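(* Let $T$ denote a proper homaloidal type of degree $d\geq 6$ and highest virtual multiplicity $d-3$. Then $T$ is one of the following, where $t\geq 2$, and all of these are proper homaloidal types: (0) if $d\equiv 0\pmod 3$, $d=3t$: (0.1) $(d;d-3,3^{2t-2},2,1^4)$; (0.2) $(d;d-3,3^{2t-3},2^4,1)$. (1) if $d\equiv 1\pmod 3$, $d=3t+1$: (1.1) $(d;d-3,3^{2t-1},2^0,1^5)$; (1.2) $(d;d-3,3^{2t-2},2^3,1^2)$. (2) if $d\equiv 2\pmod 3$, $d=3t+2$: (2.1) $(d;d-3,3^{2t-1},2^2,1^3)$; (2.2) $(d;d-3,3^{2t-2},2^5,1^0)$.
   Context: Let $k$ be an algebraically closed field. A homaloidal type of degree $d$ is a tuple of integers $(d;\mu_1,\ldots,\mu_r)$ satisfying the equations of condition $\sum\mu_i=3d-3$ and $\sum\mu_i^2=d^2-1$ (zero multiplicities are suppressed, order is irrelevant, exponents denote repetition). A plane Cremona map of degree $d$ is a birational map $\mathbb{P}^2\dashrightarrow\mathbb{P}^2$ defined by three $k$-linearly independent forms of degree $d$ in $k[x,y,z]$ without common factor; its type is given by $d$ and the virtual multiplicities of its linear system at all its base points (proper and infinitely near), where the virtual multiplicity at a point is the minimum of the multiplicities there of members of the linear system (computed after blowing up for infinitely near points). A homaloidal type is proper if there exists a plane Cremona map with this type. *)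

theory Defs
  imports "HOL-Library.Multiset" "HOL-Computational_Algebra.Polynomial"
begin

section \<open>Polynomials in two and three variables\<close>

text \<open>
  \<open>k[x][y]\<close> and \<open>k[x][y][z]\<close> as iterated polynomial rings: the outermost variable is the last one,
  so the coefficient of \<open>x ^ i * y ^ j * z ^ l\<close> in \<open>F\<close> is \<open>coeff (coeff (coeff F l) j) i\<close>.
\<close>

type_synonym 'a poly2 = "'a poly poly"
type_synonym 'a poly3 = "'a poly poly poly"

definition const2 :: "'a::comm_ring_1 \<Rightarrow> 'a poly2" where
  "const2 c = [:[:c:]:]"

definition X2 :: "'a::comm_ring_1 poly2" where "X2 = [:[:0, 1:]:]"
definition Y2 :: "'a::comm_ring_1 poly2" where "Y2 = [:0, 1:]"

definition const3 :: "'a::comm_ring_1 \<Rightarrow> 'a poly3" where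
  "const3 c = [:[:[:c:]:]:]"

definition X3 :: "'a::comm_ring_1 poly3" where "X3 = [:[:[:0, 1:]:]:]"
definition Y3 :: "'a::comm_ring_1 poly3" where "Y3 = [:[:0, 1:]:]"
definition Z3 :: "'a::comm_ring_1 poly3" where "Z3 = [:0, 1:]"

text \<open>
  Substitution \<open>f(a, b)\<close> and \<open>F(a, b, c)\<close> with values in a \<open>k\<close>-algebra \<open>'b\<close> whose structure map
  is \<open>e\<close> (always \<open>const2\<close> or \<open>const3\<close> below).
\<close>

definition eval2 :: "('a::comm_ring_1 \<Rightarrow> 'b::comm_ring_1) \<Rightarrow> 'a poly2 \<Rightarrow> 'b \<Rightarrow> 'b \<Rightarrow> 'b" where
  "eval2 e f a b = poly (map_poly (\<lambda>g. poly (map_poly e g) a) f) b"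

definition eval3 :: "('a::comm_ring_1 \<Rightarrow> 'b::comm_ring_1) \<Rightarrow> 'a poly3 \<Rightarrow> 'b \<Rightarrow> 'b \<Rightarrow> 'b \<Rightarrow> 'b" where
  "eval3 e F a b c = poly (map_poly (\<lambda>g. eval2 e g a b) F) c"

definition is_form :: "nat \<Rightarrow> 'a::comm_ring_1 poly3 \<Rightarrow> bool" where
  "is_form d F \<longleftrightarrow> (\<forall>i j l. coeff (coeff (coeff F l) j) i \<noteq> 0 \<longrightarrow> i + j + l = d)"


section \<open>Plane Cremona maps\<close>

type_synonym 'a form_triple = "'a poly3 \<times> 'a poly3 \<times> 'a poly3"

text \<open>
  \<open>composes_to_id G F\<close>: the rational map \<open>G \<circ> F\<close> is defined and is the identity of the plane,
  i.e. \<open>G(F(x, y, z)) = H * (x, y, z)\<close> with \<open>H \<noteq> 0\<close>.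
\<close>

fun composes_to_id :: "'a::idom form_triple \<Rightarrow> 'a form_triple \<Rightarrow> bool" where
  "composes_to_id (G1, G2, G3) (F1, F2, F3) \<longleftrightarrow>
     (\<exists>H. H \<noteq> 0 \<and>
        eval3 const3 G1 F1 F2 F3 = H * X3 \<and>
        eval3 const3 G2 F1 F2 F3 = H * Y3 \<and>
        eval3 const3 G3 F1 F2 F3 = H * Z3)"

fun is_form_triple :: "nat \<Rightarrow> 'a::idom form_triple \<Rightarrow> bool" where
  "is_form_triple d (F1, F2, F3) \<longleftrightarrow> is_form d F1 \<and> is_form d F2 \<and> is_form d F3"

definition birational :: "'a::idom form_triple \<Rightarrow> bool" where
  "birational F \<longleftrightarrow> (\<exists>e G. is_form_triple e G \<and> composes_to_id G F \<and> composes_to_id F G)"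

fun lin_indep :: "'a::idom form_triple \<Rightarrow> bool" where
  "lin_indep (F1, F2, F3) \<longleftrightarrow>
     (\<forall>a b c. const3 a * F1 + const3 b * F2 + const3 c * F3 = 0 \<longrightarrow> a = 0 \<and> b = 0 \<and> c = 0)"

fun no_common_factor :: "'a::idom form_triple \<Rightarrow> bool" where
  "no_common_factor (F1, F2, F3) \<longleftrightarrow> (\<forall>h. h dvd F1 \<and> h dvd F2 \<and> h dvd F3 \<longrightarrow> h dvd 1)"

definition plane_cremona :: "nat \<Rightarrow> 'a::idom form_triple \<Rightarrow> bool" where
  "plane_cremona d F \<longleftrightarrow>
     is_form_triple d F \<and> lin_indep F \<and> no_common_factor F \<and> birational F"

text \<open>The linear system of a triple, as the set of equations of its members.\<close>

fun linear_system :: "'a::idom form_triple \<Rightarrow> 'a poly3 set" where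
  "linear_system (F1, F2, F3) =
     {const3 a * F1 + const3 b * F2 + const3 c * F3 | a b c. (a, b, c) \<noteq> (0, 0, 0)}"


section \<open>Proper and infinitely near points, virtual multiplicities\<close>

text \<open>
  Each point of the projective plane is represented exactly once:
  \<open>PA a b\<close>, \<open>PB a\<close>, \<open>PC\<close> stand for \<open>(a : b : 1)\<close>, \<open>(a : 1 : 0)\<close>, \<open>(1 : 0 : 0)\<close>.
\<close>

datatype 'a proj_plane = PA 'a 'a | PB 'a | PC

text \<open>The equation of a curve in affine coordinates \<open>(x, y)\<close> centred at the given point.\<close>

fun localize :: "'a::idom proj_plane \<Rightarrow> 'a poly3 \<Rightarrow> 'a poly2" where
  "localize (PA a b) F = eval3 const2 F (X2 + const2 a) (Y2 + const2 b) 1"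
| "localize (PB a) F = eval3 const2 F (X2 + const2 a) 1 Y2"
| "localize PC F = eval3 const2 F 1 X2 Y2"

text \<open>The multiplicity at the origin of a (nonzero) equation.\<close>

definition mult_origin :: "'a::idom poly2 \<Rightarrow> nat" where
  "mult_origin f = (LEAST n. \<exists>i j. coeff (coeff f j) i \<noteq> 0 \<and> i + j = n)"

definition system_mult :: "'a::idom poly2 set \<Rightarrow> nat" where
  "system_mult V = (LEAST n. \<exists>f\<in>V. mult_origin f = n)"

text \<open>
  The exceptional curve of the blow-up of the origin is a projective line: \<open>Some a\<close> is its point in
  the direction of the tangent \<open>y = a * x\<close>, and \<open>None\<close> the one in the direction \<open>x = 0\<close>.
  Near \<open>Some a\<close> the blow-up map is \<open>(x, y) \<mapsto> (x, x * (y + a))\<close> with exceptional curve \<open>x = 0\<close>; near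
  \<open>None\<close> it is \<open>(x, y) \<mapsto> (x * y, y)\<close> with exceptional curve \<open>y = 0\<close>. In both cases the new
  coordinates are centred at the chosen point.
\<close>

fun blowup_pullback :: "'a::idom option \<Rightarrow> 'a poly2 \<Rightarrow> 'a poly2" where
  "blowup_pullback (Some a) f = eval2 const2 f X2 (X2 * (Y2 + const2 a))"
| "blowup_pullback None f = eval2 const2 f (X2 * Y2) Y2"

fun exceptional :: "'a::idom option \<Rightarrow> 'a poly2" where
  "exceptional (Some a) = X2"
| "exceptional None = Y2"

text \<open>
  The linear system on the blow-up: if \<open>m\<close> is the multiplicity of the system at the origin, the
  exceptional curve is removed exactly \<open>m\<close> times from the pullback of every member (the division
  is exact, since each member has multiplicity at least \<open>m\<close>).
\<close>

definition blowup_system :: "'a::{idom, idom_divide} option \<Rightarrow> 'a poly2 set \<Rightarrow> 'a poly2 set" where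
  "blowup_system s V = (\<lambda>f. blowup_pullback s f div exceptional s ^ system_mult V) ` V"

text \<open>
  A proper or infinitely near point: a point of the plane, followed by a list of successive
  choices of points on the exceptional curves. The list is empty for proper points, and its
  length is the order of the infinitesimal neighbourhood. Every point is represented exactly once.
\<close>

type_synonym 'a bubble_point = "'a proj_plane \<times> 'a option list"

fun virtual_mult :: "'a::{idom, idom_divide} form_triple \<Rightarrow> 'a bubble_point \<Rightarrow> nat" where
  "virtual_mult F (p, ss) =
     system_mult (fold blowup_system ss (localize p ` linear_system F))"

definition base_points :: "'a::{idom, idom_divide} form_triple \<Rightarrow> 'a bubble_point set" where
  "base_points F = {q. virtual_mult F q > 0}"


section \<open>Homaloidal types\<close>

text \<open>The tuple \<open>(d; \<mu>\<^sub>1, \<dots>, \<mu>\<^sub>r)\<close>, up to order, as the pair of \<open>d\<close> and a multiset without zeros.\<close>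

type_synonym homtype = "int \<times> int multiset"

fun homaloidal_type :: "homtype \<Rightarrow> bool" where
  "homaloidal_type (d, M) \<longleftrightarrow>
     0 \<notin># M \<and> (\<Sum>m\<in>#M. m) = 3 * d - 3 \<and> (\<Sum>m\<in>#M. m\<^sup>2) = d\<^sup>2 - 1"

text \<open>
  There are always only finitely many base points; finiteness is mentioned because \<open>mset_set\<close>
  of an infinite set is empty by convention.
\<close>

definition has_type :: "nat \<Rightarrow> 'a::{idom, idom_divide} form_triple \<Rightarrow> homtype \<Rightarrow> bool" where
  "has_type d F T \<longleftrightarrow>
     finite (base_points F) \<and>
     T = (int d, image_mset (\<lambda>q. int (virtual_mult F q)) (mset_set (base_points F)))"

text \<open>Properness over the field \<open>'k\<close>.\<close>

definition proper_homaloidal_type :: "'k::alg_closed_field itself \<Rightarrow> homtype \<Rightarrow> bool" where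
  "proper_homaloidal_type _ T \<longleftrightarrow>
     homaloidal_type T \<and>
     (\<exists>d (F :: 'k form_triple). plane_cremona d F \<and> has_type d F T)"

text \<open>The type \<open>(d; e, 3\<^sup>a, 2\<^sup>b, 1\<^sup>c)\<close>.\<close>

definition type321 :: "int \<Rightarrow> int \<Rightarrow> nat \<Rightarrow> nat \<Rightarrow> nat \<Rightarrow> homtype" where
  "type321 d e a b c =
     (d, add_mset e (replicate_mset a 3 + replicate_mset b 2 + replicate_mset c 1))"

end

theory Submission
  imports Defs "HOL-Library.Product_Plus"
begin

text \<open>
The theorem has two halves: six numerical types are the only candidates, and each of them occurs.

\<^bold>\<open>Only six types.\<close> Two base points of a plane Cremona map of degree \<open>d\<close>, proper or infinitely near,
have multiplicities with sum at most \<open>d\<close> (\<open>bezout_line\<close>). Multiplicities do not increase under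
blowing up, so one may take one of the points proper and the other one proper or in its first
neighbourhood; if the sum exceeded \<open>d\<close>, every member would vanish on the line through them, and
this line would be a common factor. Next to a point of multiplicity \<open>d - 3\<close> all other multiplicities
are therefore 1, 2 or 3. If \<open>c\<close>, \<open>b\<close>, \<open>a\<close> are their numbers, the equations of condition become
\<open>3a + 2b + c = 2d\<close> and \<open>9a + 4b + c = 6d - 10\<close>, that is \<open>b + c = 5\<close> and \<open>3a + b = 2d - 5\<close>, and for
each residue of \<open>d\<close> modulo 3 this leaves two solutions.

\<^bold>\<open>All six types occur.\<close> The maps are composites of quadratic maps. To know all base points of a
composite, infinitely near ones included, only \<^emph>\<open>ordinary\<close> systems are used: at every point of the
plane the initial forms of the members have no common zero. Blowing up such a point leaves nothing on
the exceptional curve, so all base points are proper. A quadratic map based at three points that are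
not collinear keeps a system ordinary if the sides of the triangle carry no further base points
(\<open>quadratic_step\<close>); degree and multiplicities change by the classical rule \<open>d' = 2d - m\<^sub>1 - m\<^sub>2 - m\<^sub>3\<close>,
\<open>m\<^sub>i' = d - m\<^sub>j - m\<^sub>k\<close>. With one base point of multiplicity \<open>m\<close> and two general points (\<open>attains_step\<close>) the
type \<open>(d; m, M)\<close> becomes \<open>(2d - m; d, (d - m)\<^sup>2, M)\<close>, and for \<open>m = d - 3\<close> this is \<open>(d + 3; d, 3\<^sup>2, M)\<close>:
each family climbs from \<open>t\<close> to \<open>t + 1\<close> (\<open>attains_ladder\<close>). Such steps also lead from the identity to
\<open>(2; 1\<^sup>3)\<close>, \<open>(3; 2, 1\<^sup>4)\<close> and the starting types \<open>(6; 3\<^sup>3, 2, 1\<^sup>4)\<close>, \<open>(4; 3, 1\<^sup>6)\<close>, \<open>(4; 2\<^sup>3, 1\<^sup>3)\<close>,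
\<open>(5; 3, 2\<^sup>3, 1\<^sup>3)\<close>. The two remaining ones, \<open>(6; 3\<^sup>2, 2\<^sup>4, 1)\<close> and \<open>(5; 2\<^sup>6)\<close>, come from \<open>(4; 2\<^sup>3, 1\<^sup>3)\<close> by a
quadratic map based at two or three of the simple points, so there the position of the base points
matters; \<open>special_quartic\<close> supplies a quartic map with explicit ones.

\<^bold>\<open>Method.\<close> Multiplicities and initial forms are read off from the restriction of the equations to
arcs, that is to vectors of polynomials in a parameter \<open>s\<close>. The standard quadratic map sends arcs to
arcs up to a power of \<open>s\<close>, so no local coordinates have to be transformed. Statements about all arcs
are reduced to the universal arc with indeterminate coefficients, of which the others are
specialisations.
\<close>

section \<open>Ring homomorphisms and substitution\<close>

text \<open>
Structure maps of algebras and substitutions alike. The predicate speaks about functions between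
types, so that one form can be evaluated in many different polynomial rings.
\<close>

definition is_hom :: "('a::comm_ring_1 \<Rightarrow> 'b::comm_ring_1) \<Rightarrow> bool" where
  "is_hom e \<longleftrightarrow> e 1 = 1 \<and> (\<forall>x y. e (x + y) = e x + e y) \<and> (\<forall>x y. e (x * y) = e x * e y)"

lemma is_homI: "e 1 = 1 \<Longrightarrow> (\<And>x y. e (x + y) = e x + e y) \<Longrightarrow> (\<And>x y. e (x * y) = e x * e y) \<Longrightarrow> is_hom e"
  by (simp add: is_hom_def)

lemma hom_1: "is_hom e \<Longrightarrow> e 1 = 1"
  and hom_add: "is_hom e \<Longrightarrow> e (x + y) = e x + e y"
  and hom_mult: "is_hom e \<Longrightarrow> e (x * y) = e x * e y"
  by (simp_all add: is_hom_def)

lemma hom_0: "is_hom e \<Longrightarrow> e 0 = 0"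
  using hom_add[of e 0 0] by simp

lemma hom_uminus: "is_hom e \<Longrightarrow> e (- x) = - e x"
  using hom_add[of e x "-x"] by (simp add: hom_0 eq_neg_iff_add_eq_0 add.commute)

lemma hom_diff: "is_hom e \<Longrightarrow> e (x - y) = e x - e y"
  using hom_add[of e x "-y"] by (simp add: hom_uminus)

lemma hom_power: "is_hom e \<Longrightarrow> e (x ^ n) = e x ^ n"
  by (induction n) (simp_all add: hom_1 hom_mult)

lemma hom_sum: "is_hom e \<Longrightarrow> e (sum f A) = (\<Sum>x\<in>A. e (f x))"
  by (induction A rule: infinite_finite_induct) (simp_all add: hom_0 hom_add)

lemmas hom_simps = hom_0 hom_1 hom_add hom_mult hom_uminus hom_diff hom_power hom_sum

lemma hom_comp: "is_hom h \<Longrightarrow> is_hom e \<Longrightarrow> is_hom (\<lambda>x. h (e x))"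
  by (simp add: is_hom_def)

lemma hom_id: "is_hom (\<lambda>x. x)"
  by (simp add: is_hom_def)

lemma hom_dvd: "is_hom e \<Longrightarrow> a dvd b \<Longrightarrow> e a dvd e b"
  by (metis dvd_def hom_mult)

lemma hom_const: "is_hom (\<lambda>c. [:c:])"
  by (rule is_homI) (simp_all add: one_pCons)

lemma hom_inverse:
  fixes c :: "'a::field"
  shows "is_hom e \<Longrightarrow> c \<noteq> 0 \<Longrightarrow> e (inverse c) * e c = 1"
  by (metis hom_1 hom_mult left_inverse)

lemma hom_map_poly:
  assumes "is_hom e"
  shows "is_hom (map_poly e)"
proof (rule is_homI)
  note [simp] = hom_simps[OF assms]
  show "map_poly e 1 = 1"
    by (simp add: one_pCons map_poly_pCons)
  show "map_poly e (p + q) = map_poly e p + map_poly e q" for p q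
    by (rule poly_eqI) (simp add: coeff_map_poly)
  show "map_poly e (p * q) = map_poly e p * map_poly e q" for p q
    by (rule poly_eqI) (simp add: coeff_map_poly coeff_mult)
qed

lemma hom_poly: "is_hom (\<lambda>p. poly p a)"
  by (rule is_homI) simp_all

lemma hom_eval1:
  "is_hom e \<Longrightarrow> is_hom (\<lambda>p. poly (map_poly e p) a)"
  by (rule hom_comp[OF hom_poly hom_map_poly])

lemma eval1_const: "is_hom e \<Longrightarrow> poly (map_poly e [:c:]) a = e c"
  by (simp add: map_poly_pCons hom_0)

lemma eval1_X: "is_hom e \<Longrightarrow> poly (map_poly e [:0, 1:]) a = a"
  by (simp add: map_poly_pCons hom_0 hom_1)

text \<open>
A homomorphism on a polynomial ring is determined by its values on the constants and the
indeterminate. All rules for iterated substitution below rest on this uniqueness.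
\<close>

lemma hom_poly_eq:
  assumes "is_hom h"
  shows "h p = poly (map_poly (\<lambda>c. h [:c:]) p) (h [:0, 1:])"
proof (induction p)
  case 0
  then show ?case by (simp add: hom_0 assms)
next
  case (pCons a p)
  note hc = hom_comp[OF assms hom_const]
  have "h (pCons a p) = h ([:a:] + [:0, 1:] * p)" by simp
  also have "\<dots> = h [:a:] + h [:0, 1:] * h p"
    using assms by (simp only: hom_simps)
  also have "\<dots> = poly (map_poly (\<lambda>c. h [:c:]) (pCons a p)) (h [:0, 1:])"
    using pCons hom_0[OF hc] hom_0[OF assms] by (simp add: map_poly_pCons)
  finally show ?case .
qed

lemma hom_eval2: "is_hom e \<Longrightarrow> is_hom (\<lambda>f. eval2 e f a b)"
  unfolding eval2_def by (intro hom_eval1)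

lemma hom_eval3: "is_hom e \<Longrightarrow> is_hom (\<lambda>F. eval3 e F a b c)"
  unfolding eval3_def by (intro hom_eval1 hom_eval2)

lemma hom_const2: "is_hom const2"
  unfolding const2_def by (rule hom_comp[OF hom_const hom_const])

lemma hom_const3: "is_hom const3"
  unfolding const3_def by (rule hom_comp[OF hom_const hom_comp[OF hom_const hom_const]])

lemma eval2_const: "is_hom e \<Longrightarrow> eval2 e [:g:] a b = poly (map_poly e g) a"
  and eval2_X: "is_hom e \<Longrightarrow> eval2 e X2 a b = a"
  and eval2_Y: "is_hom e \<Longrightarrow> eval2 e Y2 a b = b"
  unfolding eval2_def X2_def Y2_def by (simp_all add: eval1_const eval1_X hom_eval1)

lemma eval2_const2: "is_hom e \<Longrightarrow> eval2 e (const2 c) a b = e c"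
  unfolding const2_def by (simp add: eval2_const eval1_const)

lemma eval3_X: "is_hom e \<Longrightarrow> eval3 e X3 a b c = a"
  and eval3_Y: "is_hom e \<Longrightarrow> eval3 e Y3 a b c = b"
  and eval3_Z: "is_hom e \<Longrightarrow> eval3 e Z3 a b c = c"
  and eval3_const: "is_hom e \<Longrightarrow> eval3 e (const3 k) a b c = e k"
  unfolding eval3_def X3_def Y3_def Z3_def const3_def
  by (simp_all add: eval1_const eval1_X hom_eval2 eval2_const eval2_const2
     eval2_X[unfolded X2_def] eval2_Y[unfolded Y2_def])

lemmas eval2_simps = eval2_X eval2_Y eval2_const2
lemmas eval3_simps = eval3_X eval3_Y eval3_Z eval3_const

lemma hom_eq_eval2:
  assumes "is_hom h"
  shows "h f = eval2 (\<lambda>c. h (const2 c)) f (h X2) (h Y2)"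
proof -
  have 1: "h [:g:] = poly (map_poly (\<lambda>c. h (const2 c)) g) (h X2)" for g
    using hom_poly_eq[OF hom_comp[OF assms hom_const], of g]
    by (simp add: const2_def X2_def)
  show ?thesis
    by (subst hom_poly_eq[OF assms]) (simp add: eval2_def 1 Y2_def)
qed

lemma hom_eq_eval3:
  assumes "is_hom h"
  shows "h F = eval3 (\<lambda>c. h (const3 c)) F (h X3) (h Y3) (h Z3)"
proof -
  have 1: "h [:g:] = eval2 (\<lambda>c. h (const3 c)) g (h X3) (h Y3)" for g
    using hom_eq_eval2[OF hom_comp[OF assms hom_const], of g]
    by (simp add: const2_def const3_def X2_def X3_def Y2_def Y3_def)
  show ?thesis
    by (subst hom_poly_eq[OF assms]) (simp add: eval3_def 1 Z3_def)
qed

lemma hom_of_eval2: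
  assumes "is_hom h" "is_hom e"
  shows "h (eval2 e f a b) = eval2 (\<lambda>c. h (e c)) f (h a) (h b)"
  using hom_eq_eval2[OF hom_comp[OF assms(1) hom_eval2[OF assms(2), of a b]], of f] assms(2)
  by (simp add: eval2_simps)

lemma hom_of_eval3:
  assumes "is_hom h" "is_hom e"
  shows "h (eval3 e F a b c) = eval3 (\<lambda>k. h (e k)) F (h a) (h b) (h c)"
  using hom_eq_eval3[OF hom_comp[OF assms(1) hom_eval3[OF assms(2), of a b c]], of F] assms(2)
  by (simp add: eval3_simps)

lemma eval1_sum:
  assumes "is_hom h"
  shows "poly (map_poly h p) x = (\<Sum>i\<le>degree p. h (coeff p i) * x ^ i)"
proof -
  have "poly (map_poly h p) x = poly (map_poly h (\<Sum>i\<le>degree p. monom (coeff p i) i)) x"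
    by (simp add: poly_as_sum_of_monoms)
  also have "\<dots> = (\<Sum>i\<le>degree p. h (coeff p i) * x ^ i)"
    by (simp add: hom_sum[OF hom_eval1[OF assms]] map_poly_monom poly_monom hom_0[OF assms])
  finally show ?thesis .
qed

lemma eval3_sum:
  assumes "is_hom e"
  shows "eval3 e F a b c = (\<Sum>l\<le>degree F. \<Sum>j\<le>degree (coeff F l). \<Sum>i\<le>degree (coeff (coeff F l) j).
           e (coeff (coeff (coeff F l) j) i) * a ^ i * b ^ j * c ^ l)"
  unfolding eval3_def eval1_sum[OF hom_eval2[OF assms]]
  unfolding eval2_def eval1_sum[OF hom_eval1[OF assms]]
  unfolding eval1_sum[OF assms] by (simp add: sum_distrib_right)

section \<open>Vectors and forms\<close>

type_synonym 'a vec = "'a \<times> 'a \<times> 'a"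

fun scale :: "'a::comm_ring_1 \<Rightarrow> 'a vec \<Rightarrow> 'a vec" where
  "scale r (a, b, c) = (r * a, r * b, r * c)"

fun map_vec :: "('a \<Rightarrow> 'b) \<Rightarrow> 'a vec \<Rightarrow> 'b vec" where
  "map_vec f (a, b, c) = (f a, f b, f c)"

fun ev :: "('a::comm_ring_1 \<Rightarrow> 'b::comm_ring_1) \<Rightarrow> 'a poly3 \<Rightarrow> 'b vec \<Rightarrow> 'b" where
  "ev e F (a, b, c) = eval3 e F a b c"

lemma map_vec_map_vec: "map_vec f (map_vec g v) = map_vec (\<lambda>x. f (g x)) v"
  by (cases v) simp

lemma map_vec_id: "map_vec (\<lambda>x. x) v = v"
  by (cases v) simp

lemma map_vec_add: "is_hom e \<Longrightarrow> map_vec e (v + w) = map_vec e v + map_vec e w"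
  by (cases v; cases w) (simp add: hom_add)

lemma map_vec_scale: "is_hom e \<Longrightarrow> map_vec e (scale r v) = scale (e r) (map_vec e v)"
  by (cases v) (simp add: hom_mult)

lemma scale_add: "scale r (v + w) = scale r v + scale r w"
  by (cases v; cases w) (simp add: algebra_simps)

lemma scale_scale: "scale r (scale s v) = scale (r * s) v"
  by (cases v) (simp add: algebra_simps)

lemma scale_1: "scale 1 v = v"
  by (cases v) simp

lemma scale_0: "scale 0 v = 0"
  by (cases v) (simp add: zero_prod_def)

lemma scale_eq_0_iff: "scale (r::'a::idom) v = 0 \<longleftrightarrow> r = 0 \<or> v = 0"
  by (cases v) (auto simp: zero_prod_def)

lemma hom_ev: "is_hom e \<Longrightarrow> is_hom (\<lambda>F. ev e F v)"
  by (cases v) (simp add: hom_eval3)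

lemma hom_of_ev: "is_hom h \<Longrightarrow> is_hom e \<Longrightarrow> h (ev e F v) = ev (\<lambda>c. h (e c)) F (map_vec h v)"
  by (cases v) (simp add: hom_of_eval3)

definition XYZ :: "'a::comm_ring_1 poly3 vec" where "XYZ = (X3, Y3, Z3)"

lemma ev_const3: "is_hom e \<Longrightarrow> ev e (const3 c) v = e c"
  by (cases v) (simp add: eval3_simps)

lemma ev_XYZ: "is_hom e \<Longrightarrow> map_vec (\<lambda>g. ev e g v) XYZ = v"
  by (cases v) (simp add: eval3_simps XYZ_def)

lemma ev_at_XYZ: "ev const3 F XYZ = F"
  using hom_eq_eval3[OF hom_id, of F] by (simp add: XYZ_def)

lemma hom_eq_ev: "is_hom h \<Longrightarrow> h F = ev (\<lambda>c. h (const3 c)) F (map_vec h XYZ)"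
  using hom_eq_eval3[of h F] by (simp add: XYZ_def)

lemma ev_subst:
  assumes "is_hom e"
  shows "ev e (ev const3 F G) v = ev e F (map_vec (\<lambda>g. ev e g v) G)"
  using hom_of_ev[OF hom_ev[OF assms, of v] hom_const3, of F G] assms
  by (simp add: ev_const3)

lemma poly3_induct [case_names add monom]:
  assumes add: "\<And>F G. P F \<Longrightarrow> P G \<Longrightarrow> P (F + G)"
    and mon: "\<And>c i j l. P (monom (monom (monom c i) j) l)"
  shows "P (F :: 'a::comm_ring_1 poly3)"
proof -
  have 0: "P 0" using mon[of 0 0 0 0] by simp
  have sum: "P (sum f A)" if "\<And>x. x \<in> A \<Longrightarrow> P (f x)" for f and A :: "nat set"
    using that by (induction A rule: infinite_finite_induct) (auto intro: 0 add)
  have 1: "P (monom (monom g j) l)" for g j l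
  proof -
    have "monom (monom g j) l = (\<Sum>i\<le>degree g. monom (monom (monom (coeff g i) i) j) l)"
      by (subst poly_as_sum_of_monoms[of g, symmetric]) (simp only: monom_sum)
    then show ?thesis by (simp only:) (intro sum mon)
  qed
  have 2: "P (monom f l)" for f l
  proof -
    have "monom f l = (\<Sum>j\<le>degree f. monom (monom (coeff f j) j) l)"
      by (subst poly_as_sum_of_monoms[of f, symmetric]) (simp only: monom_sum)
    then show ?thesis by (simp only:) (intro sum 1)
  qed
  have "P (\<Sum>l\<le>degree F. monom (coeff F l) l)" by (intro sum 2)
  then show ?thesis by (simp add: poly_as_sum_of_monoms)
qed

lemma ev_monom:
  "is_hom e \<Longrightarrow> ev e (monom (monom (monom k i) j) l) (a, b, c) = e k * a ^ i * b ^ j * c ^ l"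
  by (simp add: eval3_def eval2_def map_poly_monom poly_monom hom_0 hom_eval1)

text \<open>
\<open>F(sX, sY, sZ)\<close>, with \<open>s\<close> the outermost variable: the coefficient of \<open>s ^ n\<close> is the homogeneous part
of degree \<open>n\<close> of \<open>F\<close>.
\<close>

definition dilate :: "'a::comm_ring_1 poly3 \<Rightarrow> 'a poly3 poly" where
  "dilate F = ev (\<lambda>c. [:const3 c:]) F (scale [:0, 1:] (map_vec (\<lambda>g. [:g:]) XYZ))"

lemma hom_const_const3: "is_hom (\<lambda>c. [:const3 c:])"
  by (rule hom_comp[OF hom_const hom_const3])

lemma coeff_dilate:
  "coeff (coeff (coeff (coeff (dilate F) n) l) j) i =
     (if n = i + j + l then coeff (coeff (coeff F l) j) i else 0)"
proof (induction F arbitrary: n l j i rule: poly3_induct)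
  case (add F G)
  then show ?case
    by (simp add: dilate_def hom_add[OF hom_ev[OF hom_const_const3]])
next
  case (monom c i' j' l')
  let ?M = "monom (monom (monom c i') j') l'"
  have M: "?M = const3 c * X3 ^ i' * Y3 ^ j' * Z3 ^ l'"
    using ev_at_XYZ[of ?M] unfolding XYZ_def ev_monom[OF hom_const3] by (rule sym)
  have "dilate ?M = [:0, 1:] ^ (i' + j' + l') * [:const3 c * X3 ^ i' * Y3 ^ j' * Z3 ^ l':]"
    unfolding dilate_def XYZ_def map_vec.simps scale.simps ev_monom[OF hom_const_const3]
         hom_mult[OF hom_const] hom_power[OF hom_const] power_mult_distrib power_add by (simp only: mult_ac)
  also have "\<dots> = monom ?M (i' + j' + l')"
    unfolding M[symmetric] monom_altdef[of _ "i' + j' + l'"] by simp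
  finally have "dilate ?M = monom ?M (i' + j' + l')" .
  then show ?case by (simp only: coeff_monom) auto
qed

text \<open>
Homogeneity as a functional equation. In this shape it passes to products, exact quotients and
substitutions without any computation with coefficients.
\<close>

lemma is_form_iff: "is_form d F \<longleftrightarrow> dilate F = [:0, 1:] ^ d * [:F:]"
proof -
  have "[:0, 1:] ^ d * [:F:] = monom F d"
    by (simp add: monom_altdef)
  moreover have "is_form d F \<longleftrightarrow> dilate F = monom F d"
  proof
    assume F: "is_form d F"
    show "dilate F = monom F d"
    proof (intro poly_eqI)
      fix n l j i
      show "coeff (coeff (coeff (coeff (dilate F) n) l) j) i =
          coeff (coeff (coeff (coeff (monom F d) n) l) j) i"
        unfolding coeff_dilate coeff_monom using F by (auto simp: is_form_def)
    qed
  next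
    assume g: "dilate F = monom F d"
    show "is_form d F"
      unfolding is_form_def
    proof (intro allI impI)
      fix i j l assume "coeff (coeff (coeff F l) j) i \<noteq> 0"
      then show "i + j + l = d"
        using coeff_dilate[of F d l j i] unfolding g by (auto split: if_splits)
    qed
  qed
  ultimately show ?thesis by simp
qed

text \<open>
The equation in \<open>is_form_iff\<close> is the generic case; every other one is its image under a homomorphism.
\<close>

lemma ev_form_scale:
  assumes "is_form d F" and e: "is_hom e"
  shows "ev e F (scale r v) = r ^ d * ev e F v"
proof -
  let ?h = "\<lambda>P. poly (map_poly (\<lambda>G. ev e G v) P) r"
  have h: "is_hom ?h" by (rule hom_eval1[OF hom_ev[OF e]])
  have c: "?h [:G:] = ev e G v" for G by (rule eval1_const[OF hom_ev[OF e]])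
  have s: "?h [:0, 1:] = r" by (rule eval1_X[OF hom_ev[OF e]])
  have "?h (dilate F) = ev e F (scale r v)"
    unfolding dilate_def
    by (subst hom_of_ev[OF h hom_const_const3])
       (simp only: c s ev_const3[OF e] map_vec_scale[OF h] map_vec_map_vec ev_XYZ[OF e])
  moreover have "?h ([:0, 1:] ^ d * [:F:]) = r ^ d * ev e F v"
    by (simp only: hom_mult[OF h] hom_power[OF h] c s)
  ultimately show ?thesis
    using assms(1) by (simp add: is_form_iff)
qed

lemma dilate_form:
  "is_form d F \<Longrightarrow> ev (\<lambda>c. [:const3 c:]) F (scale [:0, 1:] (map_vec (\<lambda>g. [:g:]) XYZ)) = [:0, 1:] ^ d * [:F:]"
  unfolding is_form_iff dilate_def .

lemma is_form_subst:
  assumes F: "is_form d F" and G: "is_form n G1" "is_form n G2" "is_form n G3"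
  shows "is_form (n * d) (ev const3 F (G1, G2, G3))"
proof -
  note h = hom_const_const3
  let ?v = "scale [:0, 1:] (map_vec (\<lambda>g. [:g:]) XYZ)"
  have "map_vec (\<lambda>g. ev (\<lambda>c. [:const3 c:]) g ?v) (G1, G2, G3) =
     scale ([:0, 1:] ^ n) (map_vec (\<lambda>g. [:g:]) (G1, G2, G3))"
    by (simp only: map_vec.simps scale.simps dilate_form[OF G(1)] dilate_form[OF G(2)] dilate_form[OF G(3)])
  then have "dilate (ev const3 F (G1, G2, G3)) =
     ([:0, 1:] ^ n) ^ d * ev (\<lambda>c. [:const3 c:]) F (map_vec (\<lambda>g. [:g:]) (G1, G2, G3))"
    by (simp only: dilate_def ev_subst[OF h] ev_form_scale[OF F h])
  also have "ev (\<lambda>c. [:const3 c:]) F (map_vec (\<lambda>g. [:g:]) (G1, G2, G3)) = [:ev const3 F (G1, G2, G3):]"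
    by (rule hom_of_ev[OF hom_const hom_const3, symmetric])
  finally show ?thesis by (simp only: is_form_iff power_mult)
qed

lemma is_form_mult:
  fixes F :: "'a::idom poly3"
  assumes G: "is_form n G" and "G \<noteq> 0" shows "is_form (m + n) (F * G) \<longleftrightarrow> is_form m F"
proof -
  have g: "dilate (F * G) = dilate F * ([:0, 1:] ^ n * [:G:])"
    unfolding dilate_def hom_mult[OF hom_ev[OF hom_const_const3]] dilate_form[OF G] ..
  have r: "[:0, 1:] ^ (m + n) * [:F * G:] = [:0, 1:] ^ m * [:F:] * ([:0, 1:] ^ n * [:G:])"
    by (simp only: hom_mult[OF hom_const] power_add mult_ac)
  have "[:0, 1:] ^ n * [:G:] \<noteq> 0"
    using \<open>G \<noteq> 0\<close> by simp
  then show ?thesis unfolding is_form_iff g r by (rule mult_right_cancel)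
qed

lemma is_form_X: "is_form 1 X3" and is_form_Y: "is_form 1 Y3" and is_form_Z: "is_form 1 Z3"
  unfolding is_form_iff dilate_def XYZ_def map_vec.simps scale.simps ev.simps
    eval3_simps[OF hom_const_const3] power_one_right by (rule refl)+

lemma is_form_add: "is_form d F \<Longrightarrow> is_form d G \<Longrightarrow> is_form d (F + G)"
  unfolding is_form_def coeff_add by (metis add_0)

lemma is_form_const_mult: "is_form d F \<Longrightarrow> is_form d (const3 c * F)"
  unfolding is_form_def const3_def by simp (metis mult_zero_right)

section \<open>Linear algebra in three variables\<close>

fun set_vec :: "'a vec \<Rightarrow> 'a set" where "set_vec (a, b, c) = {a, b, c}"

lemma set_map_vec: "set_vec (map_vec f v) = f ` set_vec v"
  by (cases v) simp

fun cross :: "'a::comm_ring_1 vec \<Rightarrow> 'a vec \<Rightarrow> 'a vec" where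
  "cross (a, b, c) (a', b', c') = (b * c' - c * b', c * a' - a * c', a * b' - b * a')"

fun dot :: "'a::comm_ring_1 vec \<Rightarrow> 'a vec \<Rightarrow> 'a" where
  "dot (a, b, c) (a', b', c') = a * a' + b * b' + c * c'"

definition indep :: "'a::field vec \<Rightarrow> 'a vec \<Rightarrow> bool" where
  "indep v w \<longleftrightarrow> cross v w \<noteq> 0"

lemma indep_iff:
  assumes "v \<noteq> 0" shows "indep v w \<longleftrightarrow> (\<forall>c. w \<noteq> scale c v)"
proof -
  obtain a b c a' b' c' where v: "v = (a, b, c)" and w: "w = (a', b', c')"
    by (cases v; cases w)
  have "cross v w = 0 \<longleftrightarrow> (\<exists>k. w = scale k v)"
  proof
    assume 0: "cross v w = 0"
    consider "a \<noteq> 0" | "b \<noteq> 0" | "c \<noteq> 0"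
      using assms v by (auto simp: zero_prod_def)
    then show "\<exists>k. w = scale k v"
    proof cases
      case 1 then show ?thesis using 0 unfolding v w
        by (intro exI[of _ "a' / a"]) (auto simp: zero_prod_def field_simps)
    next
      case 2 then show ?thesis using 0 unfolding v w
        by (intro exI[of _ "b' / b"]) (auto simp: zero_prod_def field_simps)
    next
      case 3 then show ?thesis using 0 unfolding v w
        by (intro exI[of _ "c' / c"]) (auto simp: zero_prod_def field_simps)
    qed
  qed (auto simp: v w zero_prod_def algebra_simps)
  then show ?thesis by (auto simp: indep_def)
qed

lemma indep_nonzero: "indep v w \<Longrightarrow> v \<noteq> 0"
  by (cases v; cases w) (auto simp: indep_def zero_prod_def)

lemma cross_scale: "cross (scale a v) (scale b w) = scale (a * b) (cross v w)"
  by (cases v; cases w) (simp add: algebra_simps)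

lemma indep_scale: "a \<noteq> 0 \<Longrightarrow> b \<noteq> 0 \<Longrightarrow> indep (scale a v) (scale b w) \<longleftrightarrow> indep v w"
  by (simp add: indep_def cross_scale scale_eq_0_iff)

section \<open>Multiplicity along arcs\<close>

text \<open>
The constants of \<open>k[X, Y, Z][r][s]\<close>, the ring over which the universal arc \<open>r v + s (X, Y, Z)\<close> lives.
\<close>

definition const_arc :: "'a::comm_ring_1 \<Rightarrow> 'a poly3 poly poly" where
  "const_arc c = [:[:const3 c:]:]"

text \<open>
Multiplicity at least \<open>m\<close> at the point of the plane given by \<open>v\<close>: vanishing to order \<open>m\<close> in \<open>s\<close> along
the universal arc. The coefficient \<open>r\<close> of \<open>v\<close> is an indeterminate because a quadratic map turns an arc
starting at \<open>v\<close> into one that starts at a multiple of the image of \<open>v\<close>, and this multiple need not be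
invertible in the ring of coefficients.
\<close>

definition mult_ge :: "'a::comm_ring_1 poly3 \<Rightarrow> 'a vec \<Rightarrow> nat \<Rightarrow> bool" where
  "mult_ge F v m \<longleftrightarrow> [:0, 1:] ^ m dvd ev const_arc F
     (scale [:[:0, 1:]:] (map_vec const_arc v) + scale [:0, 1:] (map_vec (\<lambda>g. [:[:g:]:]) XYZ))"

lemma hom_const_arc: "is_hom const_arc"
  unfolding const_arc_def by (rule hom_comp[OF hom_const hom_const_const3])

text \<open>
Specialisation of the universal arc to the arc \<open>r v + s u\<close>, for any \<open>r\<close>, \<open>s\<close>, \<open>u\<close> over any algebra.
\<close>

lemma universal_arc:
  fixes e :: "'a::comm_ring_1 \<Rightarrow> 'b::comm_ring_1"
  assumes e: "is_hom e"
  defines "h \<equiv> \<lambda>r s u P. poly (map_poly (\<lambda>Q. poly (map_poly (\<lambda>G. ev e G u) Q) r) P) s"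
  shows "is_hom (h r s u)"
    and "h r s u [:0, 1:] = s"
    and "h r s u (ev const_arc F (scale [:[:0, 1:]:] (map_vec const_arc v) + scale [:0, 1:] (map_vec (\<lambda>g. [:[:g:]:]) XYZ)))
       = ev e F (scale r (map_vec e v) + scale s u)"
proof -
  note 1 = hom_ev[OF e, of u]
  note 2 = hom_eval1[OF 1, of r]
  show h: "is_hom (h r s u)"
    unfolding h_def by (rule hom_eval1[OF 2])
  show s: "h r s u [:0, 1:] = s"
    unfolding h_def by (rule eval1_X[OF 2])
  have r: "h r s u [:[:0, 1:]:] = r"
    unfolding h_def eval1_const[OF 2] by (rule eval1_X[OF 1])
  have c: "h r s u [:[:G:]:] = ev e G u" for G
    unfolding h_def eval1_const[OF 2] by (rule eval1_const[OF 1])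
  have c5: "h r s u (const_arc c) = e c" for c
    unfolding const_arc_def c by (rule ev_const3[OF e])
  show "h r s u (ev const_arc F (scale [:[:0, 1:]:] (map_vec const_arc v) + scale [:0, 1:] (map_vec (\<lambda>g. [:[:g:]:]) XYZ)))
       = ev e F (scale r (map_vec e v) + scale s u)"
    unfolding hom_of_ev[OF h hom_const_arc] map_vec_add[OF h] map_vec_scale[OF h] map_vec_map_vec
      r s c c5 ev_XYZ[OF e] ..
qed

lemma mult_ge_arc:
  assumes "is_hom e" "mult_ge F v m"
  shows "s ^ m dvd ev e F (scale r (map_vec e v) + scale s u)"
  using hom_dvd[OF universal_arc(1)[OF assms(1), where r = r and s = s and u = u] assms(2)[unfolded mult_ge_def]]
  unfolding hom_power[OF universal_arc(1)[OF assms(1)]] universal_arc(2,3)[OF assms(1)] .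

abbreviation cvec :: "'a::comm_ring_1 vec \<Rightarrow> 'a poly vec" where
  "cvec \<equiv> map_vec (\<lambda>c. [:c:])"

abbreviation arc :: "'a::comm_ring_1 poly \<Rightarrow> 'a vec \<Rightarrow> 'a poly vec \<Rightarrow> 'a poly vec" where
  "arc r v u \<equiv> scale r (cvec v) + scale [:0, 1:] u"

abbreviation ev_arc :: "'a::comm_ring_1 poly3 \<Rightarrow> 'a poly vec \<Rightarrow> 'a poly" where
  "ev_arc \<equiv> ev (\<lambda>c. [:c:])"

text \<open>
The initial form of \<open>F\<close> at \<open>v\<close>, if the multiplicity there is \<open>m\<close>, in the direction \<open>w\<close>.
\<close>

definition lead :: "'a::comm_ring_1 poly3 \<Rightarrow> 'a vec \<Rightarrow> nat \<Rightarrow> 'a vec \<Rightarrow> 'a" where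
  "lead F v m w = coeff (ev_arc F (arc 1 v (cvec w))) m"

lemma coeff_X_power_mult: "coeff ([:0, 1:] ^ m * p) (m + n) = coeff p n"
  by (induction m) (simp_all add: mult.assoc)

lemma poly0_ev_arc:
  "poly (ev_arc F U) 0 = ev (\<lambda>c. c) F (map_vec (\<lambda>p. poly p 0) U)"
  by (subst hom_of_ev[OF hom_poly hom_const]) simp

text \<open>
Along the universal arc \<open>F\<close> is \<open>s ^ m\<close> times some \<open>Q\<close>, so on every specialisation the coefficient of
\<open>s ^ m\<close> is a value of \<open>Q\<close> at \<open>s = 0\<close>: it sees an arc only up to first order.
\<close>

lemma lead_function:
  assumes "mult_ge F v m"
  shows "\<exists>L. \<forall>r u. coeff (ev_arc F (arc r v u)) m = L (poly r 0) (map_vec (\<lambda>p. poly p 0) u)"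
proof -
  let ?h = "\<lambda>r s u P. poly (map_poly (\<lambda>Q. poly (map_poly (\<lambda>G. ev_arc G u) Q) r) P) s"
  obtain Q where Q: "ev const_arc F (scale [:[:0, 1:]:] (map_vec const_arc v) + scale [:0, 1:] (map_vec (\<lambda>g. [:[:g:]:]) XYZ))
      = [:0, 1:] ^ m * Q"
    using assms by (auto simp: mult_ge_def elim: dvdE)
  note univ = universal_arc[OF hom_const]
  define L where "L = (\<lambda>r u. poly (map_poly (\<lambda>q. poly (map_poly (\<lambda>G. ev (\<lambda>c. c) G u) q) r) Q) (0::'a))"
  have "coeff (ev_arc F (arc r v u)) m = L (poly r 0) (map_vec (\<lambda>p. poly p 0) u)" for r u
  proof -
    let ?H = "?h r [:0, 1:] u"
    have "ev_arc F (arc r v u) = [:0, 1:] ^ m * ?H Q"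
      using univ(3)[where r = r and s = "[:0, 1:]" and u = u and F = F and v = v]
      unfolding Q hom_mult[OF univ(1)] hom_power[OF univ(1)] univ(2) by (rule sym)
    then have "coeff (ev_arc F (arc r v u)) m = coeff (?H Q) 0"
      using coeff_X_power_mult[of m "?H Q" 0] by simp
    also have "\<dots> = poly (?H Q) 0"
      by (simp add: poly_0_coeff_0)
    also have "\<dots> = L (poly r 0) (map_vec (\<lambda>p. poly p 0) u)"
    proof -
      let ?u = "map_vec (\<lambda>p. poly p 0) u"
      have 1: "poly (ev_arc G u) 0 = ev (\<lambda>c. c) G ?u" for G by (rule poly0_ev_arc)
      have 2: "poly (poly (map_poly (\<lambda>G. ev_arc G u) q) r) 0 = poly (map_poly (\<lambda>G. ev (\<lambda>c. c) G ?u) q) (poly r 0)" for q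
        using hom_poly_eq[OF hom_comp[OF hom_poly[of 0] hom_eval1[OF hom_ev[OF hom_const, of u], of r]], of q]
        unfolding eval1_const[OF hom_ev[OF hom_const]] eval1_X[OF hom_ev[OF hom_const]] 1 .
      have "poly (?H Q) 0 = poly (map_poly (\<lambda>q. poly (map_poly (\<lambda>G. ev (\<lambda>c. c) G ?u) q) (poly r 0)) Q) (poly [:0, 1:] 0)"
        using hom_poly_eq[OF hom_comp[OF hom_poly[of 0] univ(1)[where r = r and s = "[:0, 1:]" and u = u]], of Q]
        unfolding univ(2) eval1_const[OF hom_eval1[OF hom_ev[OF hom_const]]] 2 .
      then show ?thesis by (simp add: L_def)
    qed
    finally show ?thesis .
  qed
  then show ?thesis by blast
qed

lemma lead_eq_arc:
  assumes "mult_ge F v m" "poly r 0 = 1"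
  shows "coeff (ev_arc F (arc r v u)) m = lead F v m (map_vec (\<lambda>p. poly p 0) u)"
proof -
  obtain L where L: "\<And>r u. coeff (ev_arc F (arc r v u)) m = L (poly r 0) (map_vec (\<lambda>p. poly p 0) u)"
    using lead_function[OF assms(1)] by blast
  show ?thesis
    unfolding lead_def L assms(2) by (simp add: map_vec_map_vec map_vec_id)
qed

lemma lead_eq_arc_scaled:
  fixes F :: "'a::field poly3"
  assumes "mult_ge F v m" "is_form d F" and c: "poly r 0 \<noteq> 0"
  shows "coeff (ev_arc F (arc r v u)) m =
    poly r 0 ^ d * lead F v m (scale (inverse (poly r 0)) (map_vec (\<lambda>p. poly p 0) u))"
proof -
  obtain L where L: "\<And>r u. coeff (ev_arc F (arc r v u)) m = L (poly r 0) (map_vec (\<lambda>p. poly p 0) u)"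
    using lead_function[OF assms(1)] by blast
  define c where "c = poly r 0"
  define w where "w = map_vec (\<lambda>p. poly p 0) u"
  have "arc [:c:] v (cvec w) = scale [:c:] (arc 1 v (cvec (scale (inverse c) w)))"
    using assms(3) by (cases v; cases w) (simp add: c_def)
  then have "ev_arc F (arc [:c:] v (cvec w)) =
      [:c:] ^ d * ev_arc F (arc 1 v (cvec (scale (inverse c) w)))"
    by (simp only: ev_form_scale[OF assms(2) hom_const])
  also have "[:c:] ^ d = [:c ^ d:]" by (simp add: poly_const_pow)
  finally have "coeff (ev_arc F (arc [:c:] v (cvec w))) m = c ^ d * lead F v m (scale (inverse c) w)"
    by (simp add: lead_def)
  moreover have "coeff (ev_arc F (arc [:c:] v (cvec w))) m = L c w"
    unfolding L by (simp add: map_vec_map_vec map_vec_id)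
  ultimately show ?thesis unfolding L by (simp add: c_def w_def)
qed

text \<open>
An ordinary point of multiplicity \<open>m\<close> of a linear system: no tangent direction is common to all
members. Vectors proportional to \<open>v\<close> give no direction at the point. For \<open>m = 0\<close> the point is not in
the base locus.
\<close>

definition ordinary :: "'a::field form_triple \<Rightarrow> 'a vec \<Rightarrow> nat \<Rightarrow> bool" where
  "ordinary F v m \<longleftrightarrow> (\<forall>G\<in>set_vec F. mult_ge G v m) \<and>
     (\<forall>w. indep v w \<longrightarrow> (\<exists>G\<in>set_vec F. lead G v m w \<noteq> 0))"

lemma is_form_triple_iff: "is_form_triple d F \<longleftrightarrow> (\<forall>G\<in>set_vec F. is_form d G)"
  by (cases F) auto

text \<open>
This is how ordinariness is applied: any arc that leaves the point may be used in place of a line.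
\<close>

lemma ordinary_arc:
  assumes F: "ordinary F v m" "is_form_triple d F"
    and r: "poly r 0 \<noteq> 0" and u: "indep v (map_vec (\<lambda>p. poly p 0) u)"
  shows "\<exists>G\<in>set_vec F. coeff (ev_arc G (arc r v u)) m \<noteq> 0"
proof -
  let ?u = "scale (inverse (poly r 0)) (map_vec (\<lambda>p. poly p 0) u)"
  have "indep v ?u"
    using indep_scale[of 1 "inverse (poly r 0)"] r u by (simp add: scale_1)
  then obtain G where G: "G \<in> set_vec F" "lead G v m ?u \<noteq> 0"
    using F(1) unfolding ordinary_def by blast
  then have "coeff (ev_arc G (arc r v u)) m \<noteq> 0"
    using lead_eq_arc_scaled[of G v m d r u] F r by (auto simp: ordinary_def is_form_triple_iff)
  then show ?thesis using G by blast
qed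

lemma mult_ge_0: "mult_ge F v 0"
  by (simp add: mult_ge_def)

lemma lead_0: "lead F v 0 w = ev (\<lambda>c. c) F v"
proof -
  have "lead F v 0 w = poly (ev_arc F (arc 1 v (cvec w))) 0"
    by (simp add: lead_def poly_0_coeff_0)
  also have "map_vec (\<lambda>p. poly p 0) (arc 1 v (cvec w)) = v"
    by (cases v; cases w) simp
  then have "poly (ev_arc F (arc 1 v (cvec w))) 0 = ev (\<lambda>c. c) F v"
    by (simp only: poly0_ev_arc)
  finally show ?thesis .
qed

lemma ex_indep: "v \<noteq> 0 \<Longrightarrow> \<exists>w. indep v w"
proof -
  assume "v \<noteq> 0"
  obtain a b c where v: "v = (a, b, c)" by (cases v)
  have "indep v (1, 0, 0) \<or> indep v (0, 1, 0) \<or> indep v (0, 0, 1)"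
    using \<open>v \<noteq> 0\<close> v by (auto simp: indep_def zero_prod_def)
  then show ?thesis by blast
qed

text \<open>
The initial form of degree 0 is the value at the point, the same in every direction.
\<close>

lemma ordinary_0_iff:
  "v \<noteq> 0 \<Longrightarrow> ordinary F v 0 \<longleftrightarrow> (\<exists>G\<in>set_vec F. ev (\<lambda>c. c) G v \<noteq> 0)"
  using ex_indep[of v] unfolding ordinary_def lead_0 by (blast intro: mult_ge_0)

section \<open>Linear changes of coordinates\<close>

fun lin :: "('a::comm_ring_1 \<Rightarrow> 'b::comm_ring_1) \<Rightarrow> 'a vec vec \<Rightarrow> 'b vec \<Rightarrow> 'b vec" where
  "lin e (p, q, r) (x, y, z) = scale x (map_vec e p) + scale y (map_vec e q) + scale z (map_vec e r)"

lemma lin_add: "lin e A (v + w) = lin e A v + lin e A w"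
proof -
  obtain p q r where "A = (p, q, r)" by (cases A)
  then show ?thesis
    by (cases v; cases w; cases p; cases q; cases r) (simp add: algebra_simps)
qed

lemma lin_scale: "lin e A (scale r v) = scale r (lin e A v)"
proof -
  obtain p q r' where "A = (p, q, r')" by (cases A)
  then show ?thesis
    by (cases v; cases p; cases q; cases r') (simp add: algebra_simps)
qed

lemma hom_lin: "is_hom h \<Longrightarrow> map_vec h (lin e A v) = lin (\<lambda>c. h (e c)) A (map_vec h v)"
proof -
  assume h: "is_hom h"
  obtain p q r where "A = (p, q, r)" by (cases A)
  then show ?thesis
    by (cases v) (simp add: map_vec_add[OF h] map_vec_scale[OF h] map_vec_map_vec)
qed

abbreviation mat :: "'a::comm_ring_1 vec vec \<Rightarrow> 'a vec \<Rightarrow> 'a vec" where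
  "mat \<equiv> lin (\<lambda>c. c)"

definition inverse_mat :: "'a::comm_ring_1 vec vec \<Rightarrow> 'a vec vec \<Rightarrow> bool" where
  "inverse_mat A B \<longleftrightarrow> (\<forall>v. mat A (mat B v) = v)"

lemma lin_unit:
  "mat (p, q, r) (1, 0, 0) = p" "mat (p, q, r) (0, 1, 0) = q"
  "mat (p, q, r) (0, 0, 1) = r"
  by (cases p; cases q; cases r; simp)+

text \<open>
An identity of matrices over the field persists in every algebra; it is checked on the columns.
\<close>

lemma inverse_mat_lin:
  assumes "inverse_mat A B" and e: "is_hom e"
  shows "lin e A (lin e B v) = v"
proof -
  obtain p q r where B: "B = (p, q, r)" by (cases B)
  obtain x y z where v: "v = (x, y, z)" by (cases v)
  have 1: "lin e A (map_vec e u) = map_vec e (mat A u)" for u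
    by (simp add: hom_lin[OF e])
  have "mat A p = (1, 0, 0)" "mat A q = (0, 1, 0)" "mat A r = (0, 0, 1)"
    using assms(1) unfolding inverse_mat_def B by (metis lin_unit)+
  then show ?thesis
    by (simp add: B v lin_add lin_scale 1 hom_0[OF e] hom_1[OF e])
qed

definition det3 :: "'a::comm_ring_1 vec vec \<Rightarrow> 'a" where
  "det3 A = (case A of (p, q, r) \<Rightarrow> dot p (cross q r))"

lemma ex_inverse_mat:
  fixes A :: "'a::field vec vec"
  assumes "det3 A \<noteq> 0"
  obtains B where "inverse_mat A B" "inverse_mat B A"
proof -
  obtain a1 a2 a3 b1 b2 b3 c1 c2 c3 where A: "A = ((a1, a2, a3), (b1, b2, b3), (c1, c2, c3))"
    by (cases A) auto
  define D where "D = inverse (det3 A)"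
  have D: "D * (a1 * (b2 * c3 - b3 * c2) + a2 * (b3 * c1 - b1 * c3) + a3 * (b1 * c2 - b2 * c1)) = 1"
    using assms by (simp add: D_def A det3_def)
  define B where "B =
   ((D * (b2 * c3 - b3 * c2), D * (c2 * a3 - c3 * a2), D * (a2 * b3 - a3 * b2)),
    (D * (b3 * c1 - b1 * c3), D * (c3 * a1 - c1 * a3), D * (a3 * b1 - a1 * b3)),
    (D * (b1 * c2 - b2 * c1), D * (c1 * a2 - c2 * a1), D * (a1 * b2 - a2 * b1)))"
  have "mat A (mat B (x, y, z)) = (x, y, z)" for x y z
    unfolding A B_def using D by (simp, intro conjI; algebra)
  moreover have "mat B (mat A (x, y, z)) = (x, y, z)" for x y z
    unfolding A B_def using D by (simp, intro conjI; algebra)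
  ultimately show ?thesis
    by (intro that[of B]) (auto simp: inverse_mat_def)
qed

definition lin_subst :: "'a::comm_ring_1 vec vec \<Rightarrow> 'a poly3 \<Rightarrow> 'a poly3" where
  "lin_subst A G = ev const3 G (lin const3 A XYZ)"

lemma ev_lin_subst:
  assumes "is_hom e" shows "ev e (lin_subst A G) v = ev e G (lin e A v)"
  unfolding lin_subst_def ev_subst[OF assms] hom_lin[OF hom_ev[OF assms]] ev_XYZ[OF assms] ev_const3[OF assms] ..

text \<open>
Proportionality would be carried back by the inverse matrix.
\<close>

lemma indep_lin:
  assumes "inverse_mat B A" "indep v w"
  shows "indep (mat A v) (mat A w)"
proof -
  let ?A = "mat A" and ?B = "mat B"
  have BA: "?B (?A x) = x" for x using assms(1) unfolding inverse_mat_def by blast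
  have v: "v \<noteq> 0" using assms(2) by (rule indep_nonzero)
  have "?B 0 = 0" using lin_scale[of "\<lambda>c. c" B 0 0] by (simp add: scale_0)
  then have "?A v \<noteq> 0" using v BA[of v] by auto
  moreover have "?A w \<noteq> scale c (?A v)" for c
    using assms(2) v BA[of w] BA[of v] by (metis indep_iff lin_scale)
  ultimately show ?thesis by (simp add: indep_iff)
qed

lemma mult_ge_lin:
  assumes "mult_ge G (mat A v) m"
  shows "mult_ge (lin_subst A G) v m"
  unfolding mult_ge_def ev_lin_subst[OF hom_const_arc] lin_add lin_scale
  using mult_ge_arc[OF hom_const_arc assms] by (simp add: hom_lin[OF hom_const_arc])

lemma lead_lin: "lead (lin_subst A G) v m w = lead G (mat A v) m (mat A w)"
  unfolding lead_def ev_lin_subst[OF hom_const] lin_add lin_scale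
  by (simp add: hom_lin[OF hom_const])

lemma ordinary_lin:
  assumes "ordinary F (mat A v) m" "inverse_mat B A"
  shows "ordinary (map_vec (lin_subst A) F) v m"
  unfolding ordinary_def set_map_vec ball_simps bex_simps lead_lin
  using assms(1) mult_ge_lin indep_lin[OF assms(2)] unfolding ordinary_def by blast

lemma is_form_lin_subst:
  assumes "is_form d G" shows "is_form d (lin_subst A G)"
proof -
  have 1: "ev e (lin_subst A G) (scale r x) = r ^ d * ev e (lin_subst A G) x" if "is_hom e" for e r x
    by (simp add: ev_lin_subst[OF that] lin_scale ev_form_scale[OF assms that])
  show ?thesis
    unfolding is_form_iff dilate_def 1[OF hom_const_const3]
    by (subst hom_of_ev[OF hom_const hom_const3, symmetric]) (simp only: ev_at_XYZ)
qed

section \<open>The standard quadratic map\<close>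

fun sigma :: "'a::comm_ring_1 vec \<Rightarrow> 'a vec" where
  "sigma (a, b, c) = (b * c, a * c, a * b)"

text \<open>
\<open>G'\<close> is the pullback of \<open>G\<close> under the standard quadratic map, freed from the edges of the triangle of
reference with the multiplicities that \<open>m\<^sub>1\<close>-, \<open>m\<^sub>2\<close>- and \<open>m\<^sub>3\<close>-fold vertices impose.
\<close>

definition strict_pullback :: "nat \<Rightarrow> nat \<Rightarrow> nat \<Rightarrow> 'a::comm_ring_1 poly3 \<Rightarrow> 'a poly3 \<Rightarrow> bool" where
  "strict_pullback m1 m2 m3 G G' \<longleftrightarrow> G' * (X3 ^ m1 * Y3 ^ m2 * Z3 ^ m3) = ev const3 G (sigma XYZ)"

lemma hom_sigma: "is_hom h \<Longrightarrow> map_vec h (sigma v) = sigma (map_vec h v)"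
  by (cases v) (simp add: hom_mult)

lemma strict_pullback_ev:
  assumes "strict_pullback m1 m2 m3 G G'" and e: "is_hom e"
  shows "ev e G' (a, b, c) * (a ^ m1 * b ^ m2 * c ^ m3) = ev e G (b * c, a * c, a * b)"
proof -
  have "ev e G' (a, b, c) * (a ^ m1 * b ^ m2 * c ^ m3) = ev e (G' * (X3 ^ m1 * Y3 ^ m2 * Z3 ^ m3)) (a, b, c)"
    unfolding hom_mult[OF hom_ev[OF e]] hom_power[OF hom_ev[OF e]] by (simp add: eval3_simps[OF e])
  also have "\<dots> = ev e G (sigma (a, b, c))"
    using assms(1) unfolding strict_pullback_def by (simp only: ev_subst[OF e] hom_sigma[OF hom_ev[OF e]] ev_XYZ[OF e])
  finally show ?thesis by simp
qed

lemma X_dvd_iff: "[:0, 1:] dvd p \<longleftrightarrow> poly p 0 = (0 :: 'a::comm_ring_1)"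
  by (metis minus_zero poly_eq_0_iff_dvd)

lemma prime_elem_X: "prime_elem ([:0, 1:] :: 'a::idom poly)"
proof (rule prime_elemI)
  show "\<not> [:0, 1:] dvd (1 :: 'a poly)" unfolding X_dvd_iff by simp
qed (simp, simp add: X_dvd_iff)

text \<open>
Powers of \<open>p\<close> are split off one by one. The primes in question are the parameter \<open>s\<close> of an arc and the
variables \<open>X\<close>, \<open>Y\<close>, \<open>Z\<close>.
\<close>

lemma prime_elem_power_dvd_mult:
  assumes "prime_elem p" "\<not> p dvd q" "p ^ n dvd q * r"
  shows "p ^ n dvd (r :: 'a::idom)"
  using assms(3)
proof (induction n)
  case (Suc n)
  have "p ^ n dvd q * r"
    using Suc.prems by (rule dvd_trans[rotated]) simp
  then have "p ^ n dvd r" by (rule Suc.IH)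
  then obtain t where t: "r = p ^ n * t" by (auto elim: dvdE)
  have "p ^ n * p dvd p ^ n * (q * t)" using Suc.prems by (simp add: t ac_simps)
  then have "p dvd q * t"
    using assms(1) by (simp add: dvd_mult_cancel_left prime_elem_def)
  then have "p dvd t" using assms by (simp add: prime_elem_dvd_mult_iff)
  then show ?case by (simp add: t mult_dvd_mono mult.commute[of p])
qed simp

lemma prime_elem_XYZ:
  "prime_elem (X3 :: 'a::idom poly3)" "prime_elem (Y3 :: 'a poly3)" "prime_elem (Z3 :: 'a poly3)"
  unfolding X3_def Y3_def Z3_def by (intro lift_prime_elem_poly prime_elem_X)+

lemma not_dvd_XYZ:
  "\<not> X3 dvd (Y3 :: 'a::idom poly3)" "\<not> X3 dvd (Z3 :: 'a poly3)" "\<not> Y3 dvd (Z3 :: 'a poly3)"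
proof -
  have 1: "\<not> P dvd Q" if "ev (\<lambda>c. c) P v = 0" "ev (\<lambda>c. c) Q v \<noteq> 0" for P Q :: "'a poly3" and v
    using hom_dvd[OF hom_ev[OF hom_id], of P Q v] that by auto
  show "\<not> X3 dvd (Y3 :: 'a::idom poly3)" "\<not> X3 dvd (Z3 :: 'a poly3)"
    using 1[of X3 "(0, 1, 1)"] by (simp_all add: eval3_simps[OF hom_id])
  show "\<not> Y3 dvd (Z3 :: 'a poly3)"
    using 1[of Y3 "(0, 0, 1)"] by (simp add: eval3_simps[OF hom_id])
qed

text \<open>
The argument \<open>(YZ, XZ, XY)\<close> of the pullback lies on the arc \<open>(YZ) e\<^sub>1 + X (0, Z, Y)\<close> with parameter \<open>X\<close>,
so an \<open>m\<^sub>1\<close>-fold point at \<open>e\<^sub>1\<close> makes the pullback divisible by \<open>X ^ m\<^sub>1\<close>. The same holds at the other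
vertices, and \<open>X\<close>, \<open>Y\<close>, \<open>Z\<close> are pairwise non-associated primes.
\<close>

lemma ex_strict_pullback:
  fixes G :: "'a::field poly3"
  assumes "mult_ge G (1, 0, 0) m1" "mult_ge G (0, 1, 0) m2" "mult_ge G (0, 0, 1) m3"
  shows "\<exists>G'. strict_pullback m1 m2 m3 G G'"
proof -
  let ?P = "ev const3 G (sigma XYZ)"
  have X: "X3 ^ m1 dvd ?P"
    using mult_ge_arc[OF hom_const3 assms(1), of X3 "Y3 * Z3" "(0, Z3, Y3)"]
    by (simp add: XYZ_def hom_0[OF hom_const3] hom_1[OF hom_const3] mult_ac)
  have Y: "Y3 ^ m2 dvd ?P"
    using mult_ge_arc[OF hom_const3 assms(2), of Y3 "X3 * Z3" "(Z3, 0, X3)"]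
    by (simp add: XYZ_def hom_0[OF hom_const3] hom_1[OF hom_const3] mult_ac)
  have Z: "Z3 ^ m3 dvd ?P"
    using mult_ge_arc[OF hom_const3 assms(3), of Z3 "X3 * Y3" "(Y3, X3, 0)"]
    by (simp add: XYZ_def hom_0[OF hom_const3] hom_1[OF hom_const3] mult_ac)
  obtain Q where Q: "?P = Z3 ^ m3 * Q" using Z by (auto elim: dvdE)
  have "\<not> Y3 dvd (Z3 ^ m3 :: 'a poly3)"
    using prime_elem_dvd_power[OF prime_elem_XYZ(2)] not_dvd_XYZ(3) by blast
  then have "Y3 ^ m2 dvd Q"
    using Y unfolding Q by (rule prime_elem_power_dvd_mult[OF prime_elem_XYZ(2)])
  then obtain R where R: "Q = Y3 ^ m2 * R" by (auto elim: dvdE)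
  have "\<not> X3 dvd (Z3 ^ m3 * Y3 ^ m2 :: 'a poly3)"
    using prime_elem_dvd_power[OF prime_elem_XYZ(1)] not_dvd_XYZ prime_elem_dvd_multD[OF prime_elem_XYZ(1)] by blast
  then have "X3 ^ m1 dvd R"
    using X unfolding Q R mult.assoc[symmetric] by (rule prime_elem_power_dvd_mult[OF prime_elem_XYZ(1)])
  then obtain G' where "R = X3 ^ m1 * G'" by (auto elim: dvdE)
  then show ?thesis
    by (intro exI[of _ G']) (simp add: strict_pullback_def Q R mult_ac)
qed

lemma is_form_strict_pullback:
  fixes G :: "'a::field poly3"
  assumes q: "strict_pullback m1 m2 m3 G G'" and G: "is_form d G" and m: "m1 + m2 + m3 \<le> 2 * d"
  shows "is_form (2 * d - m1 - m2 - m3) G'"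
proof -
  have pow: "is_form n (L ^ n)" if "is_form 1 L" "L \<noteq> 0" for L :: "'a poly3" and n
  proof (induction n)
    case 0 show ?case by (auto simp: is_form_def coeff_eq_0 one_pCons coeff_pCons split: nat.splits)
  next
    case (Suc n)
    then show ?case using is_form_mult[OF that, of n "L ^ n"] by (simp add: mult.commute)
  qed
  have n0: "X3 \<noteq> (0 :: 'a poly3)" "Y3 \<noteq> (0 :: 'a poly3)" "Z3 \<noteq> (0 :: 'a poly3)"
    by (simp_all add: X3_def Y3_def Z3_def)
  have M: "is_form (m1 + m2 + m3) (X3 ^ m1 * Y3 ^ m2 * Z3 ^ m3 :: 'a poly3)"
    using n0 pow[OF is_form_X n0(1)] pow[OF is_form_Y n0(2)] pow[OF is_form_Z n0(3)]
    by (intro is_form_mult[THEN iffD2]) simp_all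
  have 2: "is_form 2 (P * Q)" if "is_form 1 P" "is_form 1 Q" "Q \<noteq> 0" for P Q :: "'a poly3"
    using is_form_mult[OF that(2,3), of 1 P] that(1) by (simp add: numeral_2_eq_2)
  have "is_form (2 * d) (ev const3 G (sigma XYZ))"
    unfolding XYZ_def sigma.simps by (intro is_form_subst[OF G] 2 is_form_X is_form_Y is_form_Z n0)
  then have "is_form ((2 * d - m1 - m2 - m3) + (m1 + m2 + m3)) (G' * (X3 ^ m1 * Y3 ^ m2 * Z3 ^ m3))"
    using q m by (simp add: strict_pullback_def)
  then show ?thesis
    using is_form_mult[OF M] n0 by simp
qed

section \<open>Ordinary points under the standard quadratic map\<close>

text \<open>
The standard quadratic map is a local isomorphism off the triangle: its differential takes \<open>w\<close>,
written as \<open>(a\<omega>\<^sub>1, b\<omega>\<^sub>2, c\<omega>\<^sub>3)\<close>, to the componentwise multiple of the image point by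
\<open>(\<omega>\<^sub>2 + \<omega>\<^sub>3, \<omega>\<^sub>1 + \<omega>\<^sub>3, \<omega>\<^sub>1 + \<omega>\<^sub>2)\<close>, which is radial only if all \<open>\<omega>\<^sub>i\<close> are equal.
\<close>

lemma indep_sigma:
  fixes a :: "'a::field"
  assumes "a \<noteq> 0" "b \<noteq> 0" "c \<noteq> 0" "indep (a, b, c) (x, y, z)"
  shows "indep (b * c, a * c, a * b) (b * z + c * y, a * z + c * x, a * y + b * x)"
proof -
  have "a * c * (a * y + b * x) - a * b * (a * z + c * x) = a * a * (c * y - b * z)"
       "a * b * (b * z + c * y) - b * c * (a * y + b * x) = b * b * (a * z - c * x)"
       "b * c * (a * z + c * x) - a * c * (b * z + c * y) = c * c * (b * x - a * y)"
    by (simp_all add: algebra_simps)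
  then show ?thesis
    using assms by (auto simp: indep_def zero_prod_def)
qed

lemma coeff_mult_of_X_power_dvd:
  assumes "[:0, 1:] ^ m dvd p" shows "coeff (p * q) m = coeff p m * poly q 0"
proof -
  obtain r where r: "p = [:0, 1:] ^ m * r" using assms by (auto elim: dvdE)
  show ?thesis
    using coeff_X_power_mult[of m r 0] coeff_X_power_mult[of m "r * q" 0]
    by (simp add: r mult.assoc coeff_mult_0 poly_0_coeff_0)
qed

lemma X_power_dvd_arc: "mult_ge F v m \<Longrightarrow> [:0, 1:] ^ m dvd ev_arc F (arc r v u)"
  by (rule mult_ge_arc[OF hom_const])

text \<open>
Off the triangle the monomial removed from the pullback is invertible at \<open>s = 0\<close>, and the quadratic
map is a local isomorphism, so order and initial forms are those at the image point.
\<close>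

lemma sigma_torus:
  fixes F F' :: "'a::field form_triple"
  assumes q: "rel_set (strict_pullback m1 m2 m3) (set_vec F) (set_vec F')"
    and d: "is_form_triple d F"
    and v: "a \<noteq> 0" "b \<noteq> 0" "c \<noteq> 0"
    and F: "ordinary F (b * c, a * c, a * b) m"
  shows "ordinary F' (a, b, c) m"
proof -
  have ge: "mult_ge G' (a, b, c) m" if G': "G' \<in> set_vec F'" for G'
  proof -
    obtain G where G: "G \<in> set_vec F" "strict_pullback m1 m2 m3 G G'"
      using q G' unfolding rel_set_def by blast
    have mG: "mult_ge G (b * c, a * c, a * b) m" using F G unfolding ordinary_def by blast
    let ?e = "const_arc :: 'a \<Rightarrow> _"
    define r s x y z where "r = ([:[:0, 1:]:] :: 'a poly3 poly poly)" and "s = ([:0, 1:] :: 'a poly3 poly poly)"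
      and "x = ([:[:X3:]:] :: 'a poly3 poly poly)" and "y = ([:[:Y3:]:] :: 'a poly3 poly poly)"
      and "z = ([:[:Z3:]:] :: 'a poly3 poly poly)"
    define A B C where "A = r * ?e a + s * x" and "B = r * ?e b + s * y" and "C = r * ?e c + s * z"
    have "(B * C, A * C, A * B) = scale (r ^ 2) (map_vec ?e (b * c, a * c, a * b)) +
       scale s (r * ?e b * z + r * ?e c * y + s * y * z, r * ?e a * z + r * ?e c * x + s * x * z,
             r * ?e a * y + r * ?e b * x + s * x * y)"
      by (simp add: A_def B_def C_def hom_mult[OF hom_const_arc] algebra_simps power2_eq_square)
    then have "s ^ m dvd ev ?e G (B * C, A * C, A * B)"
      using mult_ge_arc[OF hom_const_arc mG] by metis
    then have dvd: "s ^ m dvd (A ^ m1 * B ^ m2 * C ^ m3) * ev ?e G' (A, B, C)"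
      unfolding strict_pullback_ev[OF G(2) hom_const_arc, symmetric] by (simp only: mult.commute)
    have nz: "poly (r * ?e k + s * t) 0 \<noteq> 0" if "k \<noteq> 0" for k t
      using that by (simp add: r_def s_def const_arc_def const3_def)
    have "\<not> s dvd A ^ m1 * B ^ m2 * C ^ m3"
      unfolding s_def X_dvd_iff using nz v unfolding A_def B_def C_def by simp
    then have "s ^ m dvd ev ?e G' (A, B, C)"
      using dvd unfolding s_def by (rule prime_elem_power_dvd_mult[OF prime_elem_X])
    then show ?thesis
      by (simp add: mult_ge_def XYZ_def A_def B_def C_def r_def s_def x_def y_def z_def)
  qed
  moreover have "\<exists>G'\<in>set_vec F'. lead G' (a, b, c) m w \<noteq> 0" if w: "indep (a, b, c) w" for w
  proof -
    obtain x y z where xyz: "w = (x, y, z)" by (cases w)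
    define s where "s = ([:0, 1:] :: 'a poly)"
    define A B C where "A = [:a:] + s * [:x:]" and "B = [:b:] + s * [:y:]" and "C = [:c:] + s * [:z:]"
    let ?u = "([:b:] * [:z:] + [:c:] * [:y:] + s * [:y:] * [:z:], [:a:] * [:z:] + [:c:] * [:x:] + s * [:x:] * [:z:],
             [:a:] * [:y:] + [:b:] * [:x:] + s * [:x:] * [:y:])"
    have ABC: "(B * C, A * C, A * B) = arc 1 (b * c, a * c, a * b) ?u"
      by (simp add: A_def B_def C_def s_def algebra_simps)
    have "poly s 0 = 0" by (simp add: s_def)
    then have "map_vec (\<lambda>p. poly p 0) ?u = (b * z + c * y, a * z + c * x, a * y + b * x)"
      by (simp add: mult.commute)
    then have "indep (b * c, a * c, a * b) (map_vec (\<lambda>p. poly p 0) ?u)"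
      using indep_sigma[OF v] w xyz by (simp only:)
    then obtain G where G: "G \<in> set_vec F" "coeff (ev_arc G (B * C, A * C, A * B)) m \<noteq> 0"
      using ordinary_arc[OF F d, of 1 ?u] unfolding ABC by auto
    obtain G' where G': "G' \<in> set_vec F'" "strict_pullback m1 m2 m3 G G'"
      using q G unfolding rel_set_def by blast
    have "(A, B, C) = arc 1 (a, b, c) (cvec w)"
      by (simp add: A_def B_def C_def xyz s_def)
    then have *: "[:0, 1:] ^ m dvd ev_arc G' (A, B, C)" "lead G' (a, b, c) m w = coeff (ev_arc G' (A, B, C)) m"
      using X_power_dvd_arc[OF ge[OF G'(1)]] unfolding lead_def by metis+
    have "coeff (ev_arc G' (A, B, C) * (A ^ m1 * B ^ m2 * C ^ m3)) m \<noteq> 0"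
      unfolding strict_pullback_ev[OF G'(2) hom_const] by (rule G(2))
    then have "lead G' (a, b, c) m w \<noteq> 0"
      unfolding coeff_mult_of_X_power_dvd[OF *(1)] *(2) by auto
    then show ?thesis using G' by blast
  qed
  ultimately show ?thesis unfolding ordinary_def by blast
qed

text \<open>
An edge is contracted to the opposite vertex, in such a way that the arc crossing the edge at
\<open>(0, b, c)\<close> in the direction \<open>e\<^sub>1\<close> leaves the vertex in the direction \<open>(0, c, b)\<close>. Ordinariness at the
vertex gives a member of exact order \<open>m\<^sub>1\<close> along the image, and this order is what the removal of
\<open>X ^ m\<^sub>1\<close> takes away.
\<close>

lemma sigma_edge:
  fixes F F' :: "'a::field form_triple"
  assumes q: "rel_set (strict_pullback m1 m2 m3) (set_vec F) (set_vec F')"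
    and d: "is_form_triple d F"
    and v: "b \<noteq> 0" "c \<noteq> 0"
    and F: "ordinary F (1, 0, 0) m1"
  shows "ordinary F' (0, b, c) 0"
proof -
  let ?u = "(0, [:c:], [:b:]) :: 'a poly vec"
  have "indep (1, 0, 0) (map_vec (\<lambda>p. poly p 0) ?u)"
    using v by (simp add: indep_def zero_prod_def)
  then obtain G where G: "G \<in> set_vec F" "coeff (ev_arc G (arc [:b * c:] (1, 0, 0) ?u)) m1 \<noteq> 0"
    using ordinary_arc[OF F d, of "[:b * c:]" ?u] v by auto
  obtain G' where G': "G' \<in> set_vec F'" "strict_pullback m1 m2 m3 G G'"
    using q G unfolding rel_set_def by blast
  let ?v = "([:0, 1:], [:b:], [:c:]) :: 'a poly vec"
  have "arc [:b * c:] (1, 0, 0) ?u = ([:b:] * [:c:], [:0, 1:] * [:c:], [:0, 1:] * [:b:])"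
    by (simp add: mult.commute)
  then have "ev_arc G (arc [:b * c:] (1, 0, 0) ?u) = ev_arc G' ?v * ([:0, 1:] ^ m1 * [:b:] ^ m2 * [:c:] ^ m3)"
    by (simp only: strict_pullback_ev[OF G'(2) hom_const])
  also have "\<dots> = [:0, 1:] ^ m1 * (ev_arc G' ?v * ([:b:] ^ m2 * [:c:] ^ m3))"
    by (simp only: mult_ac)
  finally have "ev_arc G (arc [:b * c:] (1, 0, 0) ?u) = [:0, 1:] ^ m1 * (ev_arc G' ?v * ([:b:] ^ m2 * [:c:] ^ m3))" .
  then have "coeff (ev_arc G' ?v * ([:b:] ^ m2 * [:c:] ^ m3)) 0 \<noteq> 0"
    using G(2) coeff_X_power_mult[of m1 _ 0] by (metis add.right_neutral)
  then have "poly (ev_arc G' ?v) 0 \<noteq> 0"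
    by (simp add: coeff_mult_0 poly_0_coeff_0)
  then have "ev (\<lambda>c. c) G' (0, b, c) \<noteq> 0"
    unfolding poly0_ev_arc by simp
  then show ?thesis
    using v G' by (subst ordinary_0_iff) (auto simp: zero_prod_def)
qed

text \<open>
A vertex is blown up to the opposite edge: an arc leaving \<open>e\<^sub>1\<close> in the direction \<open>(w\<^sub>2, w\<^sub>3)\<close> goes to \<open>s\<close>
times an arc that starts at \<open>(0, w\<^sub>3, w\<^sub>2)\<close>. The factor \<open>s\<close> contributes \<open>s ^ d\<close>, of which the removal of
\<open>Y ^ m\<^sub>2 * Z ^ m\<^sub>3\<close> leaves \<open>s ^ (d - m\<^sub>2 - m\<^sub>3)\<close>. A direction along an edge leads to one of the other
vertices; since initial forms see arcs only to first order, the arc may be bent off the edge there.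
\<close>

lemma sigma_vertex:
  fixes F F' :: "'a::field form_triple"
  assumes q: "rel_set (strict_pullback m1 m2 m3) (set_vec F) (set_vec F')"
    and d: "is_form_triple d F"
    and m: "m2 + m3 \<le> d"
    and edge: "\<And>b c. b \<noteq> 0 \<Longrightarrow> c \<noteq> 0 \<Longrightarrow> ordinary F (0, b, c) 0"
    and e2: "ordinary F (0, 1, 0) m2" and e3: "ordinary F (0, 0, 1) m3"
  shows "ordinary F' (1, 0, 0) (d - m2 - m3)"
proof -
  define n where "n = d - m2 - m3"
  have d_eq: "d = m2 + m3 + n" using m by (simp add: n_def)
  \<comment> \<open>the quadratic map sends an arc through the vertex to s times an arc meeting the opposite edge\<close>
  have contract: "ev e G' (A, s * B, s * C) * (A ^ m1 * B ^ m2 * C ^ m3) * s ^ (m2 + m3) =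
      s ^ n * ev e G (s * B * C, A * C, A * B) * s ^ (m2 + m3)"
    if G: "G \<in> set_vec F" "strict_pullback m1 m2 m3 G G'" and e: "is_hom e"
    for G G' A B C s and e :: "'a \<Rightarrow> 'r::comm_ring_1"
  proof -
    have "is_form d G" using d G by (simp add: is_form_triple_iff)
    have "ev e G' (A, s * B, s * C) * (A ^ m1 * B ^ m2 * C ^ m3) * s ^ (m2 + m3) =
       ev e G' (A, s * B, s * C) * (A ^ m1 * (s * B) ^ m2 * (s * C) ^ m3)"
      by (simp only: power_mult_distrib power_add mult_ac)
    also have "\<dots> = ev e G (scale s (s * B * C, A * C, A * B))"
      unfolding strict_pullback_ev[OF G(2) e] by (simp add: mult_ac)
    also have "\<dots> = s ^ n * ev e G (s * B * C, A * C, A * B) * s ^ (m2 + m3)"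
      unfolding ev_form_scale[OF \<open>is_form d G\<close> e] d_eq by (simp only: power_add mult_ac)
    finally show ?thesis .
  qed
  have ge: "mult_ge G' (1, 0, 0) n" if G': "G' \<in> set_vec F'" for G'
  proof -
    obtain G where G: "G \<in> set_vec F" "strict_pullback m1 m2 m3 G G'"
      using q G' unfolding rel_set_def by blast
    define r s x y z where "r = ([:[:0, 1:]:] :: 'a poly3 poly poly)" and "s = ([:0, 1:] :: 'a poly3 poly poly)"
      and "x = ([:[:X3:]:] :: 'a poly3 poly poly)" and "y = ([:[:Y3:]:] :: 'a poly3 poly poly)"
      and "z = ([:[:Z3:]:] :: 'a poly3 poly poly)"
    define A where "A = r + s * x"
    have "s ^ (m2 + m3) \<noteq> 0" by (simp add: s_def)
    then have "ev const_arc G' (A, s * y, s * z) * (A ^ m1 * y ^ m2 * z ^ m3) =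
        s ^ n * ev const_arc G (s * y * z, A * z, A * y)"
      by (rule mult_right_cancel[THEN iffD1]) (rule contract[OF G hom_const_arc])
    then have "s ^ n dvd (A ^ m1 * y ^ m2 * z ^ m3) * ev const_arc G' (A, s * y, s * z)"
      by (metis dvd_triv_left mult.commute)
    moreover have "\<not> s dvd A ^ m1 * y ^ m2 * z ^ m3"
      unfolding s_def X_dvd_iff by (simp add: A_def r_def s_def y_def z_def Y3_def Z3_def)
    ultimately have "s ^ n dvd ev const_arc G' (A, s * y, s * z)"
      unfolding s_def by (blast intro: prime_elem_power_dvd_mult[OF prime_elem_X])
    moreover have "scale r (const_arc 1, const_arc 0, const_arc 0) + scale s (x, y, z) = (A, s * y, s * z)"
      by (simp add: A_def hom_0[OF hom_const_arc] hom_1[OF hom_const_arc])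
    ultimately show ?thesis
      unfolding mult_ge_def XYZ_def map_vec.simps r_def[symmetric] s_def[symmetric]
        x_def[symmetric] y_def[symmetric] z_def[symmetric] by (simp only:)
  qed
  \<comment> \<open>reduction of the condition on a direction to one suitable arc\<close>
  have leadI: "\<exists>G'\<in>set_vec F'. lead G' (1, 0, 0) n (w1, w2, w3) \<noteq> 0"
    if G: "G \<in> set_vec F" "coeff (ev_arc G ([:0, 1:] * B * C, A * C, A * B)) k \<noteq> 0"
      and M: "A ^ m1 * B ^ m2 * C ^ m3 = [:0, 1:] ^ k * P" and AA: "A = 1 + [:0, 1:] * [:w1:]"
      and B: "poly B 0 = w2" and C: "poly C 0 = w3" for G A B C k P w1 w2 w3
  proof -
    let ?s = "[:0, 1:] :: 'a poly"
    obtain G' where G': "G' \<in> set_vec F'" "strict_pullback m1 m2 m3 G G'"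
      using q G unfolding rel_set_def by blast
    let ?p = "ev_arc G' (A, ?s * B, ?s * C)"
    have a: "(A, ?s * B, ?s * C) = arc 1 (1, 0, 0) ([:w1:], B, C)"
      by (simp add: AA one_pCons)
    have "?s ^ n dvd ?p" unfolding a by (rule X_power_dvd_arc[OF ge[OF G'(1)]])
    then obtain t where t: "?p = ?s ^ n * t" by (auto elim: dvdE)
    have "?p * (A ^ m1 * B ^ m2 * C ^ m3) = ?s ^ n * ev_arc G (?s * B * C, A * C, A * B)"
      using contract[OF G(1) G'(2) hom_const, of A ?s B C] by simp
    then have "?s ^ n * (?s ^ k * (t * P)) = ?s ^ n * ev_arc G (?s * B * C, A * C, A * B)"
      unfolding M t by (simp only: mult_ac)
    then have "?s ^ k * (t * P) = ev_arc G (?s * B * C, A * C, A * B)"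
      by simp
    then have "coeff (t * P) 0 \<noteq> 0"
      using G(2) coeff_X_power_mult[of k "t * P" 0] by simp
    then have "coeff t 0 \<noteq> 0" by (simp add: coeff_mult_0)
    then have "coeff ?p n \<noteq> 0"
      using coeff_X_power_mult[of n t 0] unfolding t by simp
    then have "lead G' (1, 0, 0) n (map_vec (\<lambda>p. poly p 0) ([:w1:], B, C)) \<noteq> 0"
      using lead_eq_arc[OF ge[OF G'(1)], of 1 "([:w1:], B, C)"] unfolding a by (simp only: poly_1 not_False_eq_True)
    then show ?thesis using G'(1) B C by auto
  qed
  have "\<exists>G'\<in>set_vec F'. lead G' (1, 0, 0) n w \<noteq> 0" if w: "indep (1, 0, 0) w" for w
  proof -
    obtain w1 w2 w3 where ww: "w = (w1, w2, w3)" by (cases w)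
    let ?s = "[:0, 1:] :: 'a poly"
    define A where "A = 1 + ?s * [:w1:]"
    have A0: "poly A 0 = 1" by (simp add: A_def)
    have "w2 \<noteq> 0 \<or> w3 \<noteq> 0" using w ww by (auto simp: indep_def zero_prod_def)
    then consider "w2 \<noteq> 0" "w3 \<noteq> 0" | "w2 = 0" "w3 \<noteq> 0" | "w2 \<noteq> 0" "w3 = 0" by blast
    then show ?thesis
    proof cases
      case 1
      then have nz: "(0, w3, w2) \<noteq> 0" by (simp add: zero_prod_def)
      then obtain G where G: "G \<in> set_vec F" "ev (\<lambda>c. c) G (0, w3, w2) \<noteq> 0"
        using edge[OF 1(2,1)] unfolding ordinary_0_iff[OF nz] by blast
      have "coeff (ev_arc G (?s * [:w2:] * [:w3:], A * [:w3:], A * [:w2:])) 0 \<noteq> 0"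
        unfolding poly_0_coeff_0[symmetric] poly0_ev_arc using G(2) A0 by simp
      then show ?thesis
        using leadI[OF G(1), of "[:w2:]" "[:w3:]" A 0 "A ^ m1 * [:w2:] ^ m2 * [:w3:] ^ m3" w1 w2 w3]
        by (simp add: A_def ww)
    next
      case 2
      \<comment> \<open>the arc \<open>(1 + s w\<^sub>1, s\<^sup>2, s w\<^sub>3)\<close>, bent off the edge, arrives at \<open>e\<^sub>2\<close>\<close>
      let ?u = "(?s * [:w3:], 0, A)"
      have "indep (0, 1, 0) (map_vec (\<lambda>p. poly p 0) ?u)"
        using A0 by (simp add: indep_def zero_prod_def)
      then obtain G where G: "G \<in> set_vec F" "coeff (ev_arc G (arc (A * [:w3:]) (0, 1, 0) ?u)) m2 \<noteq> 0"
        using ordinary_arc[OF e2 d, of "A * [:w3:]" ?u] 2 A0 by auto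
      have "arc (A * [:w3:]) (0, 1, 0) ?u = (?s * ?s * [:w3:], A * [:w3:], A * ?s)"
        by simp
      then show ?thesis
        using leadI[OF G(1), of "?s" "[:w3:]" A m2 "A ^ m1 * [:w3:] ^ m3" w1 0 w3] G(2) 2
        by (simp only: ww A_def mult_ac) simp
    next
      case 3
      \<comment> \<open>the arc \<open>(1 + s w\<^sub>1, s w\<^sub>2, s\<^sup>2)\<close>, bent off the edge, arrives at \<open>e\<^sub>3\<close>\<close>
      let ?u = "(?s * [:w2:], A, 0)"
      have "indep (0, 0, 1) (map_vec (\<lambda>p. poly p 0) ?u)"
        using A0 by (simp add: indep_def zero_prod_def)
      then obtain G where G: "G \<in> set_vec F" "coeff (ev_arc G (arc (A * [:w2:]) (0, 0, 1) ?u)) m3 \<noteq> 0"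
        using ordinary_arc[OF e3 d, of "A * [:w2:]" ?u] 3 A0 by auto
      have "arc (A * [:w2:]) (0, 0, 1) ?u = (?s * [:w2:] * ?s, A * ?s, A * [:w2:])"
        by simp
      then show ?thesis
        using leadI[OF G(1), of "[:w2:]" "?s" A m3 "A ^ m1 * [:w2:] ^ m2" w1 w2 0] G(2) 3
        by (simp only: ww A_def mult_ac) simp
    qed
  qed
  with ge show ?thesis unfolding ordinary_def n_def by blast
qed

(* quantified vectors stay single variables, so that facts about vectors apply to them *)
declare split_paired_Ex [simp del] split_paired_All [simp del]

section \<open>Birational maps\<close>

definition compose :: "'a::comm_ring_1 poly3 vec \<Rightarrow> 'a poly3 vec \<Rightarrow> 'a poly3 vec" where
  "compose G F = map_vec (\<lambda>g. ev const3 g F) G"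

lemma composes_to_id_iff:
  "composes_to_id G F \<longleftrightarrow> (\<exists>H. H \<noteq> 0 \<and> compose G F = scale H XYZ)"
  by (cases G; cases F) (auto simp: compose_def XYZ_def)

lemma compose_assoc: "compose (compose F G) K = compose F (compose G K)"
  by (simp add: compose_def map_vec_map_vec ev_subst[OF hom_const3])

lemma compose_XYZ: "compose XYZ F = F" "compose F XYZ = F"
  by (simp_all add: compose_def ev_XYZ[OF hom_const3] ev_at_XYZ map_vec_id)

lemma compose_scale: "compose (scale H F) G = scale (ev const3 H G) (compose F G)"
  by (simp add: compose_def map_vec_scale[OF hom_ev[OF hom_const3]])

lemma compose_sigma: "compose (sigma F) G = sigma (compose F G)"
  by (simp add: compose_def hom_sigma[OF hom_ev[OF hom_const3]])

lemma compose_lin: "compose (lin const3 A F) G = lin const3 A (compose F G)"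
  by (simp add: compose_def hom_lin[OF hom_ev[OF hom_const3]] ev_const3[OF hom_const3])

lemma compose_form_scale: "is_form_triple d F \<Longrightarrow> compose F (scale N G) = scale (N ^ d) (compose F G)"
  by (cases F) (simp add: compose_def ev_form_scale[OF _ hom_const3])

lemma map_lin_subst: "map_vec (lin_subst A) F = compose F (lin const3 A XYZ)"
  by (cases F) (simp add: compose_def lin_subst_def)

lemma XYZ_nonzero: "X3 \<noteq> (0 :: 'a::idom poly3)" "Y3 \<noteq> (0 :: 'a poly3)" "Z3 \<noteq> (0 :: 'a poly3)"
  by (simp_all add: X3_def Y3_def Z3_def)

lemma is_form_triple_lin:
  assumes "is_form_triple d G" shows "is_form_triple d (lin const3 B G)"
proof -
  obtain p q r where "B = (p, q, r)" by (cases B)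
  then show ?thesis
    using assms by (cases G; cases p; cases q; cases r)
      (simp add: is_form_add is_form_const_mult mult.commute[of _ "const3 _"])
qed

lemma is_form_triple_sigma:
  assumes "is_form_triple d G" "\<And>g. g \<in> set_vec G \<Longrightarrow> g \<noteq> 0" shows "is_form_triple (d + d) (sigma G)"
  using assms by (cases G) (auto simp: is_form_mult)

text \<open>
If \<open>G\<close> inverts \<open>F\<close>, then \<open>B \<circ> G\<close> inverts \<open>F \<circ> A\<close>.
\<close>

lemma birational_lin:
  fixes F :: "'a::idom poly3 vec"
  assumes F: "birational F" and A: "inverse_mat A B" "inverse_mat B A"
  shows "birational (map_vec (lin_subst A) F)"
proof -
  let ?A = "lin const3 A XYZ"
  obtain e G H K where G: "is_form_triple e G" and H: "H \<noteq> 0" "compose G F = scale H XYZ"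
    and K: "K \<noteq> 0" "compose F G = scale K XYZ"
    using F by (auto simp: birational_def composes_to_id_iff)
  have "lin_subst B (lin_subst A H) = H"
    using ev_lin_subst[OF hom_const3, of B "lin_subst A H" XYZ]
    by (simp add: ev_at_XYZ ev_lin_subst[OF hom_const3] inverse_mat_lin[OF A(1) hom_const3])
  then have H0: "lin_subst A H \<noteq> 0" using H(1) by (auto simp: lin_subst_def hom_0[OF hom_ev[OF hom_const3]])
  have "compose (lin const3 B G) (compose F ?A) = scale (lin_subst A H) XYZ"
    unfolding compose_lin compose_assoc[symmetric] H(2) compose_scale compose_XYZ lin_scale
      inverse_mat_lin[OF A(2) hom_const3] lin_subst_def ..
  moreover have "compose (compose F ?A) (lin const3 B G) = scale K XYZ"
    unfolding compose_assoc compose_lin compose_XYZ inverse_mat_lin[OF A(1) hom_const3] K(2) ..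
  ultimately show ?thesis
    unfolding birational_def composes_to_id_iff map_lin_subst
    using is_form_triple_lin[OF G] H0 K(1) by blast
qed

text \<open>
Removes a factor from a representation of the identity of the plane. The cross products of \<open>P\<close> with
\<open>(X, Y, Z)\<close> vanish, and \<open>Z\<close> is a prime that does not divide \<open>X\<close>, so \<open>Z\<close> divides the last component.
\<close>

lemma proportional_XYZ:
  fixes P :: "'a::idom poly3 vec"
  assumes "scale N P = scale H XYZ" "N \<noteq> 0" "H \<noteq> 0"
  shows "\<exists>K. K \<noteq> 0 \<and> P = scale K XYZ"
proof -
  obtain p q r where P: "P = (p, q, r)" by (cases P)
  have e: "N * p = H * X3" "N * q = H * Y3" "N * r = H * Z3"
    using assms(1) by (simp_all add: P XYZ_def)
  have "N * (p * Z3) = N * (r * X3)" "N * (q * Z3) = N * (r * Y3)"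
    using e by algebra+
  then have *: "p * Z3 = r * X3" "q * Z3 = r * Y3" using assms(2) by simp_all
  have "\<not> Z3 dvd (X3 :: 'a poly3)"
    by (simp add: Z3_def X_dvd_iff X3_def)
  then have "Z3 dvd r"
    using *(1) prime_elem_dvd_multD[OF prime_elem_XYZ(3)] by (metis dvd_triv_right)
  then obtain K where r: "r = K * Z3" by (metis dvdE mult.commute)
  have "p * Z3 = (K * X3) * Z3" "q * Z3 = (K * Y3) * Z3"
    using * unfolding r by algebra+
  then have "p = K * X3" "q = K * Y3" by (simp_all add: XYZ_nonzero)
  moreover have "K \<noteq> 0" using e(3) assms by (auto simp: r XYZ_nonzero)
  ultimately show ?thesis by (auto simp: P XYZ_def r)
qed

section \<open>General position\<close>

text \<open>
Over a finite field, one plus the product of all \<open>X - a\<close> would be a polynomial without a root.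
\<close>

lemma infinite_alg_closed: "infinite (UNIV :: 'a::alg_closed_field set)"
proof
  assume fin: "finite (UNIV :: 'a set)"
  define p :: "'a poly" where "p = (\<Prod>a\<in>UNIV. [:- a, 1:])"
  have "degree p = card (UNIV :: 'a set)"
    unfolding p_def by (subst degree_prod_eq_sum_degree) auto
  moreover have "card (UNIV :: 'a set) > 0" using fin by (simp add: card_gt_0_iff)
  ultimately have "degree (p + 1) > 0"
    by (simp add: degree_add_eq_left)
  then obtain x where x: "poly (p + 1) x = 0" using alg_closed_imp_poly_has_root by blast
  have "poly p x = 0" using fin by (simp add: p_def poly_prod)
  with x show False by simp
qed

lemma ex_nonroot:
  fixes p :: "'a::alg_closed_field poly"
  assumes "p \<noteq> 0" shows "\<exists>x. poly p x \<noteq> 0"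
proof (rule ccontr)
  assume "\<not> ?thesis"
  then have "{x. poly p x = 0} = UNIV" by auto
  then show False using poly_roots_finite[OF assms] by (simp add: infinite_alg_closed)
qed

lemma ex_nonzero_value:
  fixes P :: "'a::alg_closed_field poly3"
  assumes "P \<noteq> 0" shows "\<exists>v. ev (\<lambda>c. c) P v \<noteq> 0"
proof -
  obtain l where "coeff P l \<noteq> 0" using assms by (metis poly_eqI coeff_0)
  then obtain j where "coeff (coeff P l) j \<noteq> 0" by (metis poly_eqI coeff_0)
  then obtain a where a: "poly (coeff (coeff P l) j) a \<noteq> 0" using ex_nonroot by blast
  have "map_poly (\<lambda>g. poly g a) (coeff P l) \<noteq> 0"
    using a by (metis coeff_0 coeff_map_poly poly_0)
  then obtain b where b: "eval2 (\<lambda>c. c) (coeff P l) a b \<noteq> 0"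
    using ex_nonroot unfolding eval2_def by fastforce
  have "map_poly (\<lambda>g. eval2 (\<lambda>c. c) g a b) P \<noteq> 0"
    using b by (metis coeff_0 coeff_map_poly hom_0 hom_eval2 hom_id)
  then obtain c where c: "eval3 (\<lambda>c. c) P a b c \<noteq> 0"
    using ex_nonroot unfolding eval3_def by blast
  then show ?thesis by (intro exI[of _ "(a, b, c)"]) simp
qed

text \<open>
A general vector avoids the zeros of a given nonzero polynomial and finitely many given planes through
the origin, since the product of all the equations is a nonzero polynomial.
\<close>

lemma ex_general_vector:
  fixes P :: "'a::alg_closed_field poly3"
  assumes "P \<noteq> 0" "finite N" "0 \<notin> N"
  shows "\<exists>v. ev (\<lambda>c. c) P v \<noteq> 0 \<and> (\<forall>n\<in>N. dot n v \<noteq> 0)"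
proof -
  define L where "L n = (case n of (a, b, c) \<Rightarrow> const3 a * X3 + const3 b * Y3 + const3 c * Z3)" for n :: "'a vec"
  have evL: "ev (\<lambda>c. c) (L n) v = dot n v" for n v
    by (cases n; cases v) (simp add: L_def hom_simps[OF hom_eval3[OF hom_id]] eval3_simps[OF hom_id])
  have L0: "L n \<noteq> 0" if "n \<noteq> 0" for n
  proof
    assume "L n = 0"
    then have "dot n v = 0" for v using evL[of n v] by (simp add: hom_0[OF hom_ev[OF hom_id]] del: ev.simps)
    from this[of "(1, 0, 0)"] this[of "(0, 1, 0)"] this[of "(0, 0, 1)"] that show False
      by (cases n) (simp add: zero_prod_def)
  qed
  have "\<forall>n\<in>N. L n \<noteq> 0" using L0 assms(3) by metis
  then have "prod L N \<noteq> 0" using assms(2) by (simp add: prod_zero_iff)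
  then have "P * (\<Prod>n\<in>N. L n) \<noteq> 0" using assms(1) by simp
  then obtain v where v: "ev (\<lambda>c. c) (P * (\<Prod>n\<in>N. L n)) v \<noteq> 0"
    using ex_nonzero_value by blast
  have "ev (\<lambda>c. c) (prod L N) v = (\<Prod>n\<in>N. dot n v)"
    using assms(2) by (induction N rule: finite_induct)
      (simp_all add: hom_1[OF hom_ev[OF hom_id]] hom_mult[OF hom_ev[OF hom_id]] evL)
  then show ?thesis
    using v assms(2) by (auto simp: hom_mult[OF hom_ev[OF hom_id]])
qed

section \<open>Birationality of strict pullbacks\<close>

text \<open>
The standard quadratic map is dominant: if \<open>t\<^sup>2 = abc\<close>, then \<open>(t / a, t / b, t / c)\<close> is a preimage of
\<open>(a, b, c)\<close>.
\<close>

lemma subst_sigma_nonzero: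
  fixes H :: "'a::alg_closed_field poly3"
  assumes "H \<noteq> 0" shows "ev const3 H (sigma XYZ) \<noteq> 0"
proof -
  obtain v where v: "ev (\<lambda>c. c) H v \<noteq> 0" "\<forall>n\<in>{(1, 0, 0), (0, 1, 0), (0, 0, 1)}. dot n v \<noteq> 0"
    using ex_general_vector[OF assms, of "{(1, 0, 0), (0, 1, 0), (0, 0, 1)}"] by (auto simp: zero_prod_def)
  obtain a b c where abc: "v = (a, b, c)" by (cases v)
  have nz: "a \<noteq> 0" "b \<noteq> 0" "c \<noteq> 0" using v(2) by (auto simp: abc)
  obtain t where t: "t ^ 2 = a * b * c" using nth_root_exists[of 2 "a * b * c"] by auto
  have "sigma (t / a, t / b, t / c) = v"
    using nz t by (simp add: abc field_simps power2_eq_square)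
  then have "ev (\<lambda>c. c) (ev const3 H (sigma XYZ)) (t / a, t / b, t / c) \<noteq> 0"
    using v(1) by (simp only: ev_subst[OF hom_id] hom_sigma[OF hom_ev[OF hom_id]] ev_XYZ[OF hom_id] not_False_eq_True)
  then show ?thesis using hom_0[OF hom_ev[OF hom_id]] by metis
qed

text \<open>
The standard quadratic map is its own inverse up to the factor \<open>XYZ\<close>. If \<open>G\<close> inverts \<open>F\<close>, then
\<open>sigma G\<close> inverts the strict pullback of \<open>F\<close>, up to factors that \<open>proportional_XYZ\<close> removes.
\<close>

lemma birational_sigma:
  fixes F F' :: "'a::alg_closed_field poly3 vec"
  assumes F: "birational F" "is_form_triple d F"
    and F': "scale (X3 ^ m1 * Y3 ^ m2 * Z3 ^ m3) F' = compose F (sigma XYZ)"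
  shows "birational F'"
proof -
  let ?S = "sigma XYZ :: 'a poly3 vec"
  define M :: "'a poly3" where "M = X3 ^ m1 * Y3 ^ m2 * Z3 ^ m3"
  obtain e G H K where G: "is_form_triple e G" and H: "H \<noteq> 0" "compose G F = scale H XYZ"
    and K: "K \<noteq> 0" "compose F G = scale K XYZ"
    using F by (auto simp: birational_def composes_to_id_iff)
  obtain g1 g2 g3 where g: "G = (g1, g2, g3)" by (cases G)
  have "g1 \<noteq> 0 \<and> g2 \<noteq> 0 \<and> g3 \<noteq> 0"
    using H by (auto simp: g compose_def XYZ_def hom_0[OF hom_ev[OF hom_const3]] XYZ_nonzero)
  then have g0: "g1 * g2 * g3 \<noteq> 0" "\<And>x. x \<in> set_vec G \<Longrightarrow> x \<noteq> 0" by (auto simp: g)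
  have sgsc: "sigma (scale r v) = scale (r ^ 2) (sigma v)" for r and v :: "'a poly3 vec"
    by (cases v) (simp add: power2_eq_square algebra_simps)
  have sgsg: "sigma (sigma v) = scale (case v of (a, b, c) \<Rightarrow> a * b * c) v" for v :: "'a poly3 vec"
    by (cases v) (simp add: algebra_simps)
  have M0: "M \<noteq> 0" by (simp add: M_def XYZ_nonzero)
  have "scale (M ^ e) (compose G F') = compose G (compose F ?S)"
    unfolding F'[symmetric] compose_form_scale[OF G] M_def ..
  also have "\<dots> = scale (ev const3 H ?S) ?S"
    unfolding compose_assoc[symmetric] H(2) compose_scale compose_XYZ ..
  finally have "scale ((M ^ e) ^ 2) (compose (sigma G) F') = scale ((ev const3 H ?S) ^ 2) (sigma ?S)"
    unfolding compose_sigma by (metis sgsc)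
  then have 1: "scale ((M ^ e) ^ 2) (compose (sigma G) F') = scale ((ev const3 H ?S) ^ 2 * (X3 * Y3 * Z3)) XYZ"
    unfolding sgsg scale_scale by (simp add: XYZ_def)
  have K1: "\<exists>K. K \<noteq> 0 \<and> compose (sigma G) F' = scale K XYZ"
    by (rule proportional_XYZ[OF 1]) (use M0 subst_sigma_nonzero[OF H(1)] in \<open>auto simp: XYZ_nonzero\<close>)
  have "scale (ev const3 M (sigma G)) (compose F' (sigma G)) = compose (compose F ?S) (sigma G)"
    unfolding compose_scale[symmetric] M_def F' ..
  also have "\<dots> = compose F (scale (g1 * g2 * g3) G)"
    unfolding compose_assoc compose_sigma compose_XYZ sgsg by (simp add: g)
  also have "\<dots> = scale ((g1 * g2 * g3) ^ d * K) XYZ"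
    unfolding compose_form_scale[OF F(2)] K(2) scale_scale ..
  finally have 2: "scale (ev const3 M (sigma G)) (compose F' (sigma G)) = scale ((g1 * g2 * g3) ^ d * K) XYZ" .
  have "ev const3 M (sigma G) \<noteq> 0"
    unfolding M_def hom_mult[OF hom_ev[OF hom_const3]] hom_power[OF hom_ev[OF hom_const3]]
    using g0(1) by (simp add: g eval3_simps[OF hom_const3])
  then have "\<exists>K. K \<noteq> 0 \<and> compose F' (sigma G) = scale K XYZ"
    using g0(1) K(1) by (intro proportional_XYZ[OF 2]) auto
  then show ?thesis
    unfolding birational_def composes_to_id_iff using is_form_triple_sigma[OF G g0(2)] K1 by blast
qed

text \<open>
Substituting the inverse map turns a linear relation between the components into one between
\<open>X\<close>, \<open>Y\<close> and \<open>Z\<close>.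
\<close>

lemma birational_imp_lin_indep:
  fixes F :: "'a::idom poly3 vec"
  assumes "birational F" shows "lin_indep F"
proof -
  obtain G K where K: "K \<noteq> 0" "compose F G = scale K XYZ"
    using assms by (auto simp: birational_def composes_to_id_iff)
  obtain F1 F2 F3 where F: "F = (F1, F2, F3)" by (cases F)
  have "a = 0 \<and> b = 0 \<and> c = 0" if 0: "const3 a * F1 + const3 b * F2 + const3 c * F3 = 0" for a b c
  proof -
    have "ev const3 F1 G = K * X3" "ev const3 F2 G = K * Y3" "ev const3 F3 G = K * Z3"
      using K(2) by (simp_all add: F compose_def XYZ_def)
    moreover have "ev const3 (const3 a * F1 + const3 b * F2 + const3 c * F3) G = 0"
      unfolding 0 by (rule hom_0[OF hom_ev[OF hom_const3]])
    ultimately have "K * (const3 a * X3 + const3 b * Y3 + const3 c * Z3) = 0"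
      by (simp add: hom_add[OF hom_ev[OF hom_const3]] hom_mult[OF hom_ev[OF hom_const3]]
          ev_const3[OF hom_const3] algebra_simps)
    then have "const3 a * X3 + const3 b * Y3 + const3 c * Z3 = 0" using K(1) by simp
    then show ?thesis by (simp add: const3_def X3_def Y3_def Z3_def)
  qed
  then show ?thesis by (auto simp: F)
qed

section \<open>Ordinary systems\<close>

fun rep :: "'a::field proj_plane \<Rightarrow> 'a vec" where
  "rep (PA a b) = (a, b, 1)"
| "rep (PB a) = (a, 1, 0)"
| "rep PC = (1, 0, 0)"

fun pt :: "'a::field vec \<Rightarrow> 'a proj_plane" where
  "pt (a, b, c) = (if c \<noteq> 0 then PA (a / c) (b / c) else if b \<noteq> 0 then PB (a / b) else PC)"

lemma rep_nonzero: "rep p \<noteq> 0"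
  by (cases p) (auto simp: zero_prod_def)

lemma pt_rep: "pt (rep p) = p"
  by (cases p) auto

lemma pt_scale: "k \<noteq> 0 \<Longrightarrow> pt (scale k v) = pt v"
  by (cases v) auto

lemma rep_pt: "v \<noteq> 0 \<Longrightarrow> \<exists>k. k \<noteq> 0 \<and> v = scale k (rep (pt v))"
proof -
  assume "v \<noteq> 0"
  obtain a b c where v: "v = (a, b, c)" by (cases v)
  consider "c \<noteq> 0" | "c = 0" "b \<noteq> 0" | "c = 0" "b = 0" "a \<noteq> 0"
    using \<open>v \<noteq> 0\<close> by (auto simp: v zero_prod_def)
  then show ?thesis
    by cases (auto simp: v intro: exI[of _ c] exI[of _ b] exI[of _ a])
qed

definition support :: "('a::field vec \<Rightarrow> nat) \<Rightarrow> 'a proj_plane set" where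
  "support \<mu> = {p. \<mu> (rep p) \<noteq> 0}"

definition mults :: "('a::field vec \<Rightarrow> nat) \<Rightarrow> nat multiset" where
  "mults \<mu> = image_mset (\<lambda>p. \<mu> (rep p)) (mset_set (support \<mu>))"

definition projective :: "('a::field vec \<Rightarrow> nat) \<Rightarrow> bool" where
  "projective \<mu> \<longleftrightarrow> (\<forall>k v. k \<noteq> 0 \<longrightarrow> \<mu> (scale k v) = \<mu> v)"

text \<open>
The linear system of \<open>F\<close> is ordinary at every point, with the multiplicities \<open>\<mu>\<close>. The function \<open>\<mu>\<close> is
defined on homogeneous coordinates rather than on points, because it is to be composed with maps
given by formulas in coordinates.
\<close>

definition realizes :: "nat \<Rightarrow> 'a::field form_triple \<Rightarrow> ('a vec \<Rightarrow> nat) \<Rightarrow> bool" where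
  "realizes d F \<mu> \<longleftrightarrow> is_form_triple d F \<and> birational F \<and> projective \<mu> \<and> finite (support \<mu>) \<and>
     (\<forall>v. v \<noteq> 0 \<longrightarrow> ordinary F v (\<mu> v))"

lemma projectiveD: "projective \<mu> \<Longrightarrow> k \<noteq> 0 \<Longrightarrow> \<mu> (scale k v) = \<mu> v"
  by (simp add: projective_def)

lemma projective_rep_pt: "projective \<mu> \<Longrightarrow> v \<noteq> 0 \<Longrightarrow> \<mu> (rep (pt v)) = \<mu> v"
  by (metis projectiveD rep_pt)

lemma image_mset_mset_set_bij:
  assumes "bij_betw g S S'" "\<And>p. p \<in> S \<Longrightarrow> f' (g p) = f p"
  shows "image_mset f' (mset_set S') = image_mset f (mset_set S)"
proof -
  have "mset_set S' = image_mset g (mset_set S)"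
    using assms(1) by (simp add: bij_betw_def image_mset_mset_set)
  then have "image_mset f' (mset_set S') = image_mset (\<lambda>p. f' (g p)) (mset_set S)"
    by (simp add: multiset.map_comp comp_def)
  also have "\<dots> = image_mset f (mset_set S)"
    using assms(2) by (intro image_mset_cong) (cases "finite S"; simp)
  finally show ?thesis .
qed

lemma ordinary_scale:
  assumes F: "is_form_triple d F" and "k \<noteq> 0" "ordinary F v m"
  shows "ordinary F (scale k v) m"
  unfolding ordinary_def
proof (intro conjI ballI allI impI)
  fix G assume "G \<in> set_vec F"
  then have mg: "mult_ge G v m" using assms(3) by (simp add: ordinary_def)
  show "mult_ge G (scale k v) m"
    unfolding mult_ge_def map_vec_scale[OF hom_const_arc] scale_scale by (rule mult_ge_arc[OF hom_const_arc mg])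
next
  fix w assume w: "indep (scale k v) w"
  then have "indep v w" using indep_scale[of k 1 v w] assms(2) by (simp add: scale_1)
  then obtain G where "G \<in> set_vec F" "coeff (ev_arc G (arc [:k:] v (cvec w))) m \<noteq> 0"
    using ordinary_arc[OF assms(3) F, of "[:k:]" "cvec w"] assms(2)
    by (auto simp: map_vec_map_vec map_vec_id)
  moreover have "arc [:k:] v (cvec w) = arc 1 (scale k v) (cvec w)"
    by (simp only: map_vec_scale[OF hom_const] scale_1)
  ultimately show "\<exists>G\<in>set_vec F. lead G (scale k v) m w \<noteq> 0"
    unfolding lead_def by metis
qed

lemma lin_0: "lin e A 0 = 0"
  using lin_scale[of e A 0 0] by (simp only: scale_0)

lemma lin_inverse_nonzero:
  assumes "inverse_mat B A" "v \<noteq> 0" shows "mat A v \<noteq> 0"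
proof
  assume 0: "mat A v = 0"
  have "v = mat B 0" using assms(1) 0 by (metis inverse_mat_def)
  then show False using assms(2) by (simp add: lin_0)
qed

lemma realizes_lin:
  fixes F :: "'a::field form_triple"
  assumes F: "realizes d F \<mu>" and A: "inverse_mat A B" "inverse_mat B A"
  defines "\<nu> \<equiv> \<lambda>v. \<mu> (mat A v)"
  shows "realizes d (map_vec (lin_subst A) F) \<nu>" "mults \<nu> = mults \<mu>"
proof -
  let ?A = "mat A" and ?B = "mat B"
  have \<mu>: "projective \<mu>" and fin: "finite (support \<mu>)" using F by (simp_all add: realizes_def)
  have \<nu>: "projective \<nu>" using \<mu> by (simp add: \<nu>_def projective_def lin_scale)
  have pt: "pt (mat M (rep (pt (mat N (rep p))))) = p"
    if "inverse_mat M N" for M N :: "'a vec vec" and p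
  proof -
    let ?v = "mat N (rep p)"
    have "?v \<noteq> 0" by (rule lin_inverse_nonzero[OF that rep_nonzero])
    then obtain k where k: "k \<noteq> 0" "?v = scale k (rep (pt ?v))" using rep_pt by blast
    have "rep p = mat M ?v" using that by (simp add: inverse_mat_def)
    also have "\<dots> = scale k (mat M (rep (pt ?v)))" by (subst k(2)) (simp only: lin_scale)
    finally show ?thesis using pt_scale[OF k(1)] pt_rep by metis
  qed
  have val: "\<mu> (rep (pt (?A (rep p)))) = \<nu> (rep p)" "\<nu> (rep (pt (?B (rep p)))) = \<mu> (rep p)" for p
  proof -
    show "\<mu> (rep (pt (?A (rep p)))) = \<nu> (rep p)"
      unfolding \<nu>_def by (rule projective_rep_pt[OF \<mu> lin_inverse_nonzero[OF A(2) rep_nonzero]])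
    show "\<nu> (rep (pt (?B (rep p)))) = \<mu> (rep p)"
      using projective_rep_pt[OF \<nu> lin_inverse_nonzero[OF A(1) rep_nonzero[of p]]] A(1)
      by (simp add: \<nu>_def inverse_mat_def)
  qed
  have bij: "bij_betw (\<lambda>p. pt (?A (rep p))) (support \<nu>) (support \<mu>)"
    by (rule bij_betw_byWitness[where f' = "\<lambda>p. pt (?B (rep p))"])
       (auto simp: support_def pt[OF A(1)] pt[OF A(2)] val)
  show "mults \<nu> = mults \<mu>"
    unfolding mults_def by (rule image_mset_mset_set_bij[OF bij, symmetric]) (rule val(1))
  have "finite (support \<nu>)" using bij fin by (simp add: bij_betw_finite)
  moreover have "is_form_triple d (map_vec (lin_subst A) F)"
    using F by (auto simp: realizes_def is_form_triple_iff set_map_vec is_form_lin_subst)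
  moreover have "ordinary (map_vec (lin_subst A) F) v (\<nu> v)" if "v \<noteq> 0" for v
    using F lin_inverse_nonzero[OF A(2) that] ordinary_lin[OF _ A(2)] unfolding \<nu>_def realizes_def by blast
  moreover have "birational (map_vec (lin_subst A) F)"
    using F A by (auto simp: realizes_def intro: birational_lin)
  ultimately show "realizes d (map_vec (lin_subst A) F) \<nu>" using \<nu> by (simp add: realizes_def)
qed

text \<open>
The cyclic permutation of the coordinates, which reduces statements about the three vertices or edges
to statements about one.
\<close>

definition rot :: "'a::field vec vec" where "rot = ((0, 0, 1), (1, 0, 0), (0, 1, 0))"
definition rot' :: "'a::field vec vec" where "rot' = ((0, 1, 0), (0, 0, 1), (1, 0, 0))"

lemma lin_rot: "is_hom e \<Longrightarrow> lin e rot (a, b, c) = (b, c, a)"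
  and lin_rot': "is_hom e \<Longrightarrow> lin e rot' (a, b, c) = (c, a, b)"
  by (simp_all add: rot_def rot'_def hom_0 hom_1)

lemma inverse_rot:
  "inverse_mat (rot :: 'a::field vec vec) rot'" "inverse_mat (rot' :: 'a vec vec) rot"
proof -
  have "mat rot (mat rot' v) = v" for v :: "'a vec"
    by (cases v) (simp only: lin_rot[OF hom_id] lin_rot'[OF hom_id])
  moreover have "mat rot' (mat rot v) = v" for v :: "'a vec"
    by (cases v) (simp only: lin_rot[OF hom_id] lin_rot'[OF hom_id])
  ultimately show "inverse_mat rot (rot' :: 'a vec vec)" "inverse_mat rot' (rot :: 'a vec vec)"
    by (simp_all add: inverse_mat_def)
qed

lemma lin_subst_rot': "lin_subst rot' (lin_subst rot G) = G"
  using ev_lin_subst[OF hom_const3, of rot' "lin_subst rot G" XYZ]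
  by (simp add: ev_at_XYZ ev_lin_subst[OF hom_const3] inverse_mat_lin[OF inverse_rot(1) hom_const3])

lemma ordinary_rot:
  "ordinary (map_vec (lin_subst rot) F) (a, b, c) m \<longleftrightarrow> ordinary F (b, c, a) m"
proof
  assume "ordinary F (b, c, a) m"
  then show "ordinary (map_vec (lin_subst rot) F) (a, b, c) m"
    by (intro ordinary_lin[OF _ inverse_rot(2)]) (simp only: lin_rot[OF hom_id])
next
  assume "ordinary (map_vec (lin_subst rot) F) (a, b, c) m"
  then have "ordinary (map_vec (lin_subst rot') (map_vec (lin_subst rot) F)) (b, c, a) m"
    by (intro ordinary_lin[OF _ inverse_rot(1)]) (simp only: lin_rot'[OF hom_id])
  then show "ordinary F (b, c, a) m"
    by (simp add: map_vec_map_vec lin_subst_rot' map_vec_id)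
qed

lemma strict_pullback_rot:
  assumes "strict_pullback m1 m2 m3 G G'" shows "strict_pullback m3 m1 m2 (lin_subst rot G) (lin_subst rot G')"
proof -
  note [simp] = ev_lin_subst[OF hom_const3] lin_rot[OF hom_const3]
  have 1: "lin_subst rot G' = ev const3 G' (Y3, Z3, X3)"
    using ev_at_XYZ[of "lin_subst rot G'"] by (simp add: XYZ_def del: ev.simps)
  have 2: "ev const3 (lin_subst rot G) (sigma XYZ) = ev const3 G (X3 * Z3, X3 * Y3, Y3 * Z3)"
    by (simp add: XYZ_def del: ev.simps)
  show ?thesis
    unfolding strict_pullback_def 1 2 using strict_pullback_ev[OF assms hom_const3, of Y3 Z3 X3] by (simp add: mult_ac del: ev.simps)
qed

lemma rel_set_strict_pullback_rot:
  assumes "rel_set (strict_pullback m1 m2 m3) (set_vec F) (set_vec F')"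
  shows "rel_set (strict_pullback m3 m1 m2) (set_vec (map_vec (lin_subst rot) F)) (set_vec (map_vec (lin_subst rot) F'))"
  using assms strict_pullback_rot unfolding rel_set_def set_map_vec by blast

lemma is_form_triple_rot:
  "is_form_triple d F \<Longrightarrow> is_form_triple d (map_vec (lin_subst rot) F)"
  by (auto simp: is_form_triple_iff set_map_vec is_form_lin_subst)

section \<open>The standard quadratic map on ordinary systems\<close>

text \<open>
The classical rule for multiplicities under a quadratic map. The quadratic map contracts the edges of
the triangle of reference, so their points, apart from the vertices, do not become base points.
\<close>

fun pullback_mult :: "nat \<Rightarrow> ('a::field vec \<Rightarrow> nat) \<Rightarrow> 'a vec \<Rightarrow> nat" where
  "pullback_mult d \<mu> (a, b, c) =
     (if a \<noteq> 0 \<and> b \<noteq> 0 \<and> c \<noteq> 0 then \<mu> (b * c, a * c, a * b)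
      else if b = 0 \<and> c = 0 then d - \<mu> (0, 1, 0) - \<mu> (0, 0, 1)
      else if c = 0 \<and> a = 0 then d - \<mu> (0, 0, 1) - \<mu> (1, 0, 0)
      else if a = 0 \<and> b = 0 then d - \<mu> (1, 0, 0) - \<mu> (0, 1, 0)
      else 0)"

definition clean_edges :: "('a::field vec \<Rightarrow> nat) \<Rightarrow> bool" where
  "clean_edges \<mu> \<longleftrightarrow> (\<forall>b c. b \<noteq> 0 \<longrightarrow> c \<noteq> 0 \<longrightarrow> \<mu> (0, b, c) = 0 \<and> \<mu> (b, 0, c) = 0 \<and> \<mu> (b, c, 0) = 0)"

lemma mults_split:
  assumes fin: "finite (support \<mu>)" and clean: "clean_edges \<mu>"
  defines "T \<equiv> {PA a b | a b. a \<noteq> 0 \<and> b \<noteq> 0}"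
  shows "mults \<mu> = image_mset (\<lambda>p. \<mu> (rep p)) (mset_set (support \<mu> \<inter> T)) +
    filter_mset (\<lambda>m. m \<noteq> 0) {#\<mu> (1, 0, 0), \<mu> (0, 1, 0), \<mu> (0, 0, 1)#}"
proof -
  let ?V = "{PC, PB 0, PA 0 0} :: 'a proj_plane set"
  have "p \<in> T \<union> ?V" if "p \<in> support \<mu>" for p
    using that clean by (cases p) (auto simp: support_def T_def clean_edges_def)
  then have "support \<mu> = (support \<mu> \<inter> T) \<union> (support \<mu> \<inter> ?V)" by blast
  then have "mset_set (support \<mu>) = mset_set ((support \<mu> \<inter> T) \<union> (support \<mu> \<inter> ?V))" by simp
  also have "\<dots> = mset_set (support \<mu> \<inter> T) + mset_set (support \<mu> \<inter> ?V)"
    using fin by (intro mset_set_Union) (auto simp: T_def)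
  also have "support \<mu> \<inter> ?V = {p \<in> ?V. \<mu> (rep p) \<noteq> 0}" by (auto simp: support_def)
  also have "mset_set {p \<in> ?V. \<mu> (rep p) \<noteq> 0} = filter_mset (\<lambda>p. \<mu> (rep p) \<noteq> 0) (mset_set ?V)"
    by (rule filter_mset_mset_set[symmetric]) simp
  also have "mset_set ?V = {#PC, PB 0, PA 0 0#}" by simp
  finally show ?thesis by (simp add: mults_def)
qed

text \<open>
On points with nonzero coordinates the standard quadratic map is the involution
\<open>(a : b : 1) \<mapsto> (1/a : 1/b : 1)\<close>, so there the multiplicities are permuted; the vertices are accounted
for separately.
\<close>

lemma sigma_step:
  fixes F :: "'a::alg_closed_field form_triple"
  assumes F: "realizes d F \<mu>" and clean: "clean_edges \<mu>"
    and m: "\<mu> (1, 0, 0) = m1" "\<mu> (0, 1, 0) = m2" "\<mu> (0, 0, 1) = m3"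
    and le: "m1 + m2 \<le> d" "m2 + m3 \<le> d" "m1 + m3 \<le> d"
  shows "\<exists>F'. realizes (2 * d - m1 - m2 - m3) F' (pullback_mult d \<mu>)"
    and "mults (pullback_mult d \<mu>) + filter_mset (\<lambda>m. m \<noteq> 0) {#m1, m2, m3#} =
      mults \<mu> + filter_mset (\<lambda>m. m \<noteq> 0) {#d - m2 - m3, d - m3 - m1, d - m1 - m2#}"
proof -
  let ?\<nu> = "pullback_mult d \<mu>"
  have \<mu>: "projective \<mu>" and fin: "finite (support \<mu>)" and d: "is_form_triple d F" and bir: "birational F"
    and ord: "\<And>v. v \<noteq> 0 \<Longrightarrow> ordinary F v (\<mu> v)"
    using F by (auto simp: realizes_def)
  have \<nu>: "projective ?\<nu>"
    unfolding projective_def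
  proof (intro allI impI)
    fix k :: 'a and v :: "'a vec" assume k: "k \<noteq> 0"
    obtain a b c where v: "v = (a, b, c)" by (cases v)
    have eq: "(k * b * (k * c), k * a * (k * c), k * a * (k * b)) = scale (k * k) (b * c, a * c, a * b)"
      by (simp add: algebra_simps)
    then have "\<mu> (k * b * (k * c), k * a * (k * c), k * a * (k * b)) = \<mu> (b * c, a * c, a * b)"
      unfolding eq using projectiveD[OF \<mu>, of "k * k"] k by (simp del: scale.simps)
    then show "?\<nu> (scale k v) = ?\<nu> v"
      using k by (simp add: v)
  qed
  have clean': "clean_edges ?\<nu>" by (simp add: clean_edges_def)
  define T where "T = {PA a b | a b. a \<noteq> (0::'a) \<and> b \<noteq> (0::'a)}"
  define g :: "'a proj_plane \<Rightarrow> 'a proj_plane"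
    where "g p = (case p of PA a b \<Rightarrow> PA (inverse a) (inverse b) | _ \<Rightarrow> p)" for p
  have gT: "g p \<in> T" "g (g p) = p" "?\<nu> (rep p) = \<mu> (rep (g p))" if pT: "p \<in> T" for p
  proof -
    obtain a b where p: "p = PA a b" "a \<noteq> 0" "b \<noteq> 0" using pT by (auto simp: T_def)
    show "g p \<in> T" "g (g p) = p" using p by (auto simp: g_def T_def)
    have "(b, a, a * b) = scale (a * b) (inverse a, inverse b, 1)" using p by simp
    then have "\<mu> (b, a, a * b) = \<mu> (inverse a, inverse b, 1)"
      using projectiveD[OF \<mu>] p by (metis mult_eq_0_iff)
    then show "?\<nu> (rep p) = \<mu> (rep (g p))" using p by (simp add: g_def)
  qed
  have bij: "bij_betw g (support ?\<nu> \<inter> T) (support \<mu> \<inter> T)"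
  proof (rule bij_betw_byWitness[where f' = g])
    show "g ` (support \<mu> \<inter> T) \<subseteq> support ?\<nu> \<inter> T"
      using gT gT(3)[OF gT(1)] by (auto simp: support_def)
  qed (use gT in \<open>auto simp: support_def\<close>)
  have fin': "finite (support ?\<nu>)"
  proof (rule finite_subset)
    show "support ?\<nu> \<subseteq> (support ?\<nu> \<inter> T) \<union> {PC, PB 0, PA 0 0}"
    proof
      fix p assume "p \<in> support ?\<nu>"
      then show "p \<in> (support ?\<nu> \<inter> T) \<union> {PC, PB 0, PA 0 0}"
        by (cases p) (auto simp: support_def T_def split: if_splits)
    qed
    have "finite (support ?\<nu> \<inter> T)" using bij_betw_finite[OF bij] fin by simp
    then show "finite ((support ?\<nu> \<inter> T) \<union> {PC, PB 0, PA 0 0})" by simp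
  qed
  have "image_mset (\<lambda>p. \<mu> (rep p)) (mset_set (support \<mu> \<inter> T)) =
     image_mset (\<lambda>p. ?\<nu> (rep p)) (mset_set (support ?\<nu> \<inter> T))"
    using gT(3) by (intro image_mset_mset_set_bij[OF bij]) simp
  then show "mults ?\<nu> + filter_mset (\<lambda>m. m \<noteq> 0) {#m1, m2, m3#} =
      mults \<mu> + filter_mset (\<lambda>m. m \<noteq> 0) {#d - m2 - m3, d - m3 - m1, d - m1 - m2#}"
    using mults_split[OF fin clean] mults_split[OF fin' clean'] m by (simp add: T_def)

  have unit: "(1, 0, 0) \<noteq> (0 :: 'a vec)" "(0, 1, 0) \<noteq> (0 :: 'a vec)" "(0, 0, 1) \<noteq> (0 :: 'a vec)"
    by (simp_all add: zero_prod_def)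
  have e1: "ordinary F (1, 0, 0) m1" and e2: "ordinary F (0, 1, 0) m2" and e3: "ordinary F (0, 0, 1) m3"
    using ord unit m by metis+
  have "\<exists>G'. strict_pullback m1 m2 m3 G G'" if "G \<in> set_vec F" for G
    using ex_strict_pullback e1 e2 e3 that unfolding ordinary_def by blast
  then obtain Q where Q: "\<And>G. G \<in> set_vec F \<Longrightarrow> strict_pullback m1 m2 m3 G (Q G)" by metis
  define F' where "F' = map_vec Q F"
  have q: "rel_set (strict_pullback m1 m2 m3) (set_vec F) (set_vec F')"
    using Q unfolding rel_set_def F'_def set_map_vec by blast
  have "scale (X3 ^ m1 * Y3 ^ m2 * Z3 ^ m3) F' = compose F (sigma XYZ)"
    using Q by (cases F) (auto simp: F'_def compose_def strict_pullback_def mult.commute)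
  then have bir': "birational F'" by (rule birational_sigma[OF bir d])
  have form': "is_form_triple (2 * d - m1 - m2 - m3) F'"
    unfolding is_form_triple_iff
  proof
    fix G' assume "G' \<in> set_vec F'"
    then obtain G where "G \<in> set_vec F" "strict_pullback m1 m2 m3 G G'" using q unfolding rel_set_def by blast
    then show "is_form (2 * d - m1 - m2 - m3) G'"
      using d le by (intro is_form_strict_pullback) (auto simp: is_form_triple_iff)
  qed
  let ?R = "map_vec (lin_subst (rot :: 'a vec vec))"
  note q2 = rel_set_strict_pullback_rot[OF q] and d2 = is_form_triple_rot[OF d]
  note q3 = rel_set_strict_pullback_rot[OF q2] and d3 = is_form_triple_rot[OF d2]
  have edge: "ordinary F (0, b, c) 0" "ordinary F (b, 0, c) 0" "ordinary F (b, c, 0) 0"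
    if "b \<noteq> 0" "c \<noteq> 0" for b c
    using that clean ord[of "(0, b, c)"] ord[of "(b, 0, c)"] ord[of "(b, c, 0)"]
    by (auto simp: zero_prod_def clean_edges_def)
  have edge': "ordinary F' (0, b, c) 0" "ordinary F' (b, 0, c) 0" "ordinary F' (b, c, 0) 0"
    if "b \<noteq> 0" "c \<noteq> 0" for b c
    using sigma_edge[OF q d that e1] sigma_edge[OF q2 d2 that] sigma_edge[OF q3 d3 that(2,1)] e2 e3
    by (simp_all add: ordinary_rot)
  have vertex': "ordinary F' (1, 0, 0) (d - m2 - m3)" "ordinary F' (0, 1, 0) (d - m3 - m1)"
      "ordinary F' (0, 0, 1) (d - m1 - m2)"
    using sigma_vertex[OF q d] sigma_vertex[OF q2 d2] sigma_vertex[OF q3 d3] edge e1 e2 e3 le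
    by (simp_all add: ordinary_rot add.commute)
  have "ordinary F' v (?\<nu> v)" if v0: "v \<noteq> 0" for v
  proof -
    obtain a b c where v: "v = (a, b, c)" by (cases v)
    have sc3: "(a, 0, 0) = scale a (1, 0, 0)" "(0, b, 0) = scale b (0, 1, 0)" "(0, 0, c) = scale c (0, 0, 1)" by simp_all
    consider "a \<noteq> 0" "b \<noteq> 0" "c \<noteq> 0" | "a = 0" "b \<noteq> 0" "c \<noteq> 0" | "a \<noteq> 0" "b = 0" "c \<noteq> 0" |
      "a \<noteq> 0" "b \<noteq> 0" "c = 0" | "a \<noteq> 0" "b = 0" "c = 0" | "a = 0" "b \<noteq> 0" "c = 0" | "a = 0" "b = 0" "c \<noteq> 0"
      using v0 by (auto simp: v zero_prod_def)
    then show ?thesis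
    proof cases
      case 1
      then have "(b * c, a * c, a * b) \<noteq> 0" by (simp add: zero_prod_def)
      then show ?thesis using sigma_torus[OF q d 1 ord] 1 by (simp add: v)
    next
      case 5 then show ?thesis using ordinary_scale[OF form' 5(1) vertex'(1)] m by (simp add: v)
    next
      case 6 then show ?thesis using ordinary_scale[OF form' 6(2) vertex'(2)] m by (simp add: v)
    next
      case 7 then show ?thesis using ordinary_scale[OF form' 7(3) vertex'(3)] m by (simp add: v)
    qed (use edge' in \<open>auto simp: v\<close>)
  qed
  then show "\<exists>F'. realizes (2 * d - m1 - m2 - m3) F' (pullback_mult d \<mu>)"
    using form' bir' \<nu> fin' by (auto simp: realizes_def)
qed

section \<open>Ordinary systems have no common factor\<close>

lemma dot_add: "dot n (v + w) = dot n v + dot n w"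
  by (cases n; cases v; cases w) (simp add: algebra_simps)

lemma dot_scale: "dot n (scale k v) = k * dot n v"
  by (cases n; cases v) (simp add: algebra_simps)

lemma dot_cross: "dot (cross v w) v = 0" "dot (cross v w) w = 0" "dot (cross w b) v = - dot (cross v b) w"
  by (cases v; cases w; cases b; simp add: algebra_simps)+

lemma realizes_nonvanishing:
  assumes F: "realizes d F \<mu>" and v: "v \<noteq> 0" "\<forall>b\<in>rep ` support \<mu>. indep b v"
  shows "\<exists>G\<in>set_vec F. ev (\<lambda>c. c) G v \<noteq> 0"
proof -
  have \<mu>: "projective \<mu>" using F by (simp add: realizes_def)
  have "\<mu> v = 0"
  proof (rule ccontr)
    assume "\<mu> v \<noteq> 0"
    then have "pt v \<in> support \<mu>" by (simp add: support_def projective_rep_pt[OF \<mu> v(1)])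
    then show False
      using v rep_pt[OF v(1)] indep_iff[OF rep_nonzero] by blast
  qed
  then show ?thesis using F v(1) unfolding realizes_def ordinary_0_iff[OF v(1), symmetric] by metis
qed

text \<open>
A common factor \<open>h\<close> does not vanish at a nonzero vector that does not represent a base point. On a line (not
through the origin) whose plane contains no base point, \<open>h\<close> is then a polynomial in one variable
without a root, hence constant. For a general vector \<open>w\<close> the lines \<open>v + s w\<close> and \<open>w + s v\<close> are of this
kind and meet in \<open>v + w\<close>, so \<open>h\<close> has the same value at \<open>v\<close> and \<open>w\<close>. Comparing with one general \<open>w\<close>, all
values off the base locus are equal, and \<open>h\<close> is constant.
\<close>

lemma realizes_no_common_factor:
  fixes F :: "'a::alg_closed_field form_triple"
  assumes F: "realizes d F \<mu>"
  shows "no_common_factor F"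
proof -
  define S where "S = rep ` support \<mu>"
  have S: "finite S" "0 \<notin> S"
    using F rep_nonzero unfolding S_def realizes_def by fastforce+
  define good where "good v \<longleftrightarrow> v \<noteq> 0 \<and> (\<forall>b\<in>S. indep b v)" for v
  have "h dvd 1" if h: "\<forall>G\<in>set_vec F. h dvd G" for h
  proof -
    let ?h = "ev (\<lambda>c. c) h"
    have nz: "?h v \<noteq> 0" if v: "good v" for v
    proof -
      obtain G where G: "G \<in> set_vec F" "ev (\<lambda>c. c) G v \<noteq> 0"
        using realizes_nonvanishing[OF F, of v] v unfolding good_def S_def by blast
      then show ?thesis using h hom_dvd[OF hom_ev[OF hom_id], of h G v] by auto
    qed
    have line: "?h (v + w) = ?h v" if v: "good v" and x: "dot (cross v x) w \<noteq> 0"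
      and w: "\<forall>b\<in>S. dot (cross v b) w \<noteq> 0" for v w x
    proof -
      have good: "good (v + scale s w)" for s
        unfolding good_def
      proof (intro conjI ballI)
        have 1: "dot (cross v y) (v + scale s w) = s * dot (cross v y) w" for y
          by (simp add: dot_add dot_scale dot_cross(1,2))
        have dot0: "dot n 0 = 0" for n :: "'a vec" by (cases n) (simp add: zero_prod_def)
        show "v + scale s w \<noteq> 0"
        proof
          assume 0: "v + scale s w = 0"
          then have "s = 0" using 1[of x] x dot0 by simp
          then show False using 0 v by (simp add: scale_0 good_def)
        qed
        fix b assume b: "b \<in> S"
        then have "b \<noteq> 0" using S by auto
        show "indep b (v + scale s w)"
          unfolding indep_iff[OF \<open>b \<noteq> 0\<close>]
        proof (intro allI notI)
          fix c assume c: "v + scale s w = scale c b"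
          then have "s * dot (cross v b) w = 0" using 1[of b] by (simp add: dot_scale dot_cross(1,2))
          then have "s = 0" using w b by simp
          then have "v = scale c b" using c by (simp add: scale_0)
          then show False using v b indep_iff[OF \<open>b \<noteq> 0\<close>] unfolding good_def by blast
        qed
      qed
      define p where "p = ev_arc h (arc 1 v (cvec w))"
      have p: "poly p s = ?h (v + scale s w)" for s
      proof -
        have "map_vec (\<lambda>p. poly p s) (arc 1 v (cvec w)) = v + scale s w"
          by (cases v; cases w) simp
        then show ?thesis
          unfolding p_def by (subst hom_of_ev[OF hom_poly hom_const]) simp
      qed
      have "degree p = 0"
        using alg_closed_imp_poly_has_root[of p] nz[OF good] unfolding p by blast
      then obtain a where "p = [:a:]" by (rule degree_eq_zeroE)
      then show ?thesis using p[of 0] p[of 1] by (simp add: scale_0 scale_1)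
    qed
    have const: "?h v = ?h v'" if v: "good v" "good v'" for v v'
    proof -
      have ex: "\<exists>x. cross y x \<noteq> 0" if "good y" for y
        using ex_indep[of y] that by (auto simp: good_def indep_def)
      obtain x x' where x: "cross v x \<noteq> 0" "cross v' x' \<noteq> 0" using ex v by metis
      define N where "N = insert (cross v x) (insert (cross v' x') (cross v ` S \<union> cross v' ` S))"
      have cr: "cross v b \<noteq> 0" if "good v" "b \<in> S" for v b
      proof
        assume "cross v b = 0"
        then have "cross b v = 0" by (cases v; cases b) (auto simp: zero_prod_def algebra_simps)
        then show False using that by (auto simp: good_def indep_def)
      qed
      have "finite N" "0 \<notin> N" using S x cr[OF v(1)] cr[OF v(2)] by (auto simp: N_def)
      then obtain w where w: "\<forall>n\<in>N. dot n w \<noteq> 0"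
        using ex_general_vector[of 1 N] by auto
      have gw: "good w"
        unfolding good_def
      proof (intro conjI ballI)
        show "w \<noteq> 0"
        proof
          assume "w = 0"
          moreover have "dot (cross v x) w \<noteq> 0" using w by (simp add: N_def)
          ultimately show False by (cases "cross v x") (simp add: zero_prod_def)
        qed
        fix b assume b: "b \<in> S"
        then have "b \<noteq> 0" using S by auto
        have "dot (cross v b) w \<noteq> 0" using w b by (simp add: N_def)
        then show "indep b w"
          unfolding indep_iff[OF \<open>b \<noteq> 0\<close>] by (auto simp: dot_scale dot_cross(1,2))
      qed
      have 1: "?h (v + w) = ?h v" "?h (v' + w) = ?h v'"
        using w v by (auto simp: N_def intro!: line)
      have sw: "dot (cross w b) y = - dot (cross y b) w" for b y
        by (rule dot_cross(3))
      have 2: "?h (w + v) = ?h w" "?h (w + v') = ?h w"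
        using w by (auto simp: N_def sw intro!: line[OF gw])
      show ?thesis using 1 2 by (simp only: add.commute[of w])
    qed
    \<comment> \<open>one plane through each base point; a vector off these planes represents no base point\<close>
    define N where "N = (\<lambda>b. cross b (SOME x. indep b x)) ` S"
    have some: "indep b (SOME x. indep b x)" if "b \<in> S" for b
      using that S ex_indep[of b] by (metis someI_ex)
    have N: "finite N" "0 \<notin> N" using S some by (auto simp: N_def indep_def)
    have goodI: "good v" if v: "\<forall>n\<in>insert (1, 0, 0) N. dot n v \<noteq> 0" for v
      unfolding good_def
    proof (intro conjI ballI)
      show "v \<noteq> 0" using v by (cases v) (auto simp: zero_prod_def)
      fix b assume b: "b \<in> S"
      then have "b \<noteq> 0" using S by auto
      have "dot (cross b (SOME x. indep b x)) v \<noteq> 0" using v b by (simp add: N_def)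
      then show "indep b v"
        unfolding indep_iff[OF \<open>b \<noteq> 0\<close>] by (auto simp: dot_scale dot_cross(1,2))
    qed
    have N1: "finite (insert (1, 0, 0) N)" "0 \<notin> insert (1, 0, 0) N"
      using N by (auto simp: zero_prod_def)
    have "(1 :: 'a poly3) \<noteq> 0" by simp
    then obtain v0 where v0: "good v0"
      using ex_general_vector[OF _ N1] goodI by blast
    have "h - const3 (?h v0) = 0"
    proof (rule ccontr)
      assume "h - const3 (?h v0) \<noteq> 0"
      then obtain v where "ev (\<lambda>c. c) (h - const3 (?h v0)) v \<noteq> 0" "good v"
        using ex_general_vector[OF _ N1] goodI by blast
      then show False
        using const[OF v0, of v] by (simp add: hom_diff[OF hom_ev[OF hom_id]] ev_const3[OF hom_id] del: ev.simps)
    qed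
    then have "h = const3 (?h v0)" by simp
    moreover have "const3 (inverse (?h v0)) * const3 (?h v0) = 1"
      using hom_inverse[OF hom_const3 nz[OF v0]] .
    ultimately show ?thesis by (metis dvd_triv_right)
  qed
  then show ?thesis by (cases F) auto
qed

lemma realizes_imp_plane_cremona:
  fixes F :: "'a::alg_closed_field form_triple"
  assumes "realizes d F \<mu>" shows "plane_cremona d F"
  using assms realizes_no_common_factor[OF assms]
  by (simp add: plane_cremona_def realizes_def birational_imp_lin_indep)

section \<open>Order and blowing up in two variables\<close>

definition order_ge :: "'a::comm_ring_1 poly2 \<Rightarrow> nat \<Rightarrow> bool" where
  "order_ge f m \<longleftrightarrow> (\<forall>i j. coeff (coeff f j) i \<noteq> 0 \<longrightarrow> m \<le> i + j)"

lemma eval3_const_poly2: "is_hom e \<Longrightarrow> eval3 e [:f:] a b c = eval2 e f a b"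
  by (simp add: eval3_def eval1_const hom_eval2)

lemma X_power_dvd_iff: "[:0, 1:] ^ m dvd p \<longleftrightarrow> (\<forall>j<m. coeff p j = (0 :: 'a::idom))"
proof -
  have "[:0, 1:] ^ m = monom (1 :: 'a) m" by (simp add: monom_altdef)
  then show ?thesis by (simp add: monom_1_dvd_iff')
qed

lemma order_ge_iff:
  fixes f :: "'a::idom poly2"
  shows "order_ge f m \<longleftrightarrow> [:0, 1:] ^ m dvd dilate [:f:]"
proof -
  have "[:0, 1:] ^ m dvd dilate [:f:] \<longleftrightarrow> (\<forall>n<m. coeff (dilate [:f:]) n = 0)"
    by (rule X_power_dvd_iff)
  also have "\<dots> \<longleftrightarrow> order_ge f m"
  proof
    assume 0: "\<forall>n<m. coeff (dilate [:f:]) n = 0"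
    show "order_ge f m"
      unfolding order_ge_def
    proof (intro allI impI)
      fix i j assume "coeff (coeff f j) i \<noteq> 0"
      then show "m \<le> i + j"
        using 0 coeff_dilate[of "[:f:]" "i + j" 0 j i] by (metis add.right_neutral coeff_0 coeff_pCons_0 not_le)
    qed
  next
    assume f: "order_ge f m"
    have *: "coeff (coeff f j) i = 0" if "i + j < m" for i j
      using f that unfolding order_ge_def by (metis not_le)
    show "\<forall>n<m. coeff (dilate [:f:]) n = 0"
    proof (intro allI impI)
      fix n assume "n < m"
      with * show "coeff (dilate [:f:]) n = 0"
        by (intro poly_eqI) (auto simp: coeff_dilate coeff_pCons split: nat.splits)
    qed
  qed
  finally show ?thesis by simp
qed

text \<open>
\<open>f(sa, sb)\<close> is a specialisation of \<open>dilate [:f:]\<close>.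
\<close>

lemma order_ge_dvd:
  fixes f :: "'a::idom poly2"
  assumes "order_ge f m" "is_hom e" shows "s ^ m dvd eval2 e f (s * a) (s * b)"
proof -
  let ?h = "\<lambda>P. poly (map_poly (\<lambda>G. ev e G (a, b, 0)) P) s"
  have h: "is_hom ?h" by (rule hom_eval1[OF hom_ev[OF assms(2)]])
  have c: "?h [:G:] = ev e G (a, b, 0)" for G by (rule eval1_const[OF hom_ev[OF assms(2)]])
  have x: "?h [:0, 1:] = s" by (rule eval1_X[OF hom_ev[OF assms(2)]])
  have "?h (dilate [:f:]) = ev e [:f:] (s * a, s * b, s * 0)"
    unfolding dilate_def
    by (subst hom_of_ev[OF h hom_const_const3])
       (simp only: c x ev_const3[OF assms(2)] map_vec_scale[OF h] map_vec_map_vec ev_XYZ[OF assms(2)] scale.simps)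
  also have "\<dots> = eval2 e f (s * a) (s * b)"
    by (simp add: eval3_const_poly2[OF assms(2)])
  finally show ?thesis
    using hom_dvd[OF h assms(1)[unfolded order_ge_iff]] unfolding hom_power[OF h] x by simp
qed

lemma order_geI:
  fixes f :: "'a::idom poly2"
  assumes "[:0, 1:] ^ m dvd eval2 (\<lambda>c. [:const3 c:]) f ([:0, 1:] * [:X3:]) ([:0, 1:] * [:Y3:])"
  shows "order_ge f m"
  using assms unfolding order_ge_iff dilate_def XYZ_def
  by (simp add: eval3_const_poly2[OF hom_const_const3] del: mult_pCons_left mult_pCons_right)

text \<open>
The homogeneous part of degree \<open>m\<close> of \<open>f\<close>, evaluated at \<open>(a, b)\<close>.
\<close>

definition initial_form :: "'a::comm_ring_1 poly2 \<Rightarrow> nat \<Rightarrow> 'a \<Rightarrow> 'a \<Rightarrow> 'a" where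
  "initial_form f m a b = coeff (eval2 (\<lambda>c. [:c:]) f ([:0, 1:] * [:a:]) ([:0, 1:] * [:b:])) m"

text \<open>
Stated over an arbitrary algebra, because the comparison with the strict transform along the whole
exceptional curve needs an indeterminate direction.
\<close>

lemma initial_form_sum:
  assumes e: "is_hom e"
  shows "coeff (eval2 (\<lambda>c. [:e c:]) f ([:0, 1:] * [:A:]) ([:0, 1:] * [:B:])) m =
    (\<Sum>j\<le>m. e (coeff (coeff f j) (m - j)) * A ^ (m - j) * B ^ j)"
proof -
  have h: "is_hom (\<lambda>c. [:e c:])" by (rule hom_comp[OF hom_const e])
  have "coeff (eval2 (\<lambda>c. [:e c:]) (coeff F 0) ([:0, 1:] * [:A:]) ([:0, 1:] * [:B:])) m =
    (\<Sum>j\<le>m. e (coeff (coeff (coeff F 0) j) (m - j)) * A ^ (m - j) * B ^ j)" for F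
  proof (induction F rule: poly3_induct)
    case (add F G)
    then show ?case
      by (simp only: coeff_add hom_add[OF hom_eval2[OF h]] hom_add[OF e] distrib_right sum.distrib)
  next
    case (monom c i j l)
    have X: "[:0, 1:] * [:c:] = monom c 1" "[:c:] = monom c 0" for c :: 'b
      by (simp_all add: monom_altdef)
    show ?case
    proof (cases "l = 0")
      case True
      have "eval2 (\<lambda>c. [:e c:]) (monom (monom c i) j) ([:0, 1:] * [:A:]) ([:0, 1:] * [:B:]) =
          [:e c:] * ([:0, 1:] * [:A:]) ^ i * ([:0, 1:] * [:B:]) ^ j"
        by (simp only: eval2_def map_poly_monom poly_monom hom_0[OF hom_eval1[OF h]] hom_0[OF h])
      also have "\<dots> = monom (e c * A ^ i * B ^ j) (i + j)"
        unfolding X(1) unfolding X(2) by (simp add: monom_power mult_monom)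
      finally have "coeff (eval2 (\<lambda>c. [:e c:]) (monom (monom c i) j) ([:0, 1:] * [:A:]) ([:0, 1:] * [:B:])) m =
         (if i + j = m then e c * A ^ i * B ^ j else 0)" by simp
      also have "\<dots> = (\<Sum>j'\<le>m. if j' = j then (if i = m - j then e c * A ^ i * B ^ j else 0) else 0)"
        by (auto simp: sum.delta)
      also have "\<dots> = (\<Sum>j'\<le>m. e (coeff (coeff (monom (monom c i) j) j') (m - j')) * A ^ (m - j') * B ^ j')"
        by (intro sum.cong) (auto simp: hom_0[OF e])
      finally show ?thesis using True by simp
    next
      case False
      then show ?thesis by (simp add: hom_0[OF hom_eval2[OF h]] hom_0[OF e])
    qed
  qed
  from this[of "[:f:]"] show ?thesis by simp
qed

lemma initial_form_nonzero_imp: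
  assumes "initial_form f m a b \<noteq> 0" shows "\<exists>i j. coeff (coeff f j) i \<noteq> 0 \<and> i + j = m"
proof -
  have "initial_form f m a b = (\<Sum>j\<le>m. coeff (coeff f j) (m - j) * a ^ (m - j) * b ^ j)"
    unfolding initial_form_def by (rule initial_form_sum[OF hom_id])
  then obtain j where "j \<le> m" "coeff (coeff f j) (m - j) \<noteq> 0"
    using assms by (metis (no_types, lifting) atMost_iff mult_zero_left sum.neutral)
  then show ?thesis by (intro exI[of _ "m - j"] exI[of _ j]) simp
qed

lemma mult_origin_attained:
  assumes "f \<noteq> 0"
  shows "order_ge f (mult_origin f)" and "\<exists>i j. coeff (coeff f j) i \<noteq> 0 \<and> i + j = mult_origin f"
proof -
  obtain j where "coeff f j \<noteq> 0" using assms by (metis poly_eqI coeff_0)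
  then obtain i where "coeff (coeff f j) i \<noteq> 0" by (metis poly_eqI coeff_0)
  then have "\<exists>n i j. coeff (coeff f j) i \<noteq> 0 \<and> i + j = n" by blast
  then show "\<exists>i j. coeff (coeff f j) i \<noteq> 0 \<and> i + j = mult_origin f"
    unfolding mult_origin_def by (rule LeastI_ex)
  show "order_ge f (mult_origin f)"
    unfolding order_ge_def mult_origin_def by (blast intro: Least_le)
qed

lemma mult_origin_ge: "order_ge f m \<Longrightarrow> f \<noteq> 0 \<Longrightarrow> m \<le> mult_origin f"
  using mult_origin_attained(2) unfolding order_ge_def by metis

lemma mult_origin_le: "initial_form f m a b \<noteq> 0 \<Longrightarrow> mult_origin f \<le> m"
  unfolding mult_origin_def by (intro Least_le initial_form_nonzero_imp)

lemma system_mult_eq: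
  assumes "\<And>f. f \<in> V \<Longrightarrow> f \<noteq> 0 \<and> order_ge f m" "f \<in> V" "initial_form f m a b \<noteq> 0"
  shows "system_mult V = m"
  unfolding system_mult_def
proof (rule Least_equality)
  have "f \<noteq> 0" "order_ge f m" using assms(1)[OF assms(2)] by auto
  then have "mult_origin f = m" using mult_origin_ge mult_origin_le assms(3) by (metis le_antisym)
  then show "\<exists>f\<in>V. mult_origin f = m" using assms(2) by blast
qed (use assms(1) mult_origin_ge in blast)

lemma eval2_subst:
  assumes "is_hom e"
  shows "eval2 e (eval2 const2 f A B) a b = eval2 e f (eval2 e A a b) (eval2 e B a b)"
  using hom_of_eval2[OF hom_eval2[OF assms, of a b] hom_const2, of f A B]
  by (simp add: eval2_const2[OF assms])

lemma coeff_00: "coeff (coeff f 0) 0 = eval2 (\<lambda>c. c) f 0 0"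
  by (simp add: eval2_def poly_0_coeff_0 coeff_map_poly hom_0[OF hom_eval1[OF hom_id]])

lemma system_mult_0:
  assumes "f \<in> V" "coeff (coeff f 0) 0 \<noteq> 0" shows "system_mult V = 0"
proof -
  have "mult_origin f = 0"
    unfolding mult_origin_def using assms(2) by (intro Least_eq_0) auto
  then show ?thesis unfolding system_mult_def using assms(1) by (intro Least_eq_0) blast
qed

lemma blowup_mult_0:
  assumes "\<exists>f\<in>V. coeff (coeff f 0) 0 \<noteq> 0"
  shows "\<exists>f\<in>blowup_system s V. coeff (coeff f 0) 0 \<noteq> 0"
proof -
  obtain f where f: "f \<in> V" "coeff (coeff f 0) 0 \<noteq> 0" using assms by blast
  have "blowup_pullback s f \<in> blowup_system s V"
    using f system_mult_0[OF f] by (auto simp: blowup_system_def image_iff intro!: bexI[of _ f])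
  moreover have "coeff (coeff (blowup_pullback s f) 0) 0 = coeff (coeff f 0) 0"
    unfolding coeff_00
    by (cases s) (simp_all add: eval2_subst[OF hom_id] eval2_simps[OF hom_id]
       hom_add[OF hom_eval2[OF hom_id]] hom_mult[OF hom_eval2[OF hom_id]])
  ultimately show ?thesis using f by metis
qed

text \<open>
A member with nonzero constant term keeps it under all further blow-ups, as nothing is removed from
its pullback.
\<close>

lemma fold_blowup_mult_0:
  "\<exists>f\<in>V. coeff (coeff f 0) 0 \<noteq> 0 \<Longrightarrow> system_mult (fold blowup_system ss V) = 0"
proof (induction ss arbitrary: V)
  case Nil then show ?case using system_mult_0 by auto
next
  case (Cons s ss) then show ?case using Cons.IH[OF blowup_mult_0[OF Cons.prems]] by simp
qed

fun direction :: "'a::idom option \<Rightarrow> 'a \<times> 'a" where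
  "direction (Some a) = (1, a)" | "direction None = (0, 1)"

text \<open>
The blow-up map in both charts: with \<open>t\<close> the equation of the exceptional curve and \<open>y\<close> the coordinate
along it, the point \<open>blowup_coords s t y\<close> goes to \<open>t\<close> times the vector \<open>curve_direction e s y\<close>.
\<close>

fun curve_direction :: "('a::idom \<Rightarrow> 'b::comm_ring_1) \<Rightarrow> 'a option \<Rightarrow> 'b \<Rightarrow> 'b \<times> 'b" where
  "curve_direction e (Some a) y = (1, y + e a)" | "curve_direction e None y = (y, 1)"

fun blowup_coords :: "'a option \<Rightarrow> 'b \<Rightarrow> 'b \<Rightarrow> 'b \<times> 'b" where
  "blowup_coords (Some a) t y = (t, y)" | "blowup_coords None t y = (y, t)"

lemma curve_direction_0:
  "is_hom e \<Longrightarrow> curve_direction e s 0 = (e (fst (direction s)), e (snd (direction s)))"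
  by (cases s) (simp_all add: hom_0 hom_1)

lemma eval2_blowup:
  assumes e: "is_hom e" and g: "blowup_pullback s f = exceptional s ^ m * g"
  shows "eval2 e f (t * fst (curve_direction e s y)) (t * snd (curve_direction e s y)) =
    t ^ m * eval2 e g (fst (blowup_coords s t y)) (snd (blowup_coords s t y))"
proof -
  note h = hom_eval2[OF e]
  show ?thesis
  proof (cases s)
    case None
    then show ?thesis
      using arg_cong[OF g, of "\<lambda>p. eval2 e p y t"]
      by (simp add: eval2_subst[OF e] hom_mult[OF h] hom_power[OF h] eval2_simps[OF e] mult.commute)
  next
    case (Some a)
    then show ?thesis
      using arg_cong[OF g, of "\<lambda>p. eval2 e p t y"]
      by (simp add: eval2_subst[OF e] hom_mult[OF h] hom_power[OF h] hom_add[OF h] eval2_simps[OF e])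
  qed
qed

lemma coeff_0_eval2:
  "is_hom e \<Longrightarrow> coeff (eval2 (\<lambda>c. [:e c:]) g p q) 0 = eval2 e g (poly p 0) (poly q 0)"
  using hom_of_eval2[OF hom_poly[of 0] hom_comp[OF hom_const], of e g p q]
  by (simp add: poly_0_coeff_0)

text \<open>
On the exceptional curve, \<open>t = 0\<close>, the quotient of \<open>f(tA, tB)\<close> by \<open>t ^ m\<close> is the initial form at \<open>(A, B)\<close>.
\<close>

lemma strict_transform:
  fixes f :: "'a::{idom, idom_divide} poly2"
  assumes "order_ge f m"
  obtains g where "blowup_pullback s f = exceptional s ^ m * g"
    "blowup_pullback s f div exceptional s ^ m = g"
    "coeff (coeff g 0) 0 = initial_form f m (fst (direction s)) (snd (direction s))"
proof -
  have "exceptional s ^ m dvd blowup_pullback s f"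
  proof (cases s)
    case None
    then show ?thesis
      using order_ge_dvd[OF assms hom_const2, of Y2 X2 1] by (simp add: mult.commute)
  next
    case (Some a)
    then show ?thesis
      using order_ge_dvd[OF assms hom_const2, of X2 1 "Y2 + const2 a"] by simp
  qed
  then obtain g where g: "blowup_pullback s f = exceptional s ^ m * g" by (rule dvdE)
  define p q where "p = fst (blowup_coords s [:0, 1:] (0 :: 'a poly))"
    and "q = snd (blowup_coords s [:0, 1:] (0 :: 'a poly))"
  have pq: "poly p 0 = 0" "poly q 0 = 0" by (cases s; simp add: p_def q_def)+
  have "initial_form f m (fst (direction s)) (snd (direction s)) = coeff ([:0, 1:] ^ m * eval2 (\<lambda>c. [:c:]) g p q) (m + 0)"
    using eval2_blowup[OF hom_const g, of "[:0, 1:]" 0]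
    unfolding initial_form_def curve_direction_0[OF hom_const] fst_conv snd_conv p_def q_def by (simp only: add_0_right)
  also have "\<dots> = coeff (coeff g 0) 0"
    unfolding coeff_X_power_mult coeff_0_eval2[OF hom_id] pq coeff_00 ..
  finally have "coeff (coeff g 0) 0 = initial_form f m (fst (direction s)) (snd (direction s))" ..
  moreover have "exceptional s \<noteq> (0 :: 'a poly2)" by (cases s) (simp_all add: X2_def Y2_def)
  ultimately show ?thesis using g by (intro that[of g]) simp_all
qed

section \<open>The type of an ordinary system\<close>

text \<open>
The vector with coordinates \<open>x\<close>, \<open>y\<close> in the affine chart that \<open>localize\<close> uses at the point.
\<close>

fun tangent :: "'a::field proj_plane \<Rightarrow> 'b::comm_ring_1 \<Rightarrow> 'b \<Rightarrow> 'b vec" where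
  "tangent (PA a b) x y = (x, y, 0)"
| "tangent (PB a) x y = (x, 0, y)"
| "tangent PC x y = (0, x, y)"

lemma localize_eq: "localize p G = ev const2 G (map_vec const2 (rep p) + tangent p X2 Y2)"
  by (cases p) (simp_all add: hom_0[OF hom_const2] hom_1[OF hom_const2] add.commute)

lemma eval2_localize:
  assumes e: "is_hom e"
  shows "eval2 e (localize p G) x y = ev e G (map_vec e (rep p) + tangent p x y)"
proof -
  have "map_vec (\<lambda>f. eval2 e f x y) (map_vec const2 (rep p) + tangent p X2 Y2) = map_vec e (rep p) + tangent p x y"
    by (cases p) (simp_all add: hom_simps[OF hom_eval2[OF e]] eval2_simps[OF e] hom_0[OF e] hom_1[OF e])
  then show ?thesis
    unfolding localize_eq by (subst hom_of_ev[OF hom_eval2[OF e] hom_const2]) (simp add: eval2_const2[OF e])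
qed

lemma tangent_mult: "tangent p (s * x) (s * y) = scale s (tangent p x y)"
  by (cases p) simp_all

lemma map_tangent: "is_hom e \<Longrightarrow> map_vec e (tangent p x y) = tangent p (e x) (e y)"
  by (cases p) (simp_all add: hom_0)

lemma order_ge_localize:
  assumes "mult_ge G (rep p) m" shows "order_ge (localize p G) m"
proof (rule order_geI)
  show "[:0, 1:] ^ m dvd eval2 (\<lambda>c. [:const3 c:]) (localize p G) ([:0, 1:] * [:X3:]) ([:0, 1:] * [:Y3:])"
    unfolding eval2_localize[OF hom_const_const3] tangent_mult
    using mult_ge_arc[OF hom_const_const3 assms, of "[:0, 1:]" 1] by (simp only: scale_1)
qed

lemma initial_form_localize: "initial_form (localize p G) m x y = lead G (rep p) m (tangent p x y)"
  unfolding initial_form_def eval2_localize[OF hom_const] tangent_mult lead_def map_tangent[OF hom_const] scale_1 ..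

lemma indep_tangent: "(x, y) \<noteq> (0, 0) \<Longrightarrow> indep (rep p) (tangent p x y)"
  by (cases p) (auto simp: indep_def zero_prod_def)

text \<open>
A form that vanishes on an affine chart vanishes on a dense set of vectors, by homogeneity.
\<close>

lemma localize_nonzero:
  fixes G :: "'a::alg_closed_field poly3"
  assumes "is_form d G" "G \<noteq> 0" shows "localize p G \<noteq> 0"
proof
  assume 0: "localize p G = 0"
  obtain n where n: "n \<noteq> 0" "\<And>v. dot n v \<noteq> 0 \<Longrightarrow> \<exists>k x y. v = scale k (rep p + tangent p x y)"
  proof (cases p)
    case (PA a b)
    show ?thesis
    proof (rule that[of "(0, 0, 1)"])
      fix v :: "'a vec" assume *: "dot (0, 0, 1) v \<noteq> 0"
      obtain x y z where v: "v = (x, y, z)" by (cases v)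
      then have "v = scale z (rep p + tangent p (x / z - a) (y / z - b))"
        using * by (simp add: PA field_simps)
      then show "\<exists>k x y. v = scale k (rep p + tangent p x y)" by blast
    qed (simp add: zero_prod_def)
  next
    case (PB a)
    show ?thesis
    proof (rule that[of "(0, 1, 0)"])
      fix v :: "'a vec" assume *: "dot (0, 1, 0) v \<noteq> 0"
      obtain x y z where v: "v = (x, y, z)" by (cases v)
      then have "v = scale y (rep p + tangent p (x / y - a) (z / y))"
        using * by (simp add: PB field_simps)
      then show "\<exists>k x y. v = scale k (rep p + tangent p x y)" by blast
    qed (simp add: zero_prod_def)
  next
    case PC
    show ?thesis
    proof (rule that[of "(1, 0, 0)"])
      fix v :: "'a vec" assume *: "dot (1, 0, 0) v \<noteq> 0"
      obtain x y z where v: "v = (x, y, z)" by (cases v)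
      then have "v = scale x (rep p + tangent p (y / x) (z / x))"
        using * by (simp add: PC field_simps)
      then show "\<exists>k x y. v = scale k (rep p + tangent p x y)" by blast
    qed (simp add: zero_prod_def)
  qed
  obtain v where v: "ev (\<lambda>c. c) G v \<noteq> 0" "dot n v \<noteq> 0"
    using ex_general_vector[OF assms(2), of "{n}"] n(1) by auto
  then obtain k x y where "v = scale k (rep p + tangent p x y)" using n(2) by blast
  then have "ev (\<lambda>c. c) G v = k ^ d * eval2 (\<lambda>c. c) (localize p G) x y"
    unfolding eval2_localize[OF hom_id] map_vec_id by (simp only: ev_form_scale[OF assms(1) hom_id])
  then show False using v(1) hom_0[OF hom_eval2[OF hom_id]] unfolding 0 by (metis mult_zero_right)
qed

lemma mult_ge_comb:
  assumes "mult_ge G v m" "mult_ge G' v m" shows "mult_ge (G + G') v m" "mult_ge (const3 a * G) v m"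
  using assms unfolding mult_ge_def hom_add[OF hom_ev[OF hom_const_arc]] hom_mult[OF hom_ev[OF hom_const_arc]]
  by (auto intro: dvd_add dvd_mult)

lemma linear_system_nonzero:
  "lin_indep F \<Longrightarrow> G \<in> linear_system F \<Longrightarrow> G \<noteq> 0"
  by (cases F) auto

lemma is_form_linear_system:
  assumes "is_form_triple d F" "G \<in> linear_system F" shows "is_form d G"
  using assms by (cases F) (auto simp: is_form_add is_form_const_mult)

lemma set_vec_linear_system: "set_vec F \<subseteq> linear_system F"
proof -
  obtain F1 F2 F3 where F: "F = (F1, F2, F3)" by (cases F)
  have c: "const3 0 = 0" "const3 1 = 1" by (rule hom_0[OF hom_const3] hom_1[OF hom_const3])+
  have "F1 = const3 1 * F1 + const3 0 * F2 + const3 0 * F3" "F2 = const3 0 * F1 + const3 1 * F2 + const3 0 * F3"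
    "F3 = const3 0 * F1 + const3 0 * F2 + const3 1 * F3"
    unfolding c by simp_all
  then show ?thesis
    unfolding F linear_system.simps by (auto simp only: set_vec.simps) (metis (mono_tags, lifting) mem_Collect_eq prod.inject zero_neq_one)+
qed

text \<open>
At an ordinary point some member attains the multiplicity, and for every point of the exceptional
curve some member has a nonzero initial form in this direction, so that its strict transform misses
the point.
\<close>

lemma ordinary_virtual_mult:
  fixes F :: "'a::alg_closed_field form_triple"
  assumes F: "realizes d F \<mu>"
  shows "virtual_mult F (p, []) = \<mu> (rep p)" and "virtual_mult F (p, s # ss) = 0"
proof -
  let ?V = "localize p ` linear_system F" and ?m = "\<mu> (rep p)"
  have d: "is_form_triple d F" and li: "lin_indep F" and ord: "ordinary F (rep p) ?m"
    using F rep_nonzero by (auto simp: realizes_def birational_imp_lin_indep)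
  have V: "f \<noteq> 0 \<and> order_ge f ?m" if "f \<in> ?V" for f
  proof -
    obtain G where G: "G \<in> linear_system F" "f = localize p G" using \<open>f \<in> ?V\<close> by blast
    have mG: "mult_ge G (rep p) ?m"
      using G(1) ord by (cases F) (auto simp: ordinary_def intro!: mult_ge_comb)
    show ?thesis
      using localize_nonzero[OF is_form_linear_system[OF d G(1)] linear_system_nonzero[OF li G(1)]]
        order_ge_localize[OF mG] unfolding G(2) by simp
  qed
  have dir: "\<exists>f\<in>?V. initial_form f ?m x y \<noteq> 0" if xy: "(x, y) \<noteq> (0, 0)" for x y
  proof -
    obtain G where "G \<in> set_vec F" "lead G (rep p) ?m (tangent p x y) \<noteq> 0"
      using ord indep_tangent[OF xy, of p] unfolding ordinary_def by blast
    then show ?thesis using set_vec_linear_system unfolding initial_form_localize[symmetric] by blast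
  qed
  have m: "system_mult ?V = ?m"
  proof -
    obtain f where "f \<in> ?V" "initial_form f ?m 1 0 \<noteq> 0" using dir[of 1 0] by auto
    then show ?thesis using system_mult_eq[OF V] by blast
  qed
  then show "virtual_mult F (p, []) = ?m" by simp
  obtain f where f: "f \<in> ?V" "initial_form f ?m (fst (direction s)) (snd (direction s)) \<noteq> 0"
    using dir[of "fst (direction s)" "snd (direction s)"] by (cases s) auto
  obtain g where g: "blowup_pullback s f div exceptional s ^ ?m = g"
    "coeff (coeff g 0) 0 = initial_form f ?m (fst (direction s)) (snd (direction s))"
    using strict_transform[of f ?m s] V[OF f(1)] by metis
  have "g \<in> blowup_system s ?V" unfolding blowup_system_def m using f(1) g(1) by blast
  then have "\<exists>g\<in>blowup_system s ?V. coeff (coeff g 0) 0 \<noteq> 0" using g(2) f(2) by metis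
  then show "virtual_mult F (p, s # ss) = 0" using fold_blowup_mult_0 by simp
qed

lemma realizes_imp_has_type:
  fixes F :: "'a::alg_closed_field form_triple"
  assumes F: "realizes d F \<mu>"
  shows "has_type d F (int d, image_mset int (mults \<mu>))"
proof -
  have bp: "base_points F = (\<lambda>p. (p, [])) ` support \<mu>"
  proof -
    have "q \<in> base_points F \<longleftrightarrow> q \<in> (\<lambda>p. (p, [])) ` support \<mu>" for q
      using ordinary_virtual_mult[OF F]
      by (cases q; cases "snd q") (auto simp: base_points_def support_def simp del: virtual_mult.simps)
    then show ?thesis by blast
  qed
  have "finite (support \<mu>)" using F by (simp add: realizes_def)
  moreover have "mset_set (base_points F) = image_mset (\<lambda>p. (p, [])) (mset_set (support \<mu>))"
    unfolding bp by (rule image_mset_mset_set[symmetric]) (simp add: inj_on_def)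
  ultimately show ?thesis
    unfolding has_type_def mults_def
    by (simp add: bp multiset.map_comp comp_def ordinary_virtual_mult(1)[OF F] del: virtual_mult.simps)
qed

section \<open>Quadratic maps with general base points\<close>

text \<open>
The line through \<open>p\<close> and \<open>q\<close> carries no base point except possibly \<open>p\<close> and \<open>q\<close> themselves.
\<close>

definition clean_line :: "('a::field vec \<Rightarrow> nat) \<Rightarrow> 'a vec \<Rightarrow> 'a vec \<Rightarrow> bool" where
  "clean_line \<mu> p q \<longleftrightarrow> (\<forall>a b. a \<noteq> 0 \<longrightarrow> b \<noteq> 0 \<longrightarrow> \<mu> (scale a p + scale b q) = 0)"

abbreviation nonzero :: "nat multiset \<Rightarrow> nat multiset" where
  "nonzero \<equiv> filter_mset (\<lambda>m. m \<noteq> 0)"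

text \<open>
A linear change of coordinates moves \<open>p\<close>, \<open>q\<close>, \<open>r\<close> to the vertices of the triangle of reference.
\<close>

lemma quadratic_step:
  fixes F :: "'a::alg_closed_field form_triple"
  assumes F: "realizes d F \<mu>" and det: "det3 (p, q, r) \<noteq> 0"
    and clean: "clean_line \<mu> p q" "clean_line \<mu> q r" "clean_line \<mu> p r"
    and le: "\<mu> p + \<mu> q \<le> d" "\<mu> q + \<mu> r \<le> d" "\<mu> p + \<mu> r \<le> d"
  shows "\<exists>(F' :: 'a form_triple) \<nu>. realizes (2 * d - \<mu> p - \<mu> q - \<mu> r) F' \<nu> \<and>
    mults \<nu> + nonzero {#\<mu> p, \<mu> q, \<mu> r#} =
      mults \<mu> + nonzero {#d - \<mu> q - \<mu> r, d - \<mu> r - \<mu> p, d - \<mu> p - \<mu> q#}"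
proof -
  let ?A = "(p, q, r)"
  obtain B where B: "inverse_mat ?A B" "inverse_mat B ?A" using ex_inverse_mat[OF det] .
  let ?\<mu> = "\<lambda>v. \<mu> (mat ?A v)"
  note L = realizes_lin[OF F B]
  have unit: "?\<mu> (1, 0, 0) = \<mu> p" "?\<mu> (0, 1, 0) = \<mu> q" "?\<mu> (0, 0, 1) = \<mu> r"
    by (simp_all only: lin_unit)
  have "clean_edges ?\<mu>"
    using clean by (auto simp: clean_edges_def clean_line_def map_vec_id scale_0)
  from sigma_step[OF L(1) this unit le] L(2) show ?thesis by (simp only:) blast
qed

text \<open>
It suffices to take \<open>r\<close> off the line \<open>pq\<close> and off all lines that join \<open>p\<close> or \<open>q\<close> to another base point.
Allowing \<open>a = 0\<close> in the conclusion records that \<open>r\<close> itself is not a base point.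
\<close>

lemma ex_clean_third:
  fixes F :: "'a::alg_closed_field form_triple"
  assumes F: "realizes d F \<mu>" and pq: "indep p q"
  shows "\<exists>r. det3 (p, q, r) \<noteq> 0 \<and> (\<forall>a b. b \<noteq> 0 \<longrightarrow> \<mu> (scale a p + scale b r) = 0) \<and>
    (\<forall>a b. b \<noteq> 0 \<longrightarrow> \<mu> (scale a q + scale b r) = 0)"
proof -
  define S where "S = rep ` support \<mu>"
  have \<mu>: "projective \<mu>" and S: "finite S" using F by (auto simp: realizes_def S_def)
  have p0: "p \<noteq> 0" and q0: "q \<noteq> 0"
    using pq by (cases p; cases q; auto simp: indep_def zero_prod_def)+
  define N where "N = insert (cross p q) (cross p ` {b \<in> S. indep p b} \<union> cross q ` {b \<in> S. indep q b})"
  have "finite N" "0 \<notin> N" using S pq by (auto simp: N_def indep_def)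
  then obtain r where r: "\<forall>n\<in>N. dot n r \<noteq> 0"
    using ex_general_vector[of "1 :: 'a poly3" N] by auto
  have det: "dot (cross p q) r \<noteq> 0" using r by (simp add: N_def)
  have clean: "\<mu> (scale a v + scale b r) = 0"
    if v: "v \<noteq> 0" and good: "\<And>y. y \<in> S \<Longrightarrow> indep v y \<Longrightarrow> dot (cross v y) r \<noteq> 0"
      and vr: "\<And>k. r \<noteq> scale k v" and b: "b \<noteq> 0" for v a b
  proof (rule ccontr)
    let ?w = "scale a v + scale b r"
    assume nz: "\<mu> ?w \<noteq> 0"
    have w: "r = scale (inverse b) ?w + scale (- (inverse b * a)) v"
      using b by (cases v; cases r) (simp add: field_simps)
    have w0: "?w \<noteq> 0"
    proof
      assume "?w = 0"
      then have "r = scale (- (inverse b * a)) v" using w by (simp add: scale_0) (cases v; simp add: zero_prod_def)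
      then show False using vr by blast
    qed
    then obtain k where k: "k \<noteq> 0" "?w = scale k (rep (pt ?w))" using rep_pt by blast
    have S: "rep (pt ?w) \<in> S" using nz by (simp add: S_def support_def projective_rep_pt[OF \<mu> w0])
    show False
    proof (cases "indep v (rep (pt ?w))")
      case True
      have "b * dot (cross v (rep (pt ?w))) r = dot (cross v (rep (pt ?w))) ?w"
        by (simp add: dot_add dot_scale dot_cross(1))
      also have "\<dots> = 0" by (subst (2) k(2)) (simp add: dot_scale dot_cross(2))
      finally show False using good[OF S True] b by simp
    next
      case False
      then obtain c where "rep (pt ?w) = scale c v" using indep_iff[OF v] by blast
      then have "?w = scale (k * c) v" using k(2) by (simp add: scale_scale)
      then have "r = scale (inverse b * (k * c) - inverse b * a) v"
        using w by (cases v; simp add: algebra_simps)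
      then show False using vr by blast
    qed
  qed
  have rp: "r \<noteq> scale k p" and rq: "r \<noteq> scale k q" for k
    using det by (auto simp: dot_scale dot_cross(1,2))
  have "det3 (p, q, r) = dot (cross p q) r"
    by (cases p; cases q; cases r) (simp add: det3_def algebra_simps)
  then have "det3 (p, q, r) \<noteq> 0" using det by simp
  moreover have "\<forall>a b. b \<noteq> 0 \<longrightarrow> \<mu> (scale a p + scale b r) = 0"
    using r by (auto simp: N_def intro!: clean[OF p0 _ rp])
  moreover have "\<forall>a b. b \<noteq> 0 \<longrightarrow> \<mu> (scale a q + scale b r) = 0"
    using r by (auto simp: N_def intro!: clean[OF q0 _ rq])
  ultimately show ?thesis by blast
qed

lemma ex_clean_second:
  fixes F :: "'a::alg_closed_field form_triple"
  assumes F: "realizes d F \<mu>" and p: "p \<noteq> 0"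
  shows "\<exists>q. indep p q \<and> (\<forall>a b. b \<noteq> 0 \<longrightarrow> \<mu> (scale a p + scale b q) = 0)"
proof -
  obtain x where "indep p x" using ex_indep[OF p] by blast
  then obtain q where q: "det3 (p, x, q) \<noteq> 0" "\<forall>a b. b \<noteq> 0 \<longrightarrow> \<mu> (scale a p + scale b q) = 0"
    using ex_clean_third[OF F] by blast
  have "cross p q \<noteq> 0"
  proof
    assume "cross p q = 0"
    moreover have "det3 (p, x, q) = - dot (cross p q) x"
      by (cases p; cases q; cases x) (simp add: det3_def algebra_simps)
    ultimately show False using q(1) by (cases x) (simp add: zero_prod_def)
  qed
  then show ?thesis using q(2) by (auto simp: indep_def)
qed

lemma clean_imp_0: "\<forall>a b. b \<noteq> 0 \<longrightarrow> \<mu> (scale a p + scale b q) = 0 \<Longrightarrow> \<mu> q = 0"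
  by (drule spec[of _ 0], drule spec[of _ 1]) (simp add: scale_0 scale_1)

definition attains :: "'a::alg_closed_field itself \<Rightarrow> nat \<Rightarrow> nat multiset \<Rightarrow> bool" where
  "attains _ d M \<longleftrightarrow> (\<exists>(F :: 'a form_triple) \<mu>. realizes d F \<mu> \<and> mults \<mu> = M)"

lemma realizes_identity: "realizes 1 (XYZ :: 'a::alg_closed_field form_triple) (\<lambda>_. 0)"
proof -
  have "ordinary XYZ v 0" if "v \<noteq> 0" for v :: "'a vec"
    unfolding ordinary_0_iff[OF that]
    using that by (cases v) (auto simp: XYZ_def zero_prod_def eval3_simps[OF hom_id])
  moreover have "birational (XYZ :: 'a form_triple)"
    unfolding birational_def composes_to_id_iff compose_XYZ
    by (intro exI[of _ 1] exI[of _ XYZ] conjI) (auto simp: scale_1 XYZ_def is_form_X[simplified] is_form_Y[simplified] is_form_Z[simplified])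
  ultimately show ?thesis
    by (auto simp: realizes_def projective_def support_def XYZ_def is_form_X[simplified] is_form_Y[simplified] is_form_Z[simplified])
qed

lemma mults_0: "mults (\<lambda>_. 0) = {#}"
  by (simp add: mults_def support_def)

lemma attains_identity: "attains TYPE('a::alg_closed_field) 1 {#}"
  unfolding attains_def using realizes_identity mults_0 by blast

text \<open>
One base point of multiplicity \<open>m\<close>, or a general point if \<open>m = 0\<close>, and two general points.
\<close>

lemma attains_step:
  assumes "attains TYPE('a::alg_closed_field) d M" and m: "m = 0 \<or> m \<in># M" "m \<le> d"
  shows "\<exists>M'. attains TYPE('a) (2 * d - m) M' \<and> M' + nonzero {#m#} = M + nonzero {#d, d - m, d - m#}"
proof -
  obtain F :: "'a form_triple" and \<mu> where F: "realizes d F \<mu>" and M: "mults \<mu> = M"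
    using assms(1) by (auto simp: attains_def)
  obtain p where p: "p \<noteq> 0" "\<mu> p = m"
  proof (cases "m = 0")
    case True
    have "(1, 0, 0) \<noteq> (0 :: 'a vec)" by (simp add: zero_prod_def)
    then obtain q where q: "indep (1, 0, 0) q" "\<forall>a b. b \<noteq> 0 \<longrightarrow> \<mu> (scale a (1, 0, 0) + scale b q) = 0"
      using ex_clean_second[OF F] by blast
    have "\<mu> q = 0" by (rule clean_imp_0[OF q(2)])
    with q(1) show ?thesis using True by (intro that[of q]) (auto simp: indep_def zero_prod_def)
  next
    case False
    then have "m \<in># mults \<mu>" using m M by simp
    then obtain x where "m = \<mu> (rep x)" by (auto simp: mults_def)
    then show ?thesis using rep_nonzero by (intro that[of "rep x"]) auto
  qed
  obtain q where q: "indep p q" "\<forall>a b. b \<noteq> 0 \<longrightarrow> \<mu> (scale a p + scale b q) = 0"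
    using ex_clean_second[OF F p(1)] by blast
  obtain r where r: "det3 (p, q, r) \<noteq> 0" "\<forall>a b. b \<noteq> 0 \<longrightarrow> \<mu> (scale a p + scale b r) = 0"
      "\<forall>a b. b \<noteq> 0 \<longrightarrow> \<mu> (scale a q + scale b r) = 0"
    using ex_clean_third[OF F q(1)] by blast
  have 0: "\<mu> q = 0" "\<mu> r = 0" using clean_imp_0 q(2) r(2) by blast+
  have "clean_line \<mu> p q" "clean_line \<mu> q r" "clean_line \<mu> p r"
    using q(2) r(2,3) by (auto simp: clean_line_def)
  moreover have "\<mu> p + \<mu> q \<le> d" "\<mu> q + \<mu> r \<le> d" "\<mu> p + \<mu> r \<le> d"
    using 0 p m by auto
  ultimately have "\<exists>(F' :: 'a form_triple) \<nu>. realizes (2 * d - m - 0 - 0) F' \<nu> \<and>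
    mults \<nu> + nonzero {#m, 0, 0#} = M + nonzero {#d - 0 - 0, d - 0 - m, d - m - 0#}"
    using quadratic_step[OF F r(1)] unfolding 0 p(2) M by blast
  moreover have "nonzero {#m, 0, 0#} = nonzero {#m#}" by simp
  ultimately obtain F' :: "'a form_triple" and \<nu>
    where "realizes (2 * d - m) F' \<nu>" "mults \<nu> + nonzero {#m#} = M + nonzero {#d, d - m, d - m#}"
    unfolding diff_zero by metis
  then show ?thesis unfolding attains_def by blast
qed

text \<open>
Here the degree exceeds the multiplicity \<open>m + 3n\<close> of the chosen base point by 3. Each step raises both
numbers by 3 and adds two general points, which become triple.
\<close>

lemma attains_ladder:
  assumes "attains TYPE('a::alg_closed_field) (m + 3) (add_mset m M)" "0 < m"
  shows "attains TYPE('a) (m + 3 * n + 3) (add_mset (m + 3 * n) (replicate_mset (2 * n) 3 + M))"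
proof (induction n)
  case (Suc n)
  let ?e = "m + 3 * n"
  obtain M' where M': "attains TYPE('a) (2 * (?e + 3) - ?e) M'"
    "M' + nonzero {#?e#} = add_mset ?e (replicate_mset (2 * n) 3 + M) + nonzero {#?e + 3, ?e + 3 - ?e, ?e + 3 - ?e#}"
    using attains_step[OF Suc, of ?e] by auto
  have "M' = add_mset (m + 3 * Suc n) (replicate_mset (2 * Suc n) 3 + M)"
    using M'(2) assms(2) by (simp add: numeral_eq_Suc)
  moreover have "2 * (?e + 3) - ?e = m + 3 * Suc n + 3" by simp
  ultimately show ?case using M'(1) by (simp only:)
qed (use assms in simp)

section \<open>A quartic map with explicit base points\<close>

text \<open>
The standard quadratic map with base points \<open>n u = (1 : u : u\<^sup>2)\<close>, \<open>u \<in> U\<close>, is pulled back by another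
one based at the vertices of the triangle of reference. The vertices become double points, and the
simple points become the preimages \<open>s u = (u\<^sup>2 : u : 1)\<close> of the points \<open>n u\<close>. No line through two of the
\<open>s u\<close> contains the third, as they lie on a conic; such a line avoids \<open>e\<^sub>1\<close> and \<open>e\<^sub>3\<close> because the values
\<open>u\<close> are distinct and nonzero, and \<open>e\<^sub>2\<close> because their squares are distinct.
\<close>

lemma special_quartic:
  fixes U :: "'a::alg_closed_field set"
  assumes U: "U = {x, y, z}" "x \<noteq> 0" "y \<noteq> 0" "z \<noteq> 0" "x ^ 2 \<noteq> y ^ 2" "y ^ 2 \<noteq> z ^ 2" "x ^ 2 \<noteq> z ^ 2"
  defines "s \<equiv> \<lambda>u :: 'a. (u ^ 2, u, 1)"
  shows "\<exists>(F :: 'a form_triple) \<mu>. realizes 4 F \<mu> \<and> mults \<mu> = {#2, 2, 2, 1, 1, 1#} \<and>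
     (\<forall>u\<in>U. \<mu> (s u) = 1) \<and> (\<forall>u\<in>U. \<forall>v\<in>U. u \<noteq> v \<longrightarrow> clean_line \<mu> (s u) (s v))"
proof -
  define n where "n = (\<lambda>u :: 'a. (1 :: 'a, u, u ^ 2))"
  have ne: "x \<noteq> y" "y \<noteq> z" "x \<noteq> z" using U by auto
  let ?N = "(n x, n y, n z)"
  have "det3 ?N = (y - x) * (z - x) * (z - y)"
    by (simp add: det3_def n_def power2_eq_square algebra_simps)
  then have "det3 ?N \<noteq> 0" using ne by simp
  then obtain B where B: "inverse_mat ?N B" "inverse_mat B ?N" by (rule ex_inverse_mat)
  let ?B = "mat B"
  have NB: "mat ?N (?B v) = v" and BN: "?B (mat ?N v) = v" for v
    using B by (simp_all add: inverse_mat_def)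
  define \<mu>1 :: "'a vec \<Rightarrow> nat" where "\<mu>1 = pullback_mult 1 (\<lambda>_. 0)"
  have "clean_edges (\<lambda>_ :: 'a vec. 0)" by (simp add: clean_edges_def)
  from sigma_step[OF realizes_identity this refl refl refl]
  obtain F1 :: "'a form_triple" where F1: "realizes 2 F1 \<mu>1" "mults \<mu>1 = {#1, 1, 1#}"
    by (auto simp: \<mu>1_def mults_0)
  define \<mu>2 where "\<mu>2 v = \<mu>1 (?B v)" for v
  have F2: "realizes 2 (map_vec (lin_subst B) F1) \<mu>2" "mults \<mu>2 = {#1, 1, 1#}"
    using realizes_lin[OF F1(1) B(2,1)] F1(2) unfolding \<mu>2_def by simp_all
  have \<mu>2: "projective \<mu>2" using F2(1) by (simp add: realizes_def)
  have \<mu>2_n: "\<mu>2 (n u) = 1" if "u \<in> U" for u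
  proof -
    have "n x = mat ?N (1, 0, 0)" "n y = mat ?N (0, 1, 0)" "n z = mat ?N (0, 0, 1)"
      by (simp_all only: lin_unit)
    then have "?B (n x) = (1, 0, 0)" "?B (n y) = (0, 1, 0)" "?B (n z) = (0, 0, 1)" using BN by metis+
    then show ?thesis using that U(1) by (auto simp: \<mu>2_def \<mu>1_def)
  qed
  have \<mu>2_nz: "\<exists>k. k \<noteq> 0 \<and> (\<exists>u\<in>U. v = scale k (n u))" if "v \<noteq> 0" "\<mu>2 v \<noteq> 0" for v
  proof -
    obtain a b c where w: "?B v = (a, b, c)" by (cases "?B v")
    have "?B v \<noteq> 0" using NB[of v] that(1) lin_0 by metis
    then have 1: "\<not> (a = 0 \<and> b = 0 \<and> c = 0)" unfolding w zero_prod_def by simp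
    have "pullback_mult 1 (\<lambda>_. 0) (a, b, c) \<noteq> 0"
      using that(2) unfolding \<mu>2_def \<mu>1_def w .
    then have "a \<noteq> 0 \<and> b = 0 \<and> c = 0 \<or> a = 0 \<and> b \<noteq> 0 \<and> c = 0 \<or> a = 0 \<and> b = 0 \<and> c \<noteq> 0"
      using 1 by (cases "a = 0"; cases "b = 0"; cases "c = 0") simp_all
    moreover have "v = scale a (n x) + scale b (n y) + scale c (n z)"
      using NB[of v] unfolding w lin.simps map_vec_id by (rule sym)
    ultimately show ?thesis
      unfolding U(1) by (auto simp: scale_0)
  qed
  have coords: "fst v \<noteq> 0 \<and> fst (snd v) \<noteq> 0 \<and> snd (snd v) \<noteq> 0" if "v \<noteq> 0" "\<mu>2 v \<noteq> 0" for v
    using \<mu>2_nz[OF that] U by (auto simp: n_def)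
  have zero: "\<mu>2 (a, b, c) = 0" if "(a, b, c) \<noteq> 0" "a = 0 \<or> b = 0 \<or> c = 0" for a b c
    using coords[of "(a, b, c)"] that by auto
  have clean2: "clean_edges \<mu>2" and unit2: "\<mu>2 (1, 0, 0) = 0" "\<mu>2 (0, 1, 0) = 0" "\<mu>2 (0, 0, 1) = 0"
    using zero by (auto simp: clean_edges_def zero_prod_def)
  define \<mu>3 where "\<mu>3 = pullback_mult 2 \<mu>2"
  obtain F3 :: "'a form_triple" where F3: "realizes 4 F3 \<mu>3"
    using sigma_step(1)[OF F2(1) clean2 unit2] by (auto simp: \<mu>3_def)
  have M3: "mults \<mu>3 = {#2, 2, 2, 1, 1, 1#}"
    using sigma_step(2)[OF F2(1) clean2 unit2] F2(2) by (simp add: \<mu>3_def)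
  have \<mu>3_s: "\<mu>3 (s u) = 1" if "u \<in> U" for u
  proof -
    have "u \<noteq> 0" using that U by auto
    moreover have "(u, u ^ 2, u ^ 2 * u) = scale u (n u)" by (simp add: n_def power2_eq_square)
    ultimately show ?thesis
      using \<mu>2_n[OF that] projectiveD[OF \<mu>2 \<open>u \<noteq> 0\<close>, of "n u"] by (simp add: \<mu>3_def s_def del: scale.simps)
  qed
  have \<mu>3_nz: "(b = 0 \<and> c = 0) \<or> (a = 0 \<and> c = 0) \<or> (a = 0 \<and> b = 0) \<or> (\<exists>u\<in>U. a = u * b \<and> b = u * c)"
    if nz: "\<mu>3 (a, b, c) \<noteq> 0" for a b c
  proof (cases "a \<noteq> 0 \<and> b \<noteq> 0 \<and> c \<noteq> 0")
    case True
    then have "(b * c, a * c, a * b) \<noteq> 0" "\<mu>2 (b * c, a * c, a * b) \<noteq> 0"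
      using nz by (simp_all add: \<mu>3_def zero_prod_def)
    then obtain k u where u: "u \<in> U" "(b * c, a * c, a * b) = scale k (n u)" using \<mu>2_nz by blast
    then have e: "b * c = k" "a * c = k * u" "a * b = k * u ^ 2" by (simp_all add: n_def)
    have "c * a = c * (u * b)" "a * b = a * (u * c)"
      using e by (simp_all add: power2_eq_square algebra_simps)
    then have "a = u * b" "b = u * c" using True by simp_all
    then show ?thesis using u by blast
  next
    case False
    then show ?thesis using nz by (auto simp: \<mu>3_def split: if_splits)
  qed
  have "clean_line \<mu>3 (s u) (s v)" if uv: "u \<in> U" "v \<in> U" "u \<noteq> v" for u v
    unfolding clean_line_def
  proof (intro allI impI, rule ccontr)
    fix a b :: 'a assume ab: "a \<noteq> 0" "b \<noteq> 0" and nz: "\<mu>3 (scale a (s u) + scale b (s v)) \<noteq> 0"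
    have sq: "u ^ 2 \<noteq> v ^ 2" and uv0: "u \<noteq> 0" "v \<noteq> 0" using uv U by auto
    have "scale a (s u) + scale b (s v) = (a * u ^ 2 + b * v ^ 2, a * u + b * v, a + b)"
      by (simp add: s_def)
    with nz have "(a * u + b * v = 0 \<and> a + b = 0) \<or> (a * u ^ 2 + b * v ^ 2 = 0 \<and> a + b = 0) \<or>
       (a * u ^ 2 + b * v ^ 2 = 0 \<and> a * u + b * v = 0) \<or>
       (\<exists>w\<in>U. a * u ^ 2 + b * v ^ 2 = w * (a * u + b * v) \<and> a * u + b * v = w * (a + b))"
      using \<mu>3_nz by metis
    then consider "a * u + b * v = 0" "a + b = 0" | "a * u ^ 2 + b * v ^ 2 = 0" "a + b = 0" |
       "a * u ^ 2 + b * v ^ 2 = 0" "a * u + b * v = 0" |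
       w where "a * u ^ 2 + b * v ^ 2 = w * (a * u + b * v)" "a * u + b * v = w * (a + b)" by blast
    then show False
    proof cases
      case 1
      then have "a * (u - v) = 0" by algebra
      then show False using ab uv by simp
    next
      case 2
      then have "a * (u ^ 2 - v ^ 2) = 0" by algebra
      then show False using ab sq by simp
    next
      case 3
      then have "a * u * (u - v) = 0" by algebra
      then show False using ab uv uv0 by simp
    next
      case 4
      then have "b * (v - w) * (v - u) = 0" by algebra
      then have "v = w" using ab uv by simp
      then have "a * (u - v) = 0" using 4(2) by (simp add: algebra_simps)
      then show False using ab uv by simp
    qed
  qed
  then show ?thesis using F3 M3 \<mu>3_s by blast
qed

text \<open>
A quadratic map based at three simple points of the quartic map gives \<open>(5; 2\<^sup>6)\<close>; one based at two of
them and a general point gives \<open>(6; 3\<^sup>2, 2\<^sup>4, 1)\<close>.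
\<close>

lemma attains_quintic_sextic:
  "attains TYPE('a::alg_closed_field) 5 {#2, 2, 2, 2, 2, 2#}"
  "attains TYPE('a) 6 {#3, 3, 2, 2, 2, 2, 1#}"
proof -
  \<comment> \<open>a parameter \<open>t\<close> with \<open>t ^ 5 \<noteq> t\<close> makes 1, \<open>t\<close>, \<open>t\<^sup>2\<close> nonzero with distinct squares\<close>
  have "coeff (monom (1 :: 'a) 5 - monom 1 1) 5 \<noteq> 0" by simp
  then have "monom (1 :: 'a) 5 - monom 1 1 \<noteq> 0" by (metis coeff_0)
  then obtain t :: 'a where "poly (monom 1 5 - monom 1 1) t \<noteq> 0" using ex_nonroot by blast
  then have t: "t ^ 5 \<noteq> t" by (simp add: poly_monom)
  have t0: "t \<noteq> 0" using t by auto
  have t2: "t ^ 2 \<noteq> 1" and t4: "t ^ 4 \<noteq> 1"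
  proof -
    show t4: "t ^ 4 \<noteq> 1"
    proof
      assume "t ^ 4 = 1"
      then have "t ^ 5 = t" by algebra
      then show False using t by simp
    qed
    show "t ^ 2 \<noteq> 1"
    proof
      assume "t ^ 2 = 1"
      then have "t ^ 4 = 1" by algebra
      then show False using t4 by simp
    qed
  qed
  have tt: "t ^ 2 \<noteq> (t ^ 2) ^ 2"
  proof
    assume "t ^ 2 = (t ^ 2) ^ 2"
    then have "t ^ 2 * (t ^ 2 - 1) = 0" by algebra
    then show False using t0 t2 by simp
  qed
  let ?U = "{1, t, t ^ 2} :: 'a set"
  let ?s = "\<lambda>u :: 'a. (u ^ 2, u, 1)"
  have t22: "(t ^ 2) ^ 2 = t ^ 4" by algebra
  have nz: "(1 :: 'a) \<noteq> 0" "t ^ 2 \<noteq> 0" "1 ^ 2 \<noteq> t ^ 2" "1 ^ 2 \<noteq> (t ^ 2) ^ 2"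
    using t0 t2 t4 unfolding t22 by auto
  obtain F :: "'a form_triple" and \<mu> where F: "realizes 4 F \<mu>" and M: "mults \<mu> = {#2, 2, 2, 1, 1, 1#}"
    and s: "\<forall>u\<in>?U. \<mu> (?s u) = 1"
    and clean: "\<forall>u\<in>?U. \<forall>v\<in>?U. u \<noteq> v \<longrightarrow> clean_line \<mu> (?s u) (?s v)"
    using special_quartic[OF refl nz(1) t0 nz(2,3) tt nz(4)] by blast
  have ne: "1 \<noteq> t" "t \<noteq> t ^ 2" "1 \<noteq> t ^ 2" using t2 tt by (auto simp: power2_eq_square)
  have s3: "\<mu> (?s 1) = 1" "\<mu> (?s t) = 1" "\<mu> (?s (t ^ 2)) = 1" using s by simp_all
  have cl: "clean_line \<mu> (?s 1) (?s t)" "clean_line \<mu> (?s t) (?s (t ^ 2))" "clean_line \<mu> (?s 1) (?s (t ^ 2))"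
    using clean ne by blast+
  have "det3 (?s 1, ?s t, ?s (t ^ 2)) = (1 - t) * (1 - t ^ 2) * (t - t ^ 2)"
    by (simp add: det3_def) algebra
  then have "det3 (?s 1, ?s t, ?s (t ^ 2)) \<noteq> 0" using ne by simp
  from quadratic_step[OF F this cl] obtain F' :: "'a form_triple" and \<nu>
    where "realizes 5 F' \<nu>" "mults \<nu> + {#1, 1, 1#} = {#2, 2, 2, 1, 1, 1#} + {#2, 2, 2#}"
    unfolding s3 M by auto
  then show "attains TYPE('a) 5 {#2, 2, 2, 2, 2, 2#}"
    unfolding attains_def by (intro exI[of _ F'] exI[of _ \<nu>]) simp
  have "indep (?s 1) (?s t)" using ne by (simp add: indep_def zero_prod_def)
  from ex_clean_third[OF F this] obtain r where r: "det3 (?s 1, ?s t, r) \<noteq> 0"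
    "\<forall>a b. b \<noteq> 0 \<longrightarrow> \<mu> (scale a (?s 1) + scale b r) = 0" "\<forall>a b. b \<noteq> 0 \<longrightarrow> \<mu> (scale a (?s t) + scale b r) = 0" by blast
  have r0: "\<mu> r = 0" using clean_imp_0[OF r(2)] .
  have "clean_line \<mu> (?s t) r" "clean_line \<mu> (?s 1) r" using r(2,3) by (auto simp: clean_line_def)
  from quadratic_step[OF F r(1) cl(1) this] obtain F' :: "'a form_triple" and \<nu>
    where "realizes 6 F' \<nu>" "mults \<nu> + {#1, 1#} = {#2, 2, 2, 1, 1, 1#} + {#3, 3, 2#}"
    unfolding s3 M r0 by auto
  then show "attains TYPE('a) 6 {#3, 3, 2, 2, 2, 2, 1#}"
    unfolding attains_def by (intro exI[of _ F'] exI[of _ \<nu>]) simp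
qed

section \<open>Forms on a line\<close>

lemma degree_power_linear_le: "degree p \<le> 1 \<Longrightarrow> degree (p ^ n) \<le> n"
  using degree_power_le[of p n] by (metis mult.commute mult.right_neutral mult_le_mono2 order_trans)

lemma degree_ev_form:
  assumes G: "is_form d G" and u: "degree a \<le> 1" "degree b \<le> 1" "degree c \<le> 1"
  shows "degree (ev_arc G (a, b, c)) \<le> d"
proof -
  have "degree ([:coeff (coeff (coeff G l) j) i:] * a ^ i * b ^ j * c ^ l) \<le> d" for i j l
  proof (cases "coeff (coeff (coeff G l) j) i = 0")
    case False
    then have "i + j + l = d" using G by (auto simp: is_form_def)
    moreover have "degree ([:coeff (coeff (coeff G l) j) i:] * a ^ i * b ^ j * c ^ l) \<le> 0 + degree (a ^ i) + degree (b ^ j) + degree (c ^ l)"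
      by (intro order_trans[OF degree_mult_le] add_mono) simp_all
    ultimately show ?thesis using degree_power_linear_le[OF u(1), of i]
      degree_power_linear_le[OF u(2), of j] degree_power_linear_le[OF u(3), of l] by linarith
  qed simp
  then show ?thesis
    unfolding ev.simps eval3_sum[OF hom_const] by (intro degree_sum_le) simp_all
qed

text \<open>
The restriction of a form to the line through \<open>v\<close> and \<open>w\<close> is a binary form with coefficients \<open>k\<close>. By
homogeneity the identity holds at all vectors with \<open>x \<noteq> 0\<close>, hence between polynomials, hence in
every algebra.
\<close>

lemma binary_form:
  fixes G :: "'a::alg_closed_field poly3" and e :: "'a \<Rightarrow> 'b::comm_ring_1" and v w :: "'a vec"
  assumes G: "is_form d G" and e: "is_hom e"
  defines "k \<equiv> coeff (ev_arc G (arc 1 v (cvec w)))"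
  shows "ev e G (scale x (map_vec e v) + scale y (map_vec e w)) = (\<Sum>j\<le>d. e (k j) * x ^ (d - j) * y ^ j)"
proof -
  let ?P = "ev_arc G (arc 1 v (cvec w))"
  have arc: "arc 1 v (cvec w) = ([:fst v, fst w:], [:fst (snd v), fst (snd w):], [:snd (snd v), snd (snd w):])"
    by (cases v; cases w) (simp add: one_pCons)
  have deg: "degree ?P \<le> d"
    unfolding arc by (rule degree_ev_form[OF G]) simp_all
  have P: "poly ?P t = ev (\<lambda>c. c) G (v + scale t w)" for t
  proof -
    have "map_vec (\<lambda>p. poly p t) (arc 1 v (cvec w)) = v + scale t w"
      by (cases v; cases w) simp
    then show ?thesis by (subst hom_of_ev[OF hom_poly hom_const]) simp
  qed
  have sum: "poly ?P t = (\<Sum>j\<le>d. k j * t ^ j)" for t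
    using arg_cong[OF poly_as_sum_of_monoms'[OF deg], of "\<lambda>p. poly p t"]
    by (simp add: poly_sum poly_monom k_def)
  \<comment> \<open>the difference of the two sides for the generic \<open>x\<close> and \<open>y\<close>\<close>
  define D where "D = ev const3 G (scale X3 (map_vec const3 v) + scale Y3 (map_vec const3 w)) -
     (\<Sum>j\<le>d. const3 (k j) * X3 ^ (d - j) * Y3 ^ j)"
  have evD: "ev e' D (x, y, z) = ev e' G (scale x (map_vec e' v) + scale y (map_vec e' w)) -
      (\<Sum>j\<le>d. e' (k j) * x ^ (d - j) * y ^ j)"
    if e': "is_hom e'" for e' :: "'a \<Rightarrow> 'c::comm_ring_1" and x y z
  proof -
    note h = hom_ev[OF e', of "(x, y, z)"]
    have 1: "map_vec (\<lambda>g. ev e' g (x, y, z)) (map_vec const3 u) = map_vec e' u" for u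
      by (simp add: map_vec_map_vec ev_const3[OF e'] del: ev.simps)
    have 2: "ev e' X3 (x, y, z) = x" "ev e' Y3 (x, y, z) = y"
      by (simp_all add: eval3_simps[OF e'])
    show ?thesis
      unfolding D_def hom_diff[OF h] ev_subst[OF e'] map_vec_add[OF h] map_vec_scale[OF h] 1 2
        hom_sum[OF h] hom_mult[OF h] hom_power[OF h] ev_const3[OF e'] ..
  qed
  have "D = 0"
  proof (rule ccontr)
    assume "D \<noteq> 0"
    then obtain p where p: "ev (\<lambda>c. c) D p \<noteq> 0" "dot (1, 0, 0) p \<noteq> 0"
      using ex_general_vector[of D "{(1, 0, 0)}"] by (auto simp: zero_prod_def)
    obtain a b c where abc: "p = (a, b, c)" by (cases p)
    have a: "a \<noteq> 0" using p(2) by (simp add: abc)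
    have "scale a v + scale b w = scale a (v + scale (b / a) w)"
      using a by (cases v; cases w) (simp add: algebra_simps)
    then have "ev (\<lambda>c. c) G (scale a v + scale b w) = a ^ d * poly ?P (b / a)"
      unfolding P by (simp only: ev_form_scale[OF G hom_id])
    also have "\<dots> = (\<Sum>j\<le>d. a ^ d * (k j * (b / a) ^ j))"
      unfolding sum by (simp add: sum_distrib_left)
    also have "\<dots> = (\<Sum>j\<le>d. k j * a ^ (d - j) * b ^ j)"
    proof (rule sum.cong[OF refl])
      fix j assume "j \<in> {..d}"
      then have "a ^ d = a ^ (d - j) * a ^ j" by (simp add: power_add[symmetric])
      then show "a ^ d * (k j * (b / a) ^ j) = k j * a ^ (d - j) * b ^ j"
        using a by (simp add: power_divide)
    qed
    finally show False using p(1) unfolding abc evD[OF hom_id] map_vec_id by simp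
  qed
  then have "ev e D (x, y, 0) = 0" by (simp only: hom_0[OF hom_ev[OF e]])
  then show ?thesis unfolding evD[OF e] by (simp only: right_minus_eq)
qed

lemma tangent_decomposition: "\<exists>c x y. w = scale c (rep p) + tangent p x y"
proof -
  obtain x y z where w: "w = (x, y, z)" by (cases w)
  show ?thesis
  proof (cases p)
    case (PA a b)
    then have "w = scale z (rep p) + tangent p (x - z * a) (y - z * b)" by (simp add: w)
    then show ?thesis by blast
  next
    case (PB a)
    then have "w = scale y (rep p) + tangent p (x - y * a) z" by (simp add: w)
    then show ?thesis by blast
  next
    case PC
    then have "w = scale x (rep p) + tangent p y z" by (simp add: w)
    then show ?thesis by blast
  qed
qed

lemma X_power_dvd_tangent:
  assumes "order_ge (localize p G) m"
  shows "[:0, 1:] ^ m dvd ev_arc G (arc 1 (rep p) (cvec (tangent p x y)))"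
  using order_ge_dvd[OF assms hom_const, of "[:0, 1:]" "[:x:]" "[:y:]"]
  unfolding eval2_localize[OF hom_const] tangent_mult map_tangent[OF hom_const] scale_1 .

text \<open>
The order at \<open>p\<close>, measured in the affine chart, bounds the order on every line through \<open>p\<close> in every
parametrisation: only the coefficients of \<open>binary_form\<close> with index at least \<open>m\<close> survive.
\<close>

lemma order_ge_line:
  fixes G :: "'a::alg_closed_field poly3" and e :: "'a \<Rightarrow> 'b::comm_ring_1"
  assumes G: "is_form d G" and e: "is_hom e" and ord: "order_ge (localize p G) m"
  shows "t ^ m dvd ev e G (scale s (map_vec e (rep p)) + scale t (map_vec e w))"
proof -
  obtain c x y where w: "w = scale c (rep p) + tangent p x y" using tangent_decomposition by blast
  have "scale s (map_vec e (rep p)) + scale t (map_vec e w) = scale (s + t * e c) (map_vec e (rep p)) + scale t (map_vec e (tangent p x y))"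
    unfolding w map_vec_add[OF e] map_vec_scale[OF e] scale_add scale_scale
    by (cases "map_vec e (rep p)"; cases "map_vec e (tangent p x y)") (simp add: algebra_simps)
  moreover have "t ^ m dvd ev e G (scale (s + t * e c) (map_vec e (rep p)) + scale t (map_vec e (tangent p x y)))"
    unfolding binary_form[OF G e]
  proof (rule dvd_sum)
    fix j
    let ?k = "coeff (ev_arc G (arc 1 (rep p) (cvec (tangent p x y))))"
    show "t ^ m dvd e (?k j) * (s + t * e c) ^ (d - j) * t ^ j"
    proof (cases "j < m")
      case True
      then have "?k j = 0" using X_power_dvd_tangent[OF ord, of x y] by (simp only: X_power_dvd_iff)
      then show ?thesis by (simp only: hom_0[OF e] mult_zero_left dvd_0_right)
    next
      case False
      then show ?thesis by (intro dvd_mult le_imp_power_dvd) simp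
    qed
  qed
  ultimately show ?thesis by (simp only:)
qed

section \<open>Lines in the base locus\<close>

text \<open>
In coordinates for which the line is \<open>Z = 0\<close>, all components are divisible by \<open>Z\<close>.
\<close>

lemma line_vanishing_imp_common_factor:
  fixes F :: "'a::alg_closed_field form_triple"
  assumes vw: "indep v w"
    and van: "\<And>G. G \<in> set_vec F \<Longrightarrow> ev const3 G (scale X3 (map_vec const3 v) + scale Y3 (map_vec const3 w)) = 0"
  shows "\<not> no_common_factor F"
proof -
  obtain r where r: "dot (cross v w) r \<noteq> 0"
    using ex_general_vector[of "1 :: 'a poly3" "{cross v w}"] vw by (auto simp: indep_def)
  have "det3 (v, w, r) = dot (cross v w) r"
    by (cases v; cases w; cases r) (simp add: det3_def algebra_simps)
  then obtain B where B: "inverse_mat (v, w, r) B" "inverse_mat B (v, w, r)"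
    using r ex_inverse_mat by metis
  let ?A = "lin_subst (v, w, r)" and ?B = "lin_subst B"
  have BA: "?B (?A G) = G" and AB: "?A (?B G) = G" for G
    using ev_lin_subst[OF hom_const3, of B "?A G" XYZ] ev_lin_subst[OF hom_const3, of "(v, w, r)" "?B G" XYZ]
    by (simp_all add: ev_at_XYZ ev_lin_subst[OF hom_const3] inverse_mat_lin[OF B(1) hom_const3]
        inverse_mat_lin[OF B(2) hom_const3] del: lin.simps)
  have hB: "is_hom ?B" and hA: "is_hom ?A"
    unfolding lin_subst_def by (rule hom_ev[OF hom_const3])+
  have "Z3 dvd ?A G" if "G \<in> set_vec F" for G
  proof -
    let ?h = "\<lambda>P :: 'a poly3. [:poly P 0:]"
    have h: "is_hom ?h" by (rule hom_comp[OF hom_const hom_poly])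
    have c: "(\<lambda>c :: 'a. [:poly (const3 c) 0:]) = const3" by (simp add: const3_def fun_eq_iff)
    have x: "?h X3 = X3" "?h Y3 = Y3" "?h Z3 = 0" by (simp_all add: X3_def Y3_def Z3_def)
    have "?h P = ev const3 P (X3, Y3, 0)" for P
      using hom_eq_ev[OF h, of P] unfolding c XYZ_def map_vec.simps x .
    then have "?h (?A G) = ev const3 (?A G) (X3, Y3, 0)" .
    also have "\<dots> = ev const3 G (scale X3 (map_vec const3 v) + scale Y3 (map_vec const3 w))"
      unfolding ev_lin_subst[OF hom_const3] lin.simps scale_0 by simp
    also have "\<dots> = 0" by (rule van[OF that])
    finally show ?thesis by (simp add: Z3_def X_dvd_iff)
  qed
  then have "?B Z3 dvd G" if "G \<in> set_vec F" for G
    using hom_dvd[OF hB, of Z3 "?A G"] that by (simp add: BA)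
  moreover have "\<not> ?B Z3 dvd 1"
  proof
    assume "?B Z3 dvd 1"
    then have "?A (?B Z3) dvd ?A 1" by (rule hom_dvd[OF hA])
    then have "Z3 dvd (1 :: 'a poly3)" by (simp add: AB hom_1[OF hA])
    then show False by (simp add: Z3_def X_dvd_iff)
  qed
  ultimately show ?thesis by (cases F) auto
qed

lemma line_coeffs_0_imp_common_factor:
  fixes F :: "'a::alg_closed_field form_triple"
  assumes F: "is_form_triple d F" and vw: "indep v w"
    and k: "\<And>G j. G \<in> set_vec F \<Longrightarrow> j \<le> d \<Longrightarrow> coeff (ev_arc G (arc 1 v (cvec w))) j = 0"
  shows "\<not> no_common_factor F"
proof (rule line_vanishing_imp_common_factor[OF vw])
  fix G assume G: "G \<in> set_vec F"
  then have "is_form d G" using F by (simp add: is_form_triple_iff)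
  then show "ev const3 G (scale X3 (map_vec const3 v) + scale Y3 (map_vec const3 w)) = 0"
    unfolding binary_form[OF \<open>is_form d G\<close> hom_const3] using k[OF G]
    by (intro sum.neutral) (simp add: hom_0[OF hom_const3])
qed

section \<open>Multiplicities do not increase under blowing up\<close>

text \<open>
The strict transform, restricted to the exceptional curve, is the dehomogenised initial form of \<open>f\<close>.
This is a nonzero polynomial of degree at most \<open>m\<close>, so its order at a point is at most \<open>m\<close>.
\<close>

lemma order_ge_strict_transform:
  fixes f g :: "'a::alg_closed_field poly2"
  assumes f: "order_ge f m" "coeff (coeff f j0) i0 \<noteq> 0" "i0 + j0 = m"
    and g: "blowup_pullback s f = exceptional s ^ m * g" and n: "order_ge g n"
  shows "n \<le> m"
proof -
  define A B where "A = fst (curve_direction (\<lambda>c. [:c:]) s [:0, 1:])"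
    and "B = snd (curve_direction (\<lambda>c. [:c:]) s [:0, 1:])"
  define H where "H = (\<Sum>j\<le>m. [:coeff (coeff f j) (m - j):] * A ^ (m - j) * B ^ j)"
  let ?e = "\<lambda>c. [:[:c:]:]" and ?t = "[:0, 1:] :: 'a poly poly" and ?y = "[:[:0, 1:]:] :: 'a poly poly"
  have e: "is_hom ?e" by (rule hom_comp[OF hom_const hom_const])
  have AB: "fst (curve_direction ?e s ?y) = [:A:]" "snd (curve_direction ?e s ?y) = [:B:]"
    by (cases s; simp add: A_def B_def one_pCons)+
  \<comment> \<open>\<open>H\<close> is the strict transform restricted to the exceptional curve\<close>
  have "H = coeff (eval2 ?e f (?t * [:A:]) (?t * [:B:])) m"
    unfolding H_def by (rule initial_form_sum[OF hom_const, symmetric])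
  also have "\<dots> = coeff (eval2 ?e g (fst (blowup_coords s ?t ?y)) (snd (blowup_coords s ?t ?y))) 0"
    unfolding eval2_blowup[OF e g, of ?t ?y, unfolded AB]
    using coeff_X_power_mult[of m _ 0] by (simp only: add_0_right)
  also have "\<dots> = eval2 (\<lambda>c. [:c:]) g ([:0, 1:] * fst (blowup_coords s 0 1)) ([:0, 1:] * snd (blowup_coords s 0 1))"
    unfolding coeff_0_eval2[OF hom_const] by (cases s) simp_all
  finally have "[:0, 1:] ^ n dvd H" using order_ge_dvd[OF n hom_const] by (simp only:)
  moreover have "degree H \<le> m"
    unfolding H_def
  proof (rule degree_sum_le)
    fix j assume "j \<in> {..m}"
    have "degree A \<le> 1" "degree B \<le> 1" by (cases s; simp add: A_def B_def)+
    then have "degree (A ^ (m - j)) + degree (B ^ j) \<le> (m - j) + j" by (intro add_mono degree_power_linear_le)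
    moreover have "degree ([:coeff (coeff f j) (m - j):] * A ^ (m - j) * B ^ j) \<le> 0 + degree (A ^ (m - j)) + degree (B ^ j)"
      by (intro order_trans[OF degree_mult_le] add_mono) simp_all
    ultimately show "degree ([:coeff (coeff f j) (m - j):] * A ^ (m - j) * B ^ j) \<le> m"
      using \<open>j \<in> {..m}\<close> by simp
  qed simp
  moreover have "H \<noteq> 0"
  proof
    assume "H = 0"
    then have H: "(\<Sum>j\<le>m. coeff (coeff f j) (m - j) * poly A t ^ (m - j) * poly B t ^ j) = 0" for t
    proof -
      have "poly H t = 0" using \<open>H = 0\<close> by simp
      then show ?thesis unfolding H_def poly_sum by (simp add: mult.assoc)
    qed
    have j0: "j0 \<le> m" "i0 = m - j0" using f(3) by simp_all
    show False
    proof (cases s)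
      case None
      define q where "q = (\<Sum>j\<le>m. monom (coeff (coeff f j) (m - j)) (m - j))"
      have "poly q t = 0" for t using H[of t] by (simp add: q_def poly_sum poly_monom A_def B_def None)
      then have "q = 0" using ex_nonroot by blast
      moreover have "coeff q i0 = (\<Sum>j\<le>m. if j = j0 then coeff (coeff f j0) i0 else 0)"
        unfolding q_def coeff_sum using j0 by (intro sum.cong) auto
      ultimately show False using f(2) j0 by simp
    next
      case (Some a)
      define q where "q = (\<Sum>j\<le>m. monom (coeff (coeff f j) (m - j)) j)"
      have "poly q t = 0" for t
        using H[of "t - a"] by (simp add: q_def poly_sum poly_monom A_def B_def Some)
      then have "q = 0" using ex_nonroot by blast
      moreover have "coeff q j0 = (\<Sum>j\<le>m. if j = j0 then coeff (coeff f j0) i0 else 0)"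
        unfolding q_def coeff_sum using j0 by (intro sum.cong) auto
      ultimately show False using f(2) j0 by simp
    qed
  qed
  ultimately have "degree ([:0, 1:] ^ n :: 'a poly) \<le> m"
    using dvd_imp_degree_le order_trans by blast
  then show "n \<le> m" by (simp add: degree_power_eq)
qed

lemma order_ge_mono: "order_ge f m \<Longrightarrow> n \<le> m \<Longrightarrow> order_ge f n"
  unfolding order_ge_def using order_trans by blast

lemma system_mult_attained:
  assumes "V \<noteq> {}" "0 \<notin> V"
  shows "f \<in> V \<Longrightarrow> order_ge f (system_mult V)"
    and "\<exists>f\<in>V. \<exists>i j. coeff (coeff f j) i \<noteq> 0 \<and> i + j = system_mult V"
proof -
  have "\<exists>n. \<exists>f\<in>V. mult_origin f = n" using assms(1) by blast
  then have "\<exists>f\<in>V. mult_origin f = system_mult V"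
    unfolding system_mult_def by (rule LeastI_ex)
  then show "\<exists>f\<in>V. \<exists>i j. coeff (coeff f j) i \<noteq> 0 \<and> i + j = system_mult V"
    using mult_origin_attained(2) assms(2) by metis
  assume f: "f \<in> V"
  have "system_mult V \<le> mult_origin f"
    unfolding system_mult_def using f by (intro Least_le) blast
  then show "order_ge f (system_mult V)"
    using mult_origin_attained(1) order_ge_mono f assms(2) by metis
qed

text \<open>
A member that attains the multiplicity bounds the multiplicity on the blow-up.
\<close>

lemma blowup_system_mult_le:
  fixes V :: "'a::alg_closed_field poly2 set"
  assumes V: "V \<noteq> {}" "0 \<notin> V"
  shows "blowup_system s V \<noteq> {}" and "0 \<notin> blowup_system s V"
    and "system_mult (blowup_system s V) \<le> system_mult V"
proof -
  let ?m = "system_mult V"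
  have strict: "\<exists>g. blowup_pullback s f = exceptional s ^ ?m * g \<and> blowup_pullback s f div exceptional s ^ ?m = g"
    if "f \<in> V" for f
    using strict_transform[OF system_mult_attained(1)[OF V that], of s] by metis
  show W: "blowup_system s V \<noteq> {}" using V(1) by (simp add: blowup_system_def)
  show W0: "0 \<notin> blowup_system s V"
  proof
    assume "0 \<in> blowup_system s V"
    then obtain f where f: "f \<in> V" "blowup_pullback s f div exceptional s ^ ?m = 0"
      by (auto simp: blowup_system_def)
    then have 0: "blowup_pullback s f = 0" using strict by fastforce
    have "f \<noteq> 0" using f(1) V(2) by blast
    then obtain i j where ij: "coeff (coeff f j) i \<noteq> 0" "i + j = mult_origin f"
      using mult_origin_attained(2) by blast
    have "Suc (mult_origin f) \<le> mult_origin f"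
      by (rule order_ge_strict_transform[OF mult_origin_attained(1)[OF \<open>f \<noteq> 0\<close>] ij, of s 0])
        (simp_all add: 0 order_ge_def)
    then show False by simp
  qed
  obtain f i j where f: "f \<in> V" "coeff (coeff f j) i \<noteq> 0" "i + j = ?m"
    using system_mult_attained(2)[OF V] by blast
  obtain g where g: "blowup_pullback s f = exceptional s ^ ?m * g" "blowup_pullback s f div exceptional s ^ ?m = g"
    using strict[OF f(1)] by blast
  have "g \<in> blowup_system s V" using f(1) g(2) by (auto simp: blowup_system_def)
  then have "order_ge g (system_mult (blowup_system s V))"
    by (rule system_mult_attained(1)[OF W W0])
  then show "system_mult (blowup_system s V) \<le> ?m"
    by (rule order_ge_strict_transform[OF system_mult_attained(1)[OF V f(1)] f(2,3) g(1)])
qed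

lemma fold_blowup_mult_le:
  fixes V :: "'a::alg_closed_field poly2 set"
  shows "V \<noteq> {} \<Longrightarrow> 0 \<notin> V \<Longrightarrow> system_mult (fold blowup_system ss V) \<le> system_mult V"
proof (induction ss arbitrary: V)
  case (Cons s ss)
  then show ?case
    using Cons.IH[OF blowup_system_mult_le(1,2)[OF Cons.prems, of s]] blowup_system_mult_le(3)[OF Cons.prems, of s] by simp
qed simp

section \<open>Two base points on a line\<close>

text \<open>
On the tangent line with the direction \<open>s\<close>, the pullback contributes the factor \<open>t ^ m\<close>, and the strict
transform vanishes to order \<open>n\<close> at the point where it meets the exceptional curve.
\<close>

lemma order_ge_tangent:
  fixes f :: "'a::alg_closed_field poly2"
  assumes g: "blowup_pullback s f = exceptional s ^ m * g" and n: "order_ge g n"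
  shows "[:0, 1:] ^ (m + n) dvd eval2 (\<lambda>c. [:c:]) f ([:0, 1:] * [:fst (direction s):]) ([:0, 1:] * [:snd (direction s):])"
proof -
  let ?t = "[:0, 1:] :: 'a poly"
  have "fst (blowup_coords s ?t 0) = ?t * fst (blowup_coords s 1 0)"
    "snd (blowup_coords s ?t 0) = ?t * snd (blowup_coords s 1 0)" by (cases s; simp)+
  then show ?thesis
    using eval2_blowup[OF hom_const g, of ?t 0] order_ge_dvd[OF n hom_const]
    unfolding curve_direction_0[OF hom_const] fst_conv snd_conv power_add
    by (simp only: mult_dvd_mono dvd_refl)
qed

lemma indep_rep:
  assumes "p \<noteq> q" shows "indep (rep p) (rep q)"
proof (rule ccontr)
  assume "\<not> indep (rep p) (rep q)"
  then obtain c where c: "rep q = scale c (rep p)" using indep_iff[OF rep_nonzero] by blast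
  then have "c \<noteq> 0" using rep_nonzero[of q] by (auto simp: scale_0)
  then have "pt (rep q) = pt (rep p)" using c pt_scale by metis
  then show False using assms by (simp add: pt_rep)
qed

text \<open>
If the sum exceeded \<open>d\<close>, the binary forms by which the members restrict to the line through the two
points would have more zeros than their degree allows.
\<close>

lemma bezout_line:
  fixes F :: "'a::alg_closed_field form_triple"
  assumes F: "plane_cremona d F" and q: "q1 \<noteq> q2"
  shows "virtual_mult F q1 + virtual_mult F q2 \<le> d"
proof (rule ccontr)
  assume gt: "\<not> ?thesis"
  have d: "is_form_triple d F" and li: "lin_indep F" and ncf: "no_common_factor F"
    using F by (simp_all add: plane_cremona_def)
  define V where "V p = localize p ` linear_system F" for p
  have V: "V p \<noteq> {}" "0 \<notin> V p" for p
  proof -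
    show "V p \<noteq> {}" using set_vec_linear_system[of F] by (cases F) (auto simp: V_def)
    show "0 \<notin> V p"
      using localize_nonzero[OF is_form_linear_system[OF d] linear_system_nonzero[OF li]] unfolding V_def by force
  qed
  have in_V: "localize p G \<in> V p" if "G \<in> set_vec F" for p G
    using that set_vec_linear_system unfolding V_def by blast
  have form: "is_form d G" if "G \<in> set_vec F" for G using d that by (simp add: is_form_triple_iff)
  have vm: "virtual_mult F (p, ss) = system_mult (fold blowup_system ss (V p))" for p ss
    by (simp add: V_def)
  have root: "virtual_mult F (p, ss) \<le> system_mult (V p)" for p ss
    unfolding vm by (rule fold_blowup_mult_le[OF V])
  \<comment> \<open>two distinct proper points\<close>
  have proper: "system_mult (V p1) + system_mult (V p2) \<le> d" if "p1 \<noteq> p2" for p1 p2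
  proof (rule ccontr)
    assume gt: "\<not> ?thesis"
    have "\<not> no_common_factor F"
    proof (rule line_coeffs_0_imp_common_factor[OF d indep_rep[OF that]])
      fix G j assume G: "G \<in> set_vec F" and j: "j \<le> d"
      let ?k = "coeff (ev_arc G (arc 1 (rep p1) (cvec (rep p2))))"
      have ord: "order_ge (localize p G) (system_mult (V p))" for p
        by (rule system_mult_attained(1)[OF V in_V[OF G]])
      show "?k j = 0"
      proof (cases "j < system_mult (V p1)")
        case True
        then show ?thesis
          using order_ge_line[OF form[OF G] hom_const ord, of "[:0, 1:]" p1 1 "rep p2"] unfolding X_power_dvd_iff by blast
      next
        case False
        then have i: "d - j < system_mult (V p2)" using gt j by linarith
        have "[:0, 1:] ^ system_mult (V p2) dvd
            ev_arc G (scale [:0, 1:] (cvec (rep p1)) + scale 1 (cvec (rep p2)))"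
          using order_ge_line[OF form[OF G] hom_const ord, of "[:0, 1:]" p2 1 "rep p1"] by (simp only: add.commute)
        moreover have "ev_arc G (scale [:0, 1:] (cvec (rep p1)) + scale 1 (cvec (rep p2))) =
            (\<Sum>i\<le>d. [:?k i:] * [:0, 1:] ^ (d - i) * 1 ^ i)"
          by (rule binary_form[OF form[OF G] hom_const])
        ultimately have "coeff (\<Sum>i\<le>d. [:?k i:] * [:0, 1:] ^ (d - i) * 1 ^ i) (d - j) = 0"
          using i by (simp only: X_power_dvd_iff)
        moreover have "[:?k i:] * [:0, 1:] ^ (d - i) * 1 ^ i = monom (?k i) (d - i)" for i
          by (simp add: monom_altdef)
        then have "coeff (\<Sum>i\<le>d. [:?k i:] * [:0, 1:] ^ (d - i) * 1 ^ i) (d - j) = (\<Sum>i\<le>d. if i = j then ?k j else 0)"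
          unfolding coeff_sum using j by (intro sum.cong) auto
        ultimately show ?thesis using j by simp
      qed
    qed
    then show False using ncf by blast
  qed
  \<comment> \<open>a proper point and a point of its first neighbourhood\<close>
  have near: "system_mult (V p) + system_mult (blowup_system s (V p)) \<le> d" for p s
  proof (rule ccontr)
    assume gt: "\<not> ?thesis"
    let ?a = "fst (direction s)" and ?b = "snd (direction s)"
    have dir: "(?a, ?b) \<noteq> (0, 0)" by (cases s) auto
    have "\<not> no_common_factor F"
    proof (rule line_coeffs_0_imp_common_factor[OF d indep_tangent[OF dir, of p]])
      fix G j assume G: "G \<in> set_vec F" and j: "j \<le> d"
      let ?f = "localize p G"
      obtain g where g: "blowup_pullback s ?f = exceptional s ^ system_mult (V p) * g"
          "blowup_pullback s ?f div exceptional s ^ system_mult (V p) = g"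
        using strict_transform[OF system_mult_attained(1)[OF V in_V[OF G]], of s] by metis
      have "g \<in> blowup_system s (V p)" unfolding blowup_system_def using in_V[OF G] g(2) by blast
      then have "order_ge g (system_mult (blowup_system s (V p)))"
        by (rule system_mult_attained(1)[OF blowup_system_mult_le(1,2)[OF V]])
      from order_ge_tangent[OF g(1) this]
      have "[:0, 1:] ^ (system_mult (V p) + system_mult (blowup_system s (V p))) dvd
         ev_arc G (arc 1 (rep p) (cvec (tangent p ?a ?b)))"
        unfolding eval2_localize[OF hom_const] tangent_mult map_tangent[OF hom_const] scale_1 .
      then show "coeff (ev_arc G (arc 1 (rep p) (cvec (tangent p ?a ?b)))) j = 0"
        unfolding X_power_dvd_iff using j gt by simp
    qed
    then show False using ncf by blast
  qed
  have near': "virtual_mult F (p, s # ss) \<le> system_mult (blowup_system s (V p))" for p s ss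
    using fold_blowup_mult_le[OF blowup_system_mult_le(1,2)[OF V], of ss s p] by (simp add: vm del: virtual_mult.simps)
  obtain p1 ss1 p2 ss2 where q12: "q1 = (p1, ss1)" "q2 = (p2, ss2)" by (cases q1; cases q2)
  show False
  proof (cases "p1 = p2")
    case False
    then show False using proper[OF False] root[of p1 ss1] root[of p2 ss2] gt unfolding q12 by linarith
  next
    case True
    then have "ss1 \<noteq> [] \<or> ss2 \<noteq> []" using q q12 by auto
    then show False
    proof
      assume "ss1 \<noteq> []"
      then obtain s ss where ss: "ss1 = s # ss" by (cases ss1) auto
      show False using near[of p1 s] near'[of p1 s ss] root[of p1 ss2] gt unfolding q12 True[symmetric] ss by linarith
    next
      assume "ss2 \<noteq> []"
      then obtain s ss where ss: "ss2 = s # ss" by (cases ss2) auto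
      show False using near[of p1 s] near'[of p1 s ss] root[of p1 ss1] gt unfolding q12 True[symmetric] ss by linarith
    qed
  qed
qed

section \<open>The six numerical types\<close>

lemma mset_123:
  fixes M :: "int multiset"
  assumes "\<And>m. m \<in># M \<Longrightarrow> m = 1 \<or> m = 2 \<or> m = 3"
  shows "M = replicate_mset (count M 3) 3 + replicate_mset (count M 2) 2 + replicate_mset (count M 1) 1"
proof (rule multiset_eqI)
  fix x show "count M x = count (replicate_mset (count M 3) 3 + replicate_mset (count M 2) 2 + replicate_mset (count M 1) 1) x"
    using assms[of x] by (cases "x \<in># M") (auto simp: not_in_iff)
qed

lemma homaloidal_type321:
  "homaloidal_type (type321 d (d - 3) a b c) \<longleftrightarrow>
    d \<noteq> 3 \<and> 3 * int a + 2 * int b + int c = 2 * d \<and> 9 * int a + 4 * int b + int c = 6 * d - 10"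
  by (auto simp: type321_def power2_eq_square algebra_simps)

text \<open>
The two equations give \<open>b + c = 5\<close> and \<open>3a + b = 2d - 5\<close>, so \<open>b\<close> is at most 5 and its residue modulo 3
is determined by that of \<open>d\<close>.
\<close>

lemma type321_eq_cases:
  fixes a b c :: nat and d :: int
  assumes d: "d \<ge> 6" and e: "3 * int a + 2 * int b + int c = 2 * d" "9 * int a + 4 * int b + int c = 6 * d - 10"
  shows "\<exists>t::nat. t \<ge> 2 \<and>
     (d = 3 * int t \<and> ((a, b, c) = (2 * t - 2, 1, 4) \<or> (a, b, c) = (2 * t - 3, 4, 1)) \<or>
      d = 3 * int t + 1 \<and> ((a, b, c) = (2 * t - 1, 0, 5) \<or> (a, b, c) = (2 * t - 2, 3, 2)) \<or>
      d = 3 * int t + 2 \<and> ((a, b, c) = (2 * t - 1, 2, 3) \<or> (a, b, c) = (2 * t - 2, 5, 0)))"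
proof -
  define t where "t = nat (d div 3)"
  have t: "int t = d div 3" "t \<ge> 2" using d by (auto simp: t_def)
  have bc: "b + c = 5" and ab: "3 * int a + int b = 2 * d - 5" using e by linarith+
  have "d = 3 * int t \<or> d = 3 * int t + 1 \<or> d = 3 * int t + 2" using t by presburger
  moreover have "b = 0 \<or> b = 1 \<or> b = 2 \<or> b = 3 \<or> b = 4 \<or> b = 5" using bc by linarith
  ultimately show ?thesis
    using ab bc t(2) by (intro exI[of _ t]) (elim disjE; simp; presburger)
qed

text \<open>
By \<open>bezout_line\<close> the multiplicities next to \<open>d - 3\<close> are at most 3; base points have positive
multiplicity.
\<close>

lemma proper_imp_type321:
  assumes "proper_homaloidal_type TYPE('k::alg_closed_field) (d, M)" "d \<ge> 6" "Max_mset M = d - 3"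
  shows "\<exists>a b c. (d, M) = type321 d (d - 3) a b c"
proof -
  obtain d' and F :: "'k form_triple" where F: "plane_cremona d' F" "has_type d' F (d, M)"
    using assms(1) by (auto simp: proper_homaloidal_type_def)
  have hom: "homaloidal_type (d, M)" using assms(1) by (simp add: proper_homaloidal_type_def)
  let ?B = "base_points F" and ?m = "\<lambda>q. int (virtual_mult F q)"
  have B: "finite ?B" and d': "d = int d'" and M: "M = image_mset ?m (mset_set ?B)"
    using F(2) by (simp_all add: has_type_def)
  have "M \<noteq> {#}" using hom assms(2) by auto
  then have "d - 3 \<in># M" using assms(3) Max_in[of "set_mset M"] by simp
  then obtain q where q: "q \<in> ?B" "?m q = d - 3" using M B by auto
  have M': "M = add_mset (d - 3) (image_mset ?m (mset_set (?B - {q})))"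
    using B q by (simp add: M mset_set.remove)
  let ?N = "image_mset ?m (mset_set (?B - {q}))"
  have "m = 1 \<or> m = 2 \<or> m = 3" if mN: "m \<in># ?N" for m
  proof -
    obtain q' where q': "q' \<in> ?B" "q' \<noteq> q" "m = ?m q'" using mN B by (auto simp del: virtual_mult.simps)
    have "?m q' + ?m q \<le> d" using bezout_line[OF F(1) q'(2)] d' by linarith
    moreover have "?m q' > 0" using q'(1) by (simp add: base_points_def)
    ultimately show ?thesis using q(2) q'(3) by linarith
  qed
  then have "?N = replicate_mset (count ?N 3) 3 + replicate_mset (count ?N 2) 2 + replicate_mset (count ?N 1) 1"
    by (rule mset_123)
  then show ?thesis using M' unfolding type321_def by metis
qed

lemma six_types:
  assumes "proper_homaloidal_type TYPE('k::alg_closed_field) (d, M)" "d \<ge> 6" "Max_mset M = d - 3"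
  shows "\<exists>t::nat. t \<ge> 2 \<and>
         (d = 3 * int t \<and>
            ((d, M) = type321 d (d - 3) (2 * t - 2) 1 4 \<or>
             (d, M) = type321 d (d - 3) (2 * t - 3) 4 1) \<or>
          d = 3 * int t + 1 \<and>
            ((d, M) = type321 d (d - 3) (2 * t - 1) 0 5 \<or>
             (d, M) = type321 d (d - 3) (2 * t - 2) 3 2) \<or>
          d = 3 * int t + 2 \<and>
            ((d, M) = type321 d (d - 3) (2 * t - 1) 2 3 \<or>
             (d, M) = type321 d (d - 3) (2 * t - 2) 5 0))"
proof -
  obtain a b c where abc: "(d, M) = type321 d (d - 3) a b c" using proper_imp_type321[OF assms] by blast
  have "homaloidal_type (type321 d (d - 3) a b c)"
    using assms(1) unfolding abc[symmetric] proper_homaloidal_type_def by blast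
  then have e: "3 * int a + 2 * int b + int c = 2 * d" "9 * int a + 4 * int b + int c = 6 * d - 10"
    unfolding homaloidal_type321 by simp_all
  obtain t :: nat where "t \<ge> 2" and
    "d = 3 * int t \<and> ((a, b, c) = (2 * t - 2, 1, 4) \<or> (a, b, c) = (2 * t - 3, 4, 1)) \<or>
     d = 3 * int t + 1 \<and> ((a, b, c) = (2 * t - 1, 0, 5) \<or> (a, b, c) = (2 * t - 2, 3, 2)) \<or>
     d = 3 * int t + 2 \<and> ((a, b, c) = (2 * t - 1, 2, 3) \<or> (a, b, c) = (2 * t - 2, 5, 0))"
    using type321_eq_cases[OF assms(2) e] by blast
  then show ?thesis
    unfolding abc by (intro exI[of _ t]) (elim disjE conjE; simp)
qed

section \<open>Existence of the six families\<close>

lemma attains_proper: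
  assumes "attains TYPE('k::alg_closed_field) d M" "homaloidal_type (int d, image_mset int M)"
  shows "proper_homaloidal_type TYPE('k) (int d, image_mset int M)"
proof -
  obtain F :: "'k form_triple" and \<mu> where F: "realizes d F \<mu>" "mults \<mu> = M"
    using assms(1) by (auto simp: attains_def)
  then show ?thesis
    using realizes_imp_plane_cremona[OF F(1)] realizes_imp_has_type[OF F(1)] assms(2)
    unfolding proper_homaloidal_type_def F(2) by blast
qed

lemma ladder_proper:
  assumes base: "attains TYPE('k::alg_closed_field) (m + 3) (add_mset m (replicate_mset a 3 + replicate_mset b 2 + replicate_mset c 1))"
    and m: "0 < m" "3 * a + 2 * b + c = 2 * m + 6" "9 * a + 4 * b + c = 6 * m + 8"
    and d: "d = int m + 3 * int n + 3" and k: "k = 2 * n + a"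
  shows "proper_homaloidal_type TYPE('k) (type321 d (d - 3) k b c)"
proof -
  let ?M = "add_mset (m + 3 * n) (replicate_mset (2 * n) 3 + (replicate_mset a 3 + replicate_mset b 2 + replicate_mset c 1))"
  have rep: "replicate_mset (2 * n) 3 + (replicate_mset a 3 + replicate_mset b 2 + replicate_mset c 1) =
      replicate_mset k (3::nat) + replicate_mset b 2 + replicate_mset c 1"
    by (rule multiset_eqI) (simp add: k)
  have d': "int (m + 3 * n + 3) = d" "int (m + 3 * n) = d - 3" using d by simp_all
  have eq: "(int (m + 3 * n + 3), image_mset int ?M) = type321 d (d - 3) k b c"
    unfolding rep type321_def by (simp add: d)
  have "homaloidal_type (type321 d (d - 3) k b c)"
    unfolding homaloidal_type321 using m d k by simp
  then show ?thesis
    using attains_proper[OF attains_ladder[OF base m(1), of n]] unfolding eq by blast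
qed

text \<open>
Starting from the identity, the steps are \<open>(1) \<rightarrow> (2; 1\<^sup>3) \<rightarrow> (3; 2, 1\<^sup>4)\<close> with \<open>m = 0\<close> and \<open>m = 1\<close>; then
\<open>m = 0\<close>, 2, 1 from the cubic type and \<open>m = 0\<close> from the quadratic type.
\<close>

lemma attains_small:
  "attains TYPE('k::alg_closed_field) 6 {#3, 3, 3, 2, 1, 1, 1, 1#}"
  "attains TYPE('k) 4 {#3, 1, 1, 1, 1, 1, 1#}"
  "attains TYPE('k) 4 {#2, 2, 2, 1, 1, 1#}"
  "attains TYPE('k) 5 {#3, 2, 2, 2, 1, 1, 1#}"
proof -
  have 2: "attains TYPE('k) 2 {#1, 1, 1#}"
    using attains_step[OF attains_identity, of 0] by auto
  have 3: "attains TYPE('k) 3 {#2, 1, 1, 1, 1#}"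
    using attains_step[OF 2, of 1] by (auto simp: add_mset_commute)
  show "attains TYPE('k) 6 {#3, 3, 3, 2, 1, 1, 1, 1#}"
    using attains_step[OF 3, of 0] by (auto simp: add_mset_commute)
  show "attains TYPE('k) 4 {#3, 1, 1, 1, 1, 1, 1#}"
    using attains_step[OF 3, of 2] by (auto simp: add_mset_commute)
  show "attains TYPE('k) 4 {#2, 2, 2, 1, 1, 1#}"
    using attains_step[OF 2, of 0] by (auto simp: add_mset_commute)
  show "attains TYPE('k) 5 {#3, 2, 2, 2, 1, 1, 1#}"
    using attains_step[OF 3, of 1] by (auto simp: add_mset_commute)
qed

lemma six_families_proper:
  fixes t :: nat
  assumes t: "t \<ge> 2"
  shows "d = 3 * int t \<Longrightarrow> proper_homaloidal_type TYPE('k::alg_closed_field) (type321 d (d - 3) (2 * t - 2) 1 4)"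
    and "d = 3 * int t \<Longrightarrow> proper_homaloidal_type TYPE('k) (type321 d (d - 3) (2 * t - 3) 4 1)"
    and "d = 3 * int t + 1 \<Longrightarrow> proper_homaloidal_type TYPE('k) (type321 d (d - 3) (2 * t - 1) 0 5)"
    and "d = 3 * int t + 1 \<Longrightarrow> proper_homaloidal_type TYPE('k) (type321 d (d - 3) (2 * t - 2) 3 2)"
    and "d = 3 * int t + 2 \<Longrightarrow> proper_homaloidal_type TYPE('k) (type321 d (d - 3) (2 * t - 1) 2 3)"
    and "d = 3 * int t + 2 \<Longrightarrow> proper_homaloidal_type TYPE('k) (type321 d (d - 3) (2 * t - 2) 5 0)"
proof -
  note small = attains_small[where ?'k = 'k] attains_quintic_sextic[where ?'a = 'k]
  show "proper_homaloidal_type TYPE('k) (type321 d (d - 3) (2 * t - 2) 1 4)" if "d = 3 * int t"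
    by (rule ladder_proper[where m = 3 and a = 2 and n = "t - 2"])
      (use t that small(1) in \<open>simp_all add: eval_nat_numeral add_mset_commute\<close>)
  show "proper_homaloidal_type TYPE('k) (type321 d (d - 3) (2 * t - 3) 4 1)" if "d = 3 * int t"
    by (rule ladder_proper[where m = 3 and a = 1 and n = "t - 2"])
      (use t that small(6) in \<open>simp_all add: eval_nat_numeral add_mset_commute\<close>)
  show "proper_homaloidal_type TYPE('k) (type321 d (d - 3) (2 * t - 1) 0 5)" if "d = 3 * int t + 1"
    by (rule ladder_proper[where m = 1 and a = 1 and n = "t - 1"])
      (use t that small(2) in \<open>simp_all add: eval_nat_numeral add_mset_commute\<close>)
  show "proper_homaloidal_type TYPE('k) (type321 d (d - 3) (2 * t - 2) 3 2)" if "d = 3 * int t + 1"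
    by (rule ladder_proper[where m = 1 and a = 0 and n = "t - 1"])
      (use t that small(3) in \<open>simp_all add: eval_nat_numeral add_mset_commute\<close>)
  show "proper_homaloidal_type TYPE('k) (type321 d (d - 3) (2 * t - 1) 2 3)" if "d = 3 * int t + 2"
    by (rule ladder_proper[where m = 2 and a = 1 and n = "t - 1"])
      (use t that small(4) in \<open>simp_all add: eval_nat_numeral add_mset_commute\<close>)
  show "proper_homaloidal_type TYPE('k) (type321 d (d - 3) (2 * t - 2) 5 0)" if "d = 3 * int t + 2"
    by (rule ladder_proper[where m = 2 and a = 0 and n = "t - 1"])
      (use t that small(5) in \<open>simp_all add: eval_nat_numeral add_mset_commute\<close>)
qed

theorem proposition3p2:
  shows
   "(\<forall>d M. proper_homaloidal_type TYPE('k::alg_closed_field) (d, M) \<and> d \<ge> 6 \<and> Max_mset M = d - 3 \<longrightarrow>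
       (\<exists>t::nat. t \<ge> 2 \<and>
         (d = 3 * int t \<and>
            ((d, M) = type321 d (d - 3) (2 * t - 2) 1 4 \<or>
             (d, M) = type321 d (d - 3) (2 * t - 3) 4 1) \<or>
          d = 3 * int t + 1 \<and>
            ((d, M) = type321 d (d - 3) (2 * t - 1) 0 5 \<or>
             (d, M) = type321 d (d - 3) (2 * t - 2) 3 2) \<or>
          d = 3 * int t + 2 \<and>
            ((d, M) = type321 d (d - 3) (2 * t - 1) 2 3 \<or>
             (d, M) = type321 d (d - 3) (2 * t - 2) 5 0)))) \<and>
    (\<forall>(t::nat) d. t \<ge> 2 \<longrightarrow>
       (d = 3 * int t \<longrightarrow>
          proper_homaloidal_type TYPE('k) (type321 d (d - 3) (2 * t - 2) 1 4) \<and>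
          proper_homaloidal_type TYPE('k) (type321 d (d - 3) (2 * t - 3) 4 1)) \<and>
       (d = 3 * int t + 1 \<longrightarrow>
          proper_homaloidal_type TYPE('k) (type321 d (d - 3) (2 * t - 1) 0 5) \<and>
          proper_homaloidal_type TYPE('k) (type321 d (d - 3) (2 * t - 2) 3 2)) \<and>
       (d = 3 * int t + 2 \<longrightarrow>
          proper_homaloidal_type TYPE('k) (type321 d (d - 3) (2 * t - 1) 2 3) \<and>
          proper_homaloidal_type TYPE('k) (type321 d (d - 3) (2 * t - 2) 5 0)))"
  by (intro conjI allI impI; (elim conjE, rule six_types; assumption)?; (rule six_families_proper; assumption)?)

end
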